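(* Let $\alpha,\beta,k>0$ and $T_m\in\mathbb{R}$. Consider the closed-loop system consisting of: (i) the one-phase Stefan problem $$T_t(x,t)=\alpha T_{xx}(x,t)\ \ (0\le x\le s(t)),\qquad -kT_x(0,t)=q_c(t),\qquad T(s(t),t)=T_m,\qquad \dot s(t)=-\beta T_x(s(t),t),$$ with $T(x,0)=T_0(x)$, $s(0)=s_0$, and measurement $Y(t)=s(t)$; (ii) the observer, for $x\in[0,s(t)]$, $$\hat T_t(x,t)=\alpha\hat T_{xx}(x,t)-P_1(x,s(t))\left(\frac{\dot Y(t)}{\beta}+\hat T_x(s(t),t)\right),\qquad -k\hat T_x(0,t)=q_c(t),\qquad \hat T(s(t),t)=T_m,$$ with $\hat T(x,0)=\hat T_0(x)$ and $$P_1(x,s(t))=-\lambda s(t)\,\frac{I_1\!\left(\sqrt{\frac{\lambda}{\alpha}\left(s(t)^2-x^2\right)}\right)}{\sqrt{\frac{\lambda}{\alpha}\left(s(t)^2-x^2\right)}},\qquad \lambda>0;$$ (iii) the output feedback control law, with controller gain $c>0$ and setpoint $s_r$, $$q_c(t)=-ck\left(\frac1\alpha\int_0^{Y(t)}\left(\hat T(x,t)-T_m\right)dx+\frac1\beta\left(Y(t)-s_r\right)\right).$$ Assume that the initial values $(\hat T_0,s_0)$ are compatible with the control law, that $s_0>0$, and that the initial plant states $(T_0,s_0)$ satisfy $$0\le T_0(x)-T_m\le H(s_0-x),\qquad x\in[0,s_0],$$ with a known constant $H>0$. Suppose that, for some choice of a parameter $\hat H>H$, the initial temperature estimate $\hat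 T_0$, the observer gain parameter $\lambda$ and the setpoint $s_r$ satisfy $$\hat T_0(x)=T_m+\hat H(s_0-x),\qquad \lambda<\frac{4\alpha}{s_0^2}\left(1-\frac{H}{\hat H}\right),\qquad s_r>s_0+\frac{\beta s_0^2}{2\alpha}\hat H .$$ Then the closed-loop system is exponentially stable in the sense of the norm $$\|T-\hat T\|_{\mathcal{H}_1}^2+\|T-T_m\|_{\mathcal{H}_1}^2+(s(t)-s_r)^2 .$$
   Context: Physical meaning of constants: $\alpha=k/(\rho C_p)$ and $\beta=k/(\rho\Delta H^* )$, with positive constants $\rho$ (density), $C_p$ (heat capacity), $k$ (heat conductivity), $\Delta H^*$ (latent heat of fusion); $T_m$ is the melting temperature. Solutions are understood as classical solutions on the moving domain $\{(x,t):0\le x\le s(t),\ t\ge0\}$. $I_1$ is the modified Bessel function of the first kind of order $1$; the quotient $I_1(z)/z$ is extended by its limit $1/2$ at $z=0$. Compatibility of the initial values $(\hat T_0,s_0)$ with the control law means that the boundary conditions of the observer hold at $t=0$, i.e. $\hat T_0(s_0)=T_m$ and $-k\hat T_0'(0)=q_c(0)$, where $q_c(0)$ is given by the control law evaluated at $(\hat T_0,s_0)$. For a function $f(\cdot,t)$ on $[0,s(t)]$, $\|f\|_{\mathcal{H}_1}^2=\int_0^{s(t)}\left(f(x,t)^2+f_x(x,t)^2\right)dx$. Exponential stability in the sense of a (squared) norm $N(t)$ means: there exist constants $M,\kappa>0$, independent of $t$ and of the admissible initial data (they may depend on the physical parameters, the gains $c,\lambda$ and the setpoint $s_r$), such that $N(t)\le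 M e^{-\kappa t}N(0)$ for all $t\ge0$. *)

theory Defs
  imports "HOL-Analysis.Analysis"
begin

definition bessel_I :: "nat \<Rightarrow> real \<Rightarrow> real" where
  "bessel_I n z = (\<Sum>m. (z / 2) ^ (2 * m + n) / (fact m * fact (m + n)))"

text \<open>The quotient I_1(z) / z, extended by its limit at 0.\<close>

definition bessel_I1_quot :: "real \<Rightarrow> real" where
  "bessel_I1_quot z = (if z = 0 then 1 / 2 else bessel_I 1 z / z)"

text \<open>Fields are written f x t (space first, then time). Only their values on the moving domain
  matter, so space derivatives are one-sided at the two ends of the interval [0, s(t)].\<close>

definition moving_domain :: "(real \<Rightarrow> real) \<Rightarrow> (real \<times> real) set" where
  "moving_domain s = {(x, t). 0 \<le> t \<and> 0 \<le> x \<and> x \<le> s t}"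

definition space_deriv :: "(real \<Rightarrow> real) \<Rightarrow> (real \<Rightarrow> real \<Rightarrow> real) \<Rightarrow> real \<Rightarrow> real \<Rightarrow> real" where
  "space_deriv s f x t = vector_derivative (\<lambda>y. f y t) (at x within {0..s t})"

text \<open>Regularity of a classical solution: the field and its first space derivative are continuous
  up to the initial time, the second space derivative is continuous up to both boundaries for
  positive times. (Continuity of the time derivative then follows from the differential equation.)
  Second derivatives are not asked for at time 0: for the linear initial estimate used with the
  observer they could not be continuous at the interface there.
  Since no compatibility of the initial plant temperature with the heat input is assumed, the first
  space derivative may jump at the corner (x, t) = (0, 0); it is only required to be bounded
  there.\<close>

definition classical_field :: "(real \<Rightarrow> real) \<Rightarrow> (real \<Rightarrow> real \<Rightarrow> real) \<Rightarrow> bool" where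
  "classical_field s f \<longleftrightarrow>
     continuous_on (moving_domain s) (\<lambda>(x, t). f x t) \<and>
     (\<forall>(x, t) \<in> moving_domain s. (\<lambda>y. f y t) differentiable (at x within {0..s t})) \<and>
     continuous_on (moving_domain s - {(0, 0)}) (\<lambda>(x, t). space_deriv s f x t) \<and>
     (\<exists>B. \<forall>(x, t) \<in> moving_domain s. t \<le> 1 \<longrightarrow> \<bar>space_deriv s f x t\<bar> \<le> B) \<and>
     (\<forall>(x, t) \<in> moving_domain s. 0 < t \<longrightarrow>
        (\<lambda>y. space_deriv s f y t) differentiable (at x within {0..s t})) \<and>
     continuous_on {(x, t) \<in> moving_domain s. 0 < t}
       (\<lambda>(x, t). space_deriv s (space_deriv s f) x t)"

text \<open>The differential equation f_t = r, for t > 0 and x in [0, s(t)]. The time derivative is taken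
  within the times at which x lies in the domain, hence is one-sided at the interface when the
  interface moves.\<close>

definition evolves_by ::
    "(real \<Rightarrow> real) \<Rightarrow> (real \<Rightarrow> real \<Rightarrow> real) \<Rightarrow> (real \<Rightarrow> real \<Rightarrow> real) \<Rightarrow> bool" where
  "evolves_by s f r \<longleftrightarrow>
     (\<forall>(x, t) \<in> moving_domain s. 0 < t \<longrightarrow>
        ((\<lambda>\<tau>. f x \<tau>) has_real_derivative r x t) (at t within {\<tau>. (x, \<tau>) \<in> moving_domain s}))"

definition stefan_solution ::
    "real \<Rightarrow> real \<Rightarrow> real \<Rightarrow> real \<Rightarrow> (real \<Rightarrow> real) \<Rightarrow> real \<Rightarrow> (real \<Rightarrow> real)
       \<Rightarrow> (real \<Rightarrow> real) \<Rightarrow> (real \<Rightarrow> real \<Rightarrow> real) \<Rightarrow> bool" where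
  "stefan_solution \<alpha> \<beta> k Tm q s0 T0 s T \<longleftrightarrow>
     (\<forall>t\<ge>0. 0 < s t) \<and>
     classical_field s T \<and>
     evolves_by s T (\<lambda>x t. \<alpha> * space_deriv s (space_deriv s T) x t) \<and>
     (\<forall>t>0. - k * space_deriv s T 0 t = q t) \<and>
     (\<forall>t\<ge>0. T (s t) t = Tm) \<and>
     (\<forall>t\<ge>0. (s has_real_derivative (- \<beta> * space_deriv s T (s t) t)) (at t within {0..})) \<and>
     s 0 = s0 \<and>
     (\<forall>x\<in>{0..s0}. T x 0 = T0 x)"

definition observer_gain :: "real \<Rightarrow> real \<Rightarrow> real \<Rightarrow> real \<Rightarrow> real" where
  "observer_gain \<alpha> lam x L = - lam * L * bessel_I1_quot (sqrt (lam / \<alpha> * (L\<^sup>2 - x\<^sup>2)))"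

text \<open>The measurement Y is the interface position, so Y also delimits the domain of the
  observer.\<close>

definition observer_solution ::
    "real \<Rightarrow> real \<Rightarrow> real \<Rightarrow> real \<Rightarrow> real \<Rightarrow> (real \<Rightarrow> real) \<Rightarrow> (real \<Rightarrow> real)
       \<Rightarrow> (real \<Rightarrow> real) \<Rightarrow> (real \<Rightarrow> real \<Rightarrow> real) \<Rightarrow> bool" where
  "observer_solution \<alpha> \<beta> k Tm lam q That0 Y That \<longleftrightarrow>
     classical_field Y That \<and>
     evolves_by Y That (\<lambda>x t. \<alpha> * space_deriv Y (space_deriv Y That) x t
        - observer_gain \<alpha> lam x (Y t) * (deriv Y t / \<beta> + space_deriv Y That (Y t) t)) \<and>
     (\<forall>t>0. - k * space_deriv Y That 0 t = q t) \<and>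
     (\<forall>t\<ge>0. That (Y t) t = Tm) \<and>
     (\<forall>x\<in>{0..Y 0}. That x 0 = That0 x)"

text \<open>The heat input commanded for the temperature estimate g on [0, L] and interface position
  L.\<close>

definition control_law ::
    "real \<Rightarrow> real \<Rightarrow> real \<Rightarrow> real \<Rightarrow> real \<Rightarrow> real \<Rightarrow> (real \<Rightarrow> real) \<Rightarrow> real \<Rightarrow> real" where
  "control_law \<alpha> \<beta> k Tm c s_r g L =
     - c * k * (1 / \<alpha> * integral {0..L} (\<lambda>x. g x - Tm) + 1 / \<beta> * (L - s_r))"

definition compatible ::
    "real \<Rightarrow> real \<Rightarrow> real \<Rightarrow> real \<Rightarrow> real \<Rightarrow> real \<Rightarrow> (real \<Rightarrow> real) \<Rightarrow> real \<Rightarrow> bool" where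
  "compatible \<alpha> \<beta> k Tm c s_r That0 s0 \<longleftrightarrow>
     That0 s0 = Tm \<and>
     - k * vector_derivative That0 (at 0 within {0..s0}) = control_law \<alpha> \<beta> k Tm c s_r That0 s0"

definition closed_loop_solution ::
    "real \<Rightarrow> real \<Rightarrow> real \<Rightarrow> real \<Rightarrow> real \<Rightarrow> real \<Rightarrow> real \<Rightarrow> real \<Rightarrow> (real \<Rightarrow> real) \<Rightarrow> (real \<Rightarrow> real)
       \<Rightarrow> (real \<Rightarrow> real) \<Rightarrow> (real \<Rightarrow> real \<Rightarrow> real) \<Rightarrow> (real \<Rightarrow> real \<Rightarrow> real) \<Rightarrow> bool" where
  "closed_loop_solution \<alpha> \<beta> k Tm c lam s_r s0 T0 That0 s T That \<longleftrightarrow>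
     (let q = (\<lambda>t. control_law \<alpha> \<beta> k Tm c s_r (\<lambda>x. That x t) (s t))
      in stefan_solution \<alpha> \<beta> k Tm q s0 T0 s T \<and>
         observer_solution \<alpha> \<beta> k Tm lam q That0 s That)"

definition h1_norm_sq :: "(real \<Rightarrow> real) \<Rightarrow> (real \<Rightarrow> real \<Rightarrow> real) \<Rightarrow> real \<Rightarrow> real" where
  "h1_norm_sq s f t = integral {0..s t} (\<lambda>x. (f x t)\<^sup>2 + (space_deriv s f x t)\<^sup>2)"

definition closed_loop_norm ::
    "real \<Rightarrow> real \<Rightarrow> (real \<Rightarrow> real) \<Rightarrow> (real \<Rightarrow> real \<Rightarrow> real) \<Rightarrow> (real \<Rightarrow> real \<Rightarrow> real) \<Rightarrow> real \<Rightarrow> real"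
    where
  "closed_loop_norm Tm s_r s T That t =
     h1_norm_sq s (\<lambda>x t. T x t - That x t) t + h1_norm_sq s (\<lambda>x t. T x t - Tm) t + (s t - s_r)\<^sup>2"

end

theory Submission
  imports Defs
begin

text \<open>Write \<open>u = T - Tm\<close> for the temperature, \<open>p = That - T\<close> for the observer error, \<open>b = q_c / k\<close> for the
heat input and \<open>a = lam / (4 \<alpha>)\<close>. The argument first finds signs and then uses them in energy
estimates.

Signs. The error satisfies \<open>p_t = \<alpha> p_xx + 2 \<alpha> s l(s^2 - x^2) p_x(s, t)\<close> with a positive kernel
\<open>l\<close> of type \<open>I_1\<close>: a heat equation with a nonlocal source, driven by the flux at the interface, whose
sign is the wrong one for a maximum principle. A Volterra map \<open>p \<mapsto> w = p + V p\<close> with a kernel of type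
\<open>J_1\<close> turns it into \<open>w_t = \<alpha> w_xx - lam w\<close> with the same boundary conditions (lemmas
\<open>bkernel_resolvent\<close> and \<open>volterra_commutator\<close>). The upper bound on \<open>lam\<close> makes \<open>w\<close> nonnegative
initially, hence always. As \<open>w\<close> and \<open>p\<close> have the same flux at the interface, \<open>p_x(s, t) \<le> 0\<close>; as the
inverse map has the nonnegative kernel \<open>l\<close>, also \<open>p \<ge> 0\<close> (lemma \<open>observer_error_sign\<close>). The control law
gives \<open>b' = - c b - c \<mu> p_x(s, t)\<close> with \<open>\<mu> \<ge> 0\<close>, so \<open>b\<close> stays nonnegative. Therefore \<open>u \<ge> 0\<close>, the
interface advances, and it cannot pass \<open>s_r\<close>.

Energies. Once the signs are known, the source in the error equation is dissipative and no further
transformation is needed. The integral of \<open>p^2\<close> is dissipated at the rate of the integral of \<open>p_x^2\<close>, which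
itself grows at most at a bounded rate. The energy balance \<open>E = (\<integral> u) / \<alpha> + (s - s_r) / \<beta>\<close> satisfies
\<open>E' = b = - c E - c (\<integral> p) / \<alpha>\<close>, so it is damped up to the observer error. Finally \<open>u\<close> solves the heat
equation with boundary input \<open>b\<close>; the uncontrolled boundary term \<open>u_x(0, t) u_t(0, t)\<close> in the derivative
of the integral of \<open>u_x^2\<close> disappears when \<open>2 b(t) u(0, t)\<close> is subtracted from that integral. A weighted
sum of these quantities is a Lyapunov function equivalent to the squared norm (lemma
\<open>lyapunov_decay\<close>). Its constants depend on the parameters only because \<open>0 < s \<le> s_r\<close>.

Two points need care for solutions of the given regularity. The mixed derivative \<open>u_xt\<close> need not exist,
so the integral of \<open>u_x^2\<close> is differentiated through difference quotients after rescaling to \<open>[0, 1]\<close>.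
And no equation holds at time 0, so the energies are shown to be continuous there, across a possible
jump of the flux at the corner.\<close>

section \<open>Preliminaries\<close>

lemma has_integral_derivative:
  fixes g g' :: "real \<Rightarrow> real"
  assumes "a \<le> b" "\<And>x. x \<in> {a..b} \<Longrightarrow> (g has_real_derivative g' x) (at x within {a..b})"
  shows "(g' has_integral g b - g a) {a..b}"
  using fundamental_theorem_of_calculus[of a b g g'] assms by (simp add: has_real_derivative_iff_has_vector_derivative)

lemma continuous_on_compose_field:
  assumes "continuous_on D (\<lambda>(x, t). f x t)" "continuous_on S g" "continuous_on S h" "\<And>z. z \<in> S \<Longrightarrow> (g z, h z) \<in> D"
  shows "continuous_on S (\<lambda>z. f (g z) (h z))"
  using continuous_on_compose2[OF assms(1) continuous_on_Pair[OF assms(2,3)]] assms(4) by fastforce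

section \<open>A Bessel series and its kernels\<close>

text \<open>Up to a power of \<open>z\<close> this is the Bessel function \<open>I_j (2 sqrt z)\<close>, and \<open>J_j (2 sqrt (- z))\<close> for negative \<open>z\<close>.
In the variable \<open>z\<close> it is entire, so one family serves both signs of the kernel, and differentiation
only raises \<open>j\<close>.\<close>

definition bessel_series :: "nat \<Rightarrow> real \<Rightarrow> real" where
  "bessel_series j z = (\<Sum>m. z ^ m / (fact m * fact (m + j)))"

lemma summable_bessel_series: "summable (\<lambda>m. z ^ m / (fact m * fact (m + j)) :: real)"
proof (rule summable_comparison_test[OF _ summable_norm_exp[of z]], intro exI allI impI)
  fix n :: nat
  have "norm (z ^ n / (fact n * fact (n + j))) = \<bar>z\<bar> ^ n / fact n / fact (n + j)"
    by (simp add: abs_mult power_abs)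
  also have "\<dots> \<le> \<bar>z\<bar> ^ n / fact n / 1"
    by (intro divide_left_mono) auto
  finally show "norm (z ^ n / (fact n * fact (n + j))) \<le> norm (z ^ n /\<^sub>R fact n)"
    by (simp add: abs_mult power_abs divide_inverse mult.commute)
qed

lemma bessel_series_0 [simp]: "bessel_series j 0 = 1 / fact j"
  using powser_zero[of "\<lambda>m. 1 / (fact m * fact (m + j)) :: real"] by (simp add: bessel_series_def)

lemma DERIV_bessel_series: "(bessel_series j has_real_derivative bessel_series (Suc j) z) (at z)"
proof -
  have "((\<lambda>z. \<Sum>m. (1 / (fact m * fact (m + j))) * z ^ m) has_real_derivative
          (\<Sum>m. diffs (\<lambda>m. 1 / (fact m * fact (m + j))) m * z ^ m)) (at z)"
    by (rule termdiffs_strong_converges_everywhere) (use summable_bessel_series[of _ j] in simp)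
  also have "(\<lambda>m. diffs (\<lambda>m. 1 / (fact m * fact (m + j))) m * z ^ m)
     = (\<lambda>m. z ^ m / (fact m * fact (m + Suc j)))"
    by (auto simp: fun_eq_iff diffs_def field_simps simp del: of_nat_Suc)
  finally show ?thesis unfolding bessel_series_def[abs_def] by simp
qed

lemma bessel_series_recurrence:
  "z * bessel_series (Suc (Suc j)) z + real (Suc j) * bessel_series (Suc j) z = bessel_series j z"
proof -
  let ?c = "\<lambda>i m. z ^ m / (fact m * fact (m + i)) :: real"
  have 1: "(\<lambda>m. z * ?c (Suc (Suc j)) m) sums (z * bessel_series (Suc (Suc j)) z)"
    unfolding bessel_series_def by (intro sums_mult summable_sums summable_bessel_series)
  have 2: "(\<lambda>m. if m = 0 then 0 else z * ?c (Suc (Suc j)) (m - 1)) sums (z * bessel_series (Suc (Suc j)) z)"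
    by (rule sums_Suc_imp[THEN sums_cong[THEN iffD1, rotated]]) (use 1 in auto)
  have 3: "(\<lambda>m. real (Suc j) * ?c (Suc j) m) sums (real (Suc j) * bessel_series (Suc j) z)"
    unfolding bessel_series_def by (intro sums_mult summable_sums summable_bessel_series)
  have "(if m = 0 then 0 else z * ?c (Suc (Suc j)) (m - 1)) + real (Suc j) * ?c (Suc j) m = ?c j m" for m
  proof (cases m)
    case 0
    then show ?thesis by (simp del: of_nat_Suc)
  next
    case (Suc n)
    define F where "F = (fact (n + j + 1) :: real)"
    define G where "G = (fact n :: real)"
    have [simp]: "F > 0" "G > 0" by (auto simp: F_def G_def)
    have e1: "fact (n + Suc (Suc j)) = (real n + real j + 2) * F" "fact (Suc n + Suc j) = (real n + real j + 2) * F"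
       "fact (Suc n + j) = F" "fact (Suc n) = (real n + 1) * G"
      by (simp_all add: F_def G_def algebra_simps)
    have pos: "real n + real j + 2 > 0" "real n + 1 > 0" by linarith+
    have "z * (z ^ n / (G * ((real n + real j + 2) * F))) + (real j + 1) * (z ^ Suc n / ((real n + 1) * G * ((real n + real j + 2) * F)))
       = z ^ Suc n / ((real n + 1) * G * F)"
      using pos by (simp add: divide_simps add_pos_pos del: of_nat_Suc) (simp add: algebra_simps)
    then show ?thesis unfolding Suc
      by (simp only: e1 diff_Suc_1 nat.distinct if_False) (simp add: G_def[symmetric] add.commute)
  qed
  with sums_add[OF 2 3] have "?c j sums (z * bessel_series (Suc (Suc j)) z + real (Suc j) * bessel_series (Suc j) z)"
    by simp
  moreover have "?c j sums bessel_series j z"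
    unfolding bessel_series_def by (intro summable_sums summable_bessel_series)
  ultimately show ?thesis by (rule sums_unique2)
qed

lemma bessel_series_ge_0: "0 \<le> z \<Longrightarrow> 0 \<le> bessel_series j z"
  unfolding bessel_series_def by (intro suminf_nonneg summable_bessel_series) auto

lemma bessel_series_mono: "0 \<le> z \<Longrightarrow> z \<le> w \<Longrightarrow> bessel_series j z \<le> bessel_series j w"
  unfolding bessel_series_def
  by (intro suminf_le summable_bessel_series divide_right_mono power_mono) auto

text \<open>For \<open>z \<le> 1\<close> the series is alternating with decreasing terms, hence bounded by its first term.\<close>

lemma bessel_series_minus_le:
  assumes "0 \<le> z" "z \<le> 1"
  shows "bessel_series j (- z) \<le> 1 / fact j"
proof -
  let ?a = "\<lambda>m. z ^ m / (fact m * fact (m + j)) :: real"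
  have "(\<Sum>m. (-1) ^ m * ?a m) \<le> (\<Sum>m<2*0+1. (-1) ^ m * ?a m)"
  proof (rule summable_Leibniz'(4))
    show "?a \<longlonglongrightarrow> 0" by (rule summable_LIMSEQ_zero[OF summable_bessel_series])
    show "0 \<le> ?a n" for n using assms by simp
    show "?a (Suc n) \<le> ?a n" for n
      using assms by (intro frac_le mult_mono power_decreasing fact_mono) auto
  qed
  also have "(\<Sum>m. (-1) ^ m * ?a m) = bessel_series j (- z)"
    unfolding bessel_series_def
    by (intro arg_cong[where f=suminf] ext) (subst power_minus, simp)
  finally show ?thesis by simp
qed

lemma bessel_I1_quot_sqrt:
  assumes "0 \<le> w"
  shows "bessel_I1_quot (sqrt w) = bessel_series 1 (w / 4) / 2"
proof (cases "w = 0")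
  case False
  have "bessel_I 1 (sqrt w) = (\<Sum>m. sqrt w / 2 * ((w / 4) ^ m / (fact m * fact (m + 1))))"
    unfolding bessel_I_def
  proof (intro arg_cong[where f=suminf] ext)
    fix m :: nat
    have "(sqrt w / 2) ^ (2 * m + 1) = sqrt w / 2 * ((sqrt w / 2)\<^sup>2) ^ m"
      by (simp add: power_mult)
    also have "(sqrt w / 2)\<^sup>2 = w / 4" using assms by (simp add: power_divide)
    finally show "(sqrt w / 2) ^ (2 * m + 1) / (fact m * fact (m + 1)) =
        sqrt w / 2 * ((w / 4) ^ m / (fact m * fact (m + 1)))" by simp
  qed
  also have "\<dots> = sqrt w / 2 * bessel_series 1 (w / 4)"
    unfolding bessel_series_def by (rule suminf_mult[OF summable_bessel_series])
  finally show ?thesis using False by (simp add: bessel_I1_quot_def)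
qed (simp add: bessel_I1_quot_def)

text \<open>For \<open>a > 0\<close> this is the kernel behind the observer gain, for \<open>a < 0\<close> that of the transformation removing it:
if \<open>J\<close> denotes integration against \<open>2 y dy\<close> from \<open>x\<close> to \<open>s\<close>, then the Volterra operator with this kernel
is \<open>exp (a J) - 1\<close>.\<close>

definition bkernel :: "real \<Rightarrow> real \<Rightarrow> real" where
  "bkernel a \<zeta> = a * bessel_series 1 (a * \<zeta>)"
definition bkernel' :: "real \<Rightarrow> real \<Rightarrow> real" where
  "bkernel' a \<zeta> = a\<^sup>2 * bessel_series 2 (a * \<zeta>)"
definition bkernel'' :: "real \<Rightarrow> real \<Rightarrow> real" where
  "bkernel'' a \<zeta> = a ^ 3 * bessel_series 3 (a * \<zeta>)"

lemma bkernel_0 [simp]: "bkernel a 0 = a" by (simp add: bkernel_def)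

lemma DERIV_bkernel: "(bkernel a has_real_derivative bkernel' a \<zeta>) (at \<zeta>)"
  unfolding bkernel_def[abs_def] bkernel'_def
  by (rule derivative_eq_intros DERIV_chain2[OF DERIV_bessel_series] refl)+ (simp add: power2_eq_square numeral_2_eq_2)

lemma DERIV_bkernel': "(bkernel' a has_real_derivative bkernel'' a \<zeta>) (at \<zeta>)"
  unfolding bkernel'_def[abs_def] bkernel''_def
  by (rule derivative_eq_intros DERIV_chain2[OF DERIV_bessel_series] refl)+ (simp add: power2_eq_square power3_eq_cube numeral_3_eq_3 numeral_2_eq_2)

lemma continuous_on_bessel_series: "continuous_on S (bessel_series j)"
  by (meson DERIV_bessel_series DERIV_isCont continuous_at_imp_continuous_on)

lemma continuous_on_bkernel [continuous_intros]:
  assumes "continuous_on S f"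
  shows "continuous_on S (\<lambda>x. bkernel a (f x))" "continuous_on S (\<lambda>x. bkernel' a (f x))" "continuous_on S (\<lambda>x. bkernel'' a (f x))"
  unfolding bkernel_def bkernel'_def bkernel''_def
  by (intro continuous_intros assms continuous_on_compose2[OF continuous_on_bessel_series[of UNIV]]; simp)+

lemma bkernel_ode: "\<zeta> * bkernel'' a \<zeta> + 2 * bkernel' a \<zeta> = a * bkernel a \<zeta>"
proof -
  have "a\<^sup>2 * (a * \<zeta> * bessel_series 3 (a * \<zeta>) + 2 * bessel_series 2 (a * \<zeta>)) = a\<^sup>2 * bessel_series 1 (a * \<zeta>)"
    using bessel_series_recurrence[of "a * \<zeta>" 1] by (simp add: numeral_3_eq_3 numeral_2_eq_2)
  then show ?thesis
    by (simp add: bkernel_def bkernel'_def bkernel''_def power2_eq_square power3_eq_cube algebra_simps)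
qed

text \<open>The identity \<open>exp (- a J) exp (a J) = 1\<close> on the level of kernels. In the variable \<open>e = y^2 - x^2\<close> it is a
convolution of solutions of two Bessel equations with opposite parameters, and such a product is the
derivative of a Wronskian.\<close>

lemma bkernel_resolvent:
  assumes "0 \<le> x" "x \<le> z"
  shows "((\<lambda>y. 2 * y * bkernel (-a) (y\<^sup>2 - x\<^sup>2) * bkernel a (z\<^sup>2 - y\<^sup>2)) has_integral
            - (bkernel a (z\<^sup>2 - x\<^sup>2) + bkernel (-a) (z\<^sup>2 - x\<^sup>2))) {x..z}"
proof (cases "x = z \<or> a = 0")
  case True
  then show ?thesis
    using has_integral_refl(2)[of "\<lambda>y. 2 * y * bkernel (-a) (y\<^sup>2 - x\<^sup>2) * bkernel a (z\<^sup>2 - y\<^sup>2)" x]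
    by (auto simp: bkernel_def)
next
  case False
  define D where "D = z\<^sup>2 - x\<^sup>2"
  have D: "D > 0" unfolding D_def using assms False by (simp add: power2_eq_square mult_strict_mono)
  (* W = F' G - F G' for F(e) = e k(e) and G(e) = (D - e) l(D - e).
     Since F'' = - a k(e) and G'' = a l(D - e), it follows that W' = - a D k(e) l(D - e). *)
  define k l where "k = bkernel (-a)" and "l = bkernel a"
  define k' l' where "k' = bkernel' (-a)" and "l' = bkernel' a"
  define k'' l'' where "k'' = bkernel'' (-a)" and "l'' = bkernel'' a"
  note dk = DERIV_bkernel[of "-a", folded k_def k'_def] and dk' = DERIV_bkernel'[of "-a", folded k'_def k''_def]
  note dl = DERIV_bkernel[of "a", folded l_def l'_def] and dl' = DERIV_bkernel'[of "a", folded l'_def l''_def]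
  define W where "W e = (k e + e * k' e) * ((D - e) * l (D - e)) + (e * k e) * (l (D - e) + (D - e) * l' (D - e))" for e
  have dW: "(W has_real_derivative - a * D * k e * l (D - e)) (at e)" for e
  proof -
    have od: "e * k'' e + 2 * k' e = - a * k e" "(D - e) * l'' (D - e) + 2 * l' (D - e) = a * l (D - e)"
      using bkernel_ode[of e "-a"] bkernel_ode[of "D - e" a] by (simp_all add: k_def l_def k'_def l'_def k''_def l''_def)
    have "(W has_real_derivative
       (k' e + (k' e + e * k'' e)) * ((D - e) * l (D - e)) - (k e + e * k' e) * (l (D - e) + (D - e) * l' (D - e))
       + (k e + e * k' e) * (l (D - e) + (D - e) * l' (D - e))
       - (e * k e) * (l' (D - e) + (l' (D - e) + (D - e) * l'' (D - e)))) (at e)"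
      unfolding W_def[abs_def]
      by (rule derivative_eq_intros DERIV_chain2[OF dk] DERIV_chain2[OF dk'] DERIV_chain2[OF dl] DERIV_chain2[OF dl'] refl)+
         (simp add: algebra_simps)
    also have "(k' e + (k' e + e * k'' e)) * ((D - e) * l (D - e)) - (k e + e * k' e) * (l (D - e) + (D - e) * l' (D - e))
       + (k e + e * k' e) * (l (D - e) + (D - e) * l' (D - e))
       - (e * k e) * (l' (D - e) + (l' (D - e) + (D - e) * l'' (D - e)))
      = (e * k'' e + 2 * k' e) * ((D - e) * l (D - e)) - (e * k e) * ((D - e) * l'' (D - e) + 2 * l' (D - e))"
      by (simp add: algebra_simps)
    also have "\<dots> = - a * D * k e * l (D - e)" unfolding od by (simp add: algebra_simps)
    finally show ?thesis .
  qed
  have "((\<lambda>y. 2 * y * k (y\<^sup>2 - x\<^sup>2) * l (z\<^sup>2 - y\<^sup>2)) has_integral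
           - W (z\<^sup>2 - x\<^sup>2) / (a * D) - (- W (x\<^sup>2 - x\<^sup>2) / (a * D))) {x..z}"
  proof (rule has_integral_derivative)
    fix y assume "y \<in> {x..z}"
    have d: "((\<lambda>y. W (y\<^sup>2 - x\<^sup>2)) has_real_derivative (- a * D * k (y\<^sup>2 - x\<^sup>2) * l (D - (y\<^sup>2 - x\<^sup>2))) * (2 * y)) (at y within {x..z})"
      by (rule DERIV_chain'[OF _ dW]) (auto intro!: derivative_eq_intros)
    show "((\<lambda>y. - W (y\<^sup>2 - x\<^sup>2) / (a * D)) has_real_derivative 2 * y * k (y\<^sup>2 - x\<^sup>2) * l (z\<^sup>2 - y\<^sup>2)) (at y within {x..z})"
    proof (rule DERIV_cong[OF DERIV_cdivide[OF DERIV_minus[OF d], of "a * D"]])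
      have "D - (y\<^sup>2 - x\<^sup>2) = z\<^sup>2 - y\<^sup>2" by (simp add: D_def)
      then show "- (- a * D * k (y\<^sup>2 - x\<^sup>2) * l (D - (y\<^sup>2 - x\<^sup>2)) * (2 * y)) / (a * D) = 2 * y * k (y\<^sup>2 - x\<^sup>2) * l (z\<^sup>2 - y\<^sup>2)"
        using False D by (simp only:) simp
    qed
  qed (use assms in simp)
  also have "- W (z\<^sup>2 - x\<^sup>2) / (a * D) - (- W (x\<^sup>2 - x\<^sup>2) / (a * D)) = - (l D + k D)"
    using False D unfolding D_def[symmetric] W_def by (simp add: k_def l_def field_simps)
  finally show ?thesis by (simp add: k_def l_def D_def)
qed

section \<open>Volterra operators with kernels in y^2 - x^2\<close>

lemma integral_lborel_interval:
  fixes g :: "real \<Rightarrow> real"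
  assumes "integrable lborel (\<lambda>x. indicator {a..b} x * g x)"
  shows "(\<integral>x. indicator {a..b} x * g x \<partial>lborel) = integral {a..b} g"
  using set_borel_integral_eq_integral(2)[of "{a..b}" g] assms by (simp add: set_integrable_def set_lebesgue_integral_def)

lemma integral_triangle_swap:
  fixes F :: "real \<Rightarrow> real \<Rightarrow> real"
  assumes "continuous_on ({x..s} \<times> {x..s}) (\<lambda>(w, y). F w y)"
  shows "integral {x..s} (\<lambda>w. integral {w..s} (F w)) = integral {x..s} (\<lambda>y. integral {x..y} (\<lambda>w. F w y))"
proof -
  define Tr where "Tr = {(w, y). x \<le> w \<and> w \<le> y \<and> y \<le> s}"
  define G where "G w y = indicator Tr (w, y) * F w y" for w y
  have sub: "Tr \<subseteq> {x..s} \<times> {x..s}" by (auto simp: Tr_def)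
  have "closed Tr"
    unfolding Tr_def case_prod_beta by (intro closed_Collect_conj closed_Collect_le continuous_intros)
  moreover have "bounded Tr"
    by (rule bounded_subset[OF _ sub]) (intro bounded_Times bounded_closed_interval)
  ultimately have "compact Tr" by (simp add: compact_eq_bounded_closed)
  then have "integrable lborel (\<lambda>z. indicator Tr z *\<^sub>R (case z of (w, y) \<Rightarrow> F w y))"
    by (rule borel_integrable_compact) (rule continuous_on_subset[OF assms sub])
  then have int: "integrable (lborel \<Otimes>\<^sub>M lborel) (case_prod G)"
    unfolding lborel_prod by (rule back_subst[where P="integrable lborel"]) (auto simp: fun_eq_iff G_def)
  have cont1: "continuous_on {w..s} (F w)" if "x \<le> w" "w \<le> s" for w
    by (rule continuous_on_compose_field[OF assms]) (use that in \<open>auto intro!: continuous_intros\<close>)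
  have cont2: "continuous_on {x..y} (\<lambda>w. F w y)" if "y \<le> s" "x \<le> y" for y
    by (rule continuous_on_compose_field[OF assms]) (use that in \<open>auto intro!: continuous_intros\<close>)
  have L1: "(\<integral>y. G w y \<partial>lborel) = indicator {x..s} w * integral {w..s} (F w)" for w
  proof (cases "x \<le> w \<and> w \<le> s")
    case True
    then have "(\<lambda>y. G w y) = (\<lambda>y. indicator {w..s} y * F w y)"
      by (auto simp: fun_eq_iff G_def Tr_def indicator_def)
    then show ?thesis
      using True integral_lborel_interval[of w s "F w"] borel_integrable_atLeastAtMost'[OF cont1[of w]] by (simp add: set_integrable_def)
  next
    case False
    then have "G w y = 0" for y by (auto simp: G_def Tr_def indicator_def)
    then show ?thesis using False by (auto simp: indicator_def)
  qed
  have L2: "(\<integral>w. G w y \<partial>lborel) = indicator {x..s} y * integral {x..y} (\<lambda>w. F w y)" for y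
  proof (cases "x \<le> y \<and> y \<le> s")
    case True
    then have "(\<lambda>w. G w y) = (\<lambda>w. indicator {x..y} w * F w y)"
      by (auto simp: fun_eq_iff G_def Tr_def indicator_def)
    then show ?thesis
      using True integral_lborel_interval[of x y "\<lambda>w. F w y"] borel_integrable_atLeastAtMost'[OF cont2[of y]] by (simp add: set_integrable_def)
  next
    case False
    then have "G w y = 0" for w by (auto simp: G_def Tr_def indicator_def)
    then show ?thesis using False by (auto simp: indicator_def)
  qed
  have i1: "integrable lborel (\<lambda>w. \<integral>y. G w y \<partial>lborel)" by (rule lborel_pair.integrable_fst[OF int])
  have i2: "integrable lborel (\<lambda>y. \<integral>w. G w y \<partial>lborel)" by (rule lborel_pair.integrable_snd[OF int])
  have "(\<integral>y. (\<integral>w. G w y \<partial>lborel) \<partial>lborel) = (\<integral>w. (\<integral>y. G w y \<partial>lborel) \<partial>lborel)"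
    by (rule lborel_pair.Fubini_integral[OF int])
  moreover have "(\<integral>w. (\<integral>y. G w y \<partial>lborel) \<partial>lborel) = integral {x..s} (\<lambda>w. integral {w..s} (F w))"
    using i1 unfolding L1 by (rule integral_lborel_interval)
  moreover have "(\<integral>y. (\<integral>w. G w y \<partial>lborel) \<partial>lborel) = integral {x..s} (\<lambda>y. integral {x..y} (\<lambda>w. F w y))"
    using i2 unfolding L2 by (rule integral_lborel_interval)
  ultimately show ?thesis by simp
qed

text \<open>The substitution \<open>y = x + (b - x) \<theta>\<close>, valid for every integrand. It turns integrals over moving
intervals into integrals over a fixed one.\<close>

lemma integral_unit_interval:
  fixes g :: "real \<Rightarrow> real"
  assumes "x \<le> b"
  shows "integral {x..b} g = (b - x) * integral {0..1} (\<lambda>\<theta>. g (x + (b - x) * \<theta>))"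
proof (cases "x = b")
  case False
  then have pos: "0 < b - x" using assms by simp
  let ?h = "\<lambda>\<theta>. g (x + (b - x) * \<theta>)"
  have iff: "(?h has_integral I / (b - x)) {0..1} \<longleftrightarrow> (g has_integral I) {x..b}" for I
    using has_integral_affinity_iff[OF pos, of g x I x b] pos by (simp add: add.commute divide_inverse mult.commute)
  show ?thesis
  proof (cases "g integrable_on {x..b}")
    case True
    then show ?thesis using iff[of "integral {x..b} g"] pos by (auto simp: has_integral_iff)
  next
    case False
    then have "\<not> ?h integrable_on {0..1}"
      using iff[of "_ * (b - x)"] pos by (auto simp: integrable_on_def)
    with False show ?thesis by (simp add: not_integrable_integral)
  qed
qed simp

lemma continuous_on_integral_moving:
  fixes F :: "'a::topological_space \<Rightarrow> real \<Rightarrow> real"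
  assumes "continuous_on (SIGMA z:D. {l z..r z}) (\<lambda>(z, y). F z y)"
    and "continuous_on D l" "continuous_on D r" and "\<And>z. z \<in> D \<Longrightarrow> l z \<le> r z"
  shows "continuous_on D (\<lambda>z. integral {l z..r z} (F z))"
proof -
  have "continuous_on D (\<lambda>z. (r z - l z) * integral (cbox 0 1) (\<lambda>\<theta>. F z (l z + (r z - l z) * \<theta>)))"
  proof (intro continuous_on_mult continuous_on_diff assms integral_continuous_on_param)
    have c: "continuous_on (D \<times> cbox 0 (1::real)) (\<lambda>p. l (fst p))" "continuous_on (D \<times> cbox 0 (1::real)) (\<lambda>p. r (fst p))"
      by (rule continuous_on_compose2[OF assms(2)] continuous_on_compose2[OF assms(3)]; auto intro: continuous_intros)+
    have "l z + (r z - l z) * \<theta> \<in> {l z..r z}" if "z \<in> D" "0 \<le> \<theta>" "\<theta> \<le> 1" for z \<theta>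
      using mult_left_le[of \<theta> "r z - l z"] mult_nonneg_nonneg[of "r z - l z" \<theta>] assms(4)[OF that(1)] that by simp
    then have "continuous_on (D \<times> cbox 0 1) (\<lambda>p. F (fst p) (l (fst p) + (r (fst p) - l (fst p)) * snd p))"
      by (intro continuous_on_compose_field[OF assms(1)] continuous_on_add continuous_on_mult continuous_on_diff c
            continuous_on_fst continuous_on_snd continuous_on_id) auto
    then show "continuous_on (D \<times> cbox 0 1) (\<lambda>(z, \<theta>). F z (l z + (r z - l z) * \<theta>))"
      by (simp add: case_prod_beta)
  qed
  then show ?thesis
    by (rule continuous_on_eq) (simp only: integral_unit_interval[OF assms(4)] box_real)
qed

text \<open>In the variable \<open>y^2\<close> this is a convolution; therefore such operators compose by convolving their
kernels, and differentiation in \<open>x\<close> acts on the kernel.\<close>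

definition volterra :: "(real \<Rightarrow> real) \<Rightarrow> real \<Rightarrow> (real \<Rightarrow> real) \<Rightarrow> real \<Rightarrow> real" where
  "volterra \<kappa> s f x = integral {x..s} (\<lambda>y. 2 * y * \<kappa> (y\<^sup>2 - x\<^sup>2) * f y)"

lemma volterra_end [simp]: "volterra \<kappa> s f s = 0" by (simp add: volterra_def)

lemma continuous_volterra_integrand:
  fixes S :: "real set"
  assumes "continuous_on UNIV \<kappa>" "continuous_on S f"
  shows "continuous_on S (\<lambda>y. 2 * y * \<kappa> (y\<^sup>2 - x\<^sup>2) * f y)"
  by (intro continuous_intros assms continuous_on_compose2[OF assms(1)]) auto

lemma continuous_on_volterra:
  assumes "continuous_on UNIV \<kappa>" "continuous_on {l..s} f"
  shows "continuous_on {l..s} (volterra \<kappa> s f)"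
  unfolding volterra_def[abs_def]
proof (rule continuous_on_integral_moving)
  show "continuous_on (SIGMA x:{l..s}. {x..s}) (\<lambda>(x, y). 2 * y * \<kappa> (y\<^sup>2 - x\<^sup>2) * f y)"
    unfolding case_prod_beta
    by (intro continuous_intros continuous_on_compose2[OF assms(1)] continuous_on_compose2[OF assms(2)]) auto
qed (auto intro!: continuous_intros)

text \<open>Exchanging the order of integration exhibits \<open>volterra \<kappa> s f\<close> as an integral from \<open>x\<close> to \<open>s\<close>, so that
the fundamental theorem of calculus applies although \<open>f\<close> is only continuous.\<close>

lemma DERIV_volterra:
  assumes k: "\<And>\<zeta>. (\<kappa> has_real_derivative \<kappa>' \<zeta>) (at \<zeta>)" and k': "continuous_on UNIV \<kappa>'"
    and f: "continuous_on {l..s} f" and x: "x \<in> {l..s}"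
  shows "(volterra \<kappa> s f has_real_derivative - 2 * x * (\<kappa> 0 * f x + volterra \<kappa>' s f x)) (at x within {l..s})"
proof -
  define h where "h w = 2 * w * (\<kappa> 0 * f w + volterra \<kappa>' s f w)" for w
  have ck: "continuous_on UNIV \<kappa>" using k DERIV_isCont continuous_at_imp_continuous_on by blast
  have ch: "continuous_on {l..s} h"
    unfolding h_def by (intro continuous_intros f continuous_on_volterra k')
  have eq: "volterra \<kappa> s f z = integral {z..s} h" if z: "z \<in> {l..s}" for z
  proof -
    have fz: "continuous_on {z..s} f" by (rule continuous_on_subset[OF f]) (use z in auto)
    have c1: "continuous_on ({z..s} \<times> {z..s}) (\<lambda>(w, y). 2 * w * (2 * y * \<kappa>' (y\<^sup>2 - w\<^sup>2) * f y))"
      unfolding case_prod_beta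
      by (intro continuous_intros continuous_on_compose2[OF k'] continuous_on_compose2[OF fz]) auto
    have "integral {z..s} (\<lambda>w. 2 * w * volterra \<kappa>' s f w)
        = integral {z..s} (\<lambda>w. integral {w..s} (\<lambda>y. 2 * w * (2 * y * \<kappa>' (y\<^sup>2 - w\<^sup>2) * f y)))"
      unfolding volterra_def by (intro integral_cong) (simp only: integral_mult_right)
    also have "\<dots> = integral {z..s} (\<lambda>y. integral {z..y} (\<lambda>w. 2 * w * (2 * y * \<kappa>' (y\<^sup>2 - w\<^sup>2) * f y)))"
      by (rule integral_triangle_swap[OF c1])
    also have "\<dots> = integral {z..s} (\<lambda>y. 2 * y * \<kappa> (y\<^sup>2 - z\<^sup>2) * f y - 2 * y * \<kappa> 0 * f y)"
    proof (rule integral_cong)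
      fix y assume y: "y \<in> {z..s}"
      have "((\<lambda>w. 2 * w * (2 * y * \<kappa>' (y\<^sup>2 - w\<^sup>2) * f y)) has_integral
              - (2 * y * f y * \<kappa> (y\<^sup>2 - y\<^sup>2)) - (- (2 * y * f y * \<kappa> (y\<^sup>2 - z\<^sup>2)))) {z..y}"
      proof (rule has_integral_derivative)
        fix w assume "w \<in> {z..y}"
        show "((\<lambda>w. - (2 * y * f y * \<kappa> (y\<^sup>2 - w\<^sup>2))) has_real_derivative 2 * w * (2 * y * \<kappa>' (y\<^sup>2 - w\<^sup>2) * f y)) (at w within {z..y})"
          by (rule derivative_eq_intros DERIV_chain2[OF k] refl)+ simp
      qed (use y in auto)
      then show "integral {z..y} (\<lambda>w. 2 * w * (2 * y * \<kappa>' (y\<^sup>2 - w\<^sup>2) * f y)) = 2 * y * \<kappa> (y\<^sup>2 - z\<^sup>2) * f y - 2 * y * \<kappa> 0 * f y"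
        by (simp add: integral_unique algebra_simps)
    qed
    also have "\<dots> = volterra \<kappa> s f z - integral {z..s} (\<lambda>y. 2 * y * \<kappa> 0 * f y)"
      unfolding volterra_def
      by (intro integral_diff integrable_continuous_interval continuous_volterra_integrand ck fz continuous_intros)
    finally have "volterra \<kappa> s f z = integral {z..s} (\<lambda>w. 2 * w * volterra \<kappa>' s f w) + integral {z..s} (\<lambda>y. 2 * y * \<kappa> 0 * f y)"
      by simp
    also have "\<dots> = integral {z..s} (\<lambda>w. 2 * w * volterra \<kappa>' s f w + 2 * w * \<kappa> 0 * f w)"
      by (intro integral_add[symmetric] integrable_continuous_interval continuous_intros fz continuous_on_volterra k')
    also have "(\<lambda>w. 2 * w * volterra \<kappa>' s f w + 2 * w * \<kappa> 0 * f w) = h"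
      by (simp add: h_def fun_eq_iff algebra_simps)
    finally show ?thesis .
  qed
  have "((\<lambda>z. integral {l..s} h - integral {l..z} h) has_real_derivative - h x) (at x within {l..s})"
    using integral_has_real_derivative[OF ch x] by (auto intro!: derivative_eq_intros)
  then have "(volterra \<kappa> s f has_real_derivative - h x) (at x within {l..s})"
  proof (rule has_field_derivative_transform_within[OF _ zero_less_one x])
    fix z assume z: "z \<in> {l..s}"
    then show "integral {l..s} h - integral {l..z} h = volterra \<kappa> s f z"
      using Henstock_Kurzweil_Integration.integral_combine[of l z s h] integrable_continuous_interval[OF ch] eq[OF z] by auto
  qed
  then show ?thesis by (simp add: h_def)
qed

lemma volterra_compose:
  assumes k1: "continuous_on UNIV \<kappa>1" and k2: "continuous_on UNIV \<kappa>2" and f: "continuous_on {x..s} f"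
    and conv: "\<And>z. z \<in> {x..s} \<Longrightarrow> ((\<lambda>y. 2 * y * \<kappa>1 (y\<^sup>2 - x\<^sup>2) * \<kappa>2 (z\<^sup>2 - y\<^sup>2)) has_integral \<kappa> (z\<^sup>2 - x\<^sup>2)) {x..z}"
  shows "volterra \<kappa>1 s (volterra \<kappa>2 s f) x = volterra \<kappa> s f x"
proof -
  have c: "continuous_on ({x..s} \<times> {x..s}) (\<lambda>(y, z). 2 * y * \<kappa>1 (y\<^sup>2 - x\<^sup>2) * (2 * z * \<kappa>2 (z\<^sup>2 - y\<^sup>2) * f z))"
    unfolding case_prod_beta
    by (intro continuous_intros continuous_on_compose2[OF k1] continuous_on_compose2[OF k2] continuous_on_compose2[OF f]) auto
  have "volterra \<kappa>1 s (volterra \<kappa>2 s f) x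
      = integral {x..s} (\<lambda>y. integral {y..s} (\<lambda>z. 2 * y * \<kappa>1 (y\<^sup>2 - x\<^sup>2) * (2 * z * \<kappa>2 (z\<^sup>2 - y\<^sup>2) * f z)))"
    unfolding volterra_def by (intro integral_cong) (simp only: integral_mult_right)
  also have "\<dots> = integral {x..s} (\<lambda>z. integral {x..z} (\<lambda>y. 2 * y * \<kappa>1 (y\<^sup>2 - x\<^sup>2) * (2 * z * \<kappa>2 (z\<^sup>2 - y\<^sup>2) * f z)))"
    by (rule integral_triangle_swap[OF c])
  also have "\<dots> = integral {x..s} (\<lambda>z. 2 * z * \<kappa> (z\<^sup>2 - x\<^sup>2) * f z)"
  proof (rule integral_cong)
    fix z assume "z \<in> {x..s}"
    from has_integral_mult_right[OF conv[OF this], of "2 * z * f z"]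
    show "integral {x..z} (\<lambda>y. 2 * y * \<kappa>1 (y\<^sup>2 - x\<^sup>2) * (2 * z * \<kappa>2 (z\<^sup>2 - y\<^sup>2) * f z)) = 2 * z * \<kappa> (z\<^sup>2 - x\<^sup>2) * f z"
      by (simp add: has_integral_iff mult_ac)
  qed
  finally show ?thesis by (simp add: volterra_def)
qed

text \<open>By \<open>bkernel_resolvent\<close> the composition of the two operators is minus their sum.\<close>

lemma bkernel_volterra_inverse:
  fixes a :: real
  assumes f: "continuous_on {0..s} f" and x: "x \<in> {0..s}"
  defines "g \<equiv> \<lambda>x. f x + volterra (bkernel (-a)) s f x"
  shows "f x = g x + volterra (bkernel a) s g x"
proof -
  have ck: "continuous_on UNIV (bkernel b)" for b by (intro continuous_intros continuous_on_id[unfolded id_def])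
  have fx: "continuous_on {x..s} f" by (rule continuous_on_subset[OF f]) (use x in auto)
  have "volterra (bkernel a) s g x = volterra (bkernel a) s f x + volterra (bkernel a) s (volterra (bkernel (-a)) s f) x"
    unfolding g_def volterra_def[of "bkernel a"] distrib_left
    by (intro integral_add integrable_continuous_interval continuous_volterra_integrand ck fx continuous_on_volterra)
  also have "volterra (bkernel a) s (volterra (bkernel (-a)) s f) x = volterra (\<lambda>\<zeta>. - (bkernel (-a) \<zeta> + bkernel a \<zeta>)) s f x"
    by (rule volterra_compose[OF ck ck fx]) (use bkernel_resolvent[of x _ "-a"] x in auto)
  also have "\<dots> = - (volterra (bkernel (-a)) s f x + volterra (bkernel a) s f x)"
  proof -
    have "volterra (bkernel (-a)) s f x + volterra (bkernel a) s f x
      = integral {x..s} (\<lambda>y. 2 * y * bkernel (-a) (y\<^sup>2 - x\<^sup>2) * f y + 2 * y * bkernel a (y\<^sup>2 - x\<^sup>2) * f y)"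
      unfolding volterra_def
      by (intro integral_add[symmetric] integrable_continuous_interval continuous_volterra_integrand ck fx)
    then show ?thesis unfolding volterra_def by (simp flip: integral_neg add: algebra_simps)
  qed
  finally show ?thesis by (simp add: g_def)
qed

text \<open>Integration by parts measures how far the operator is from commuting with the second derivative. The
differential equation of the kernel reduces the defect to a boundary flux, which the source of the
error equation balances, and to a multiple of \<open>f + volterra (bkernel a) s f\<close>, which produces the damping.\<close>

lemma volterra_commutator:
  fixes a :: real
  assumes f': "\<And>x. x \<in> {0..s} \<Longrightarrow> (f has_real_derivative f' x) (at x within {0..s})"
    and f'': "\<And>x. x \<in> {0..s} \<Longrightarrow> (f' has_real_derivative f'' x) (at x within {0..s})"
    and cf'': "continuous_on {0..s} f''" and fs: "f s = 0" and x: "x \<in> {0..s}"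
  defines "g' \<equiv> \<lambda>x. - 2 * x * (a * f x + volterra (bkernel' a) s f x)"
  shows "(volterra (bkernel a) s f has_real_derivative g' x) (at x within {0..s})"
    and "(g' has_real_derivative volterra (bkernel a) s f'' x - 2 * s * bkernel a (s\<^sup>2 - x\<^sup>2) * f' s
             - 4 * a * (f x + volterra (bkernel a) s f x)) (at x within {0..s})"
proof -
  have cf: "continuous_on {0..s} f" by (meson DERIV_continuous continuous_on_eq_continuous_within f')
  note cid = continuous_on_id[unfolded id_def]
  have ck: "continuous_on UNIV (bkernel b)" "continuous_on UNIV (bkernel' b)" "continuous_on UNIV (bkernel'' b)" for b by (intro continuous_intros cid)+
  show "(volterra (bkernel a) s f has_real_derivative g' x) (at x within {0..s})"
    using DERIV_volterra[OF DERIV_bkernel ck(2) cf x, of a] by (simp add: g'_def)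
  have d': "(volterra (bkernel' a) s f has_real_derivative - 2 * x * (bkernel' a 0 * f x + volterra (bkernel'' a) s f x)) (at x within {0..s})"
    by (rule DERIV_volterra[OF DERIV_bkernel' ck(3) cf x])
  have d2: "(g' has_real_derivative - 2 * (a * f x + volterra (bkernel' a) s f x)
       - 2 * x * (a * f' x - 2 * x * (bkernel' a 0 * f x + volterra (bkernel'' a) s f x))) (at x within {0..s})"
    unfolding g'_def by (rule derivative_eq_intros f'[OF x] d' refl)+ (simp add: algebra_simps)
  (* Two integrations by parts of 2 y k f'' at once: the primitive below is 2 y k f' minus the
     derivative of 2 y k times f. *)
  define k k' k'' where "k y = bkernel a (y\<^sup>2 - x\<^sup>2)" and "k' y = bkernel' a (y\<^sup>2 - x\<^sup>2)" and "k'' y = bkernel'' a (y\<^sup>2 - x\<^sup>2)" for y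
  have fx: "continuous_on {x..s} f" and fx'': "continuous_on {x..s} f''" by (rule continuous_on_subset[OF cf] continuous_on_subset[OF cf'']; use x in auto)+
  have "((\<lambda>y. 2 * y * k y * f'' y - (12 * y * k' y + 8 * y ^ 3 * k'' y) * f y) has_integral
      (2 * s * k s * f' s - (2 * k s + 4 * s\<^sup>2 * k' s) * f s) - (2 * x * k x * f' x - (2 * k x + 4 * x\<^sup>2 * k' x) * f x)) {x..s}"
  proof (rule has_integral_derivative)
    fix y assume y: "y \<in> {x..s}"
    then have y0: "y \<in> {0..s}" using x by auto
    have fy: "(f has_real_derivative f' y) (at y within {x..s})" "(f' has_real_derivative f'' y) (at y within {x..s})"
      by (rule DERIV_subset[OF f'[OF y0]] DERIV_subset[OF f''[OF y0]]; use x in auto)+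
    have ky: "(k has_real_derivative k' y * (2 * y)) (at y within {x..s})" "(k' has_real_derivative k'' y * (2 * y)) (at y within {x..s})"
      unfolding k_def k'_def k''_def
      by (rule DERIV_chain2[OF DERIV_bkernel] DERIV_chain2[OF DERIV_bkernel'], auto intro!: derivative_eq_intros)+
    show "((\<lambda>y. 2 * y * k y * f' y - (2 * k y + 4 * y\<^sup>2 * k' y) * f y) has_real_derivative
        2 * y * k y * f'' y - (12 * y * k' y + 8 * y ^ 3 * k'' y) * f y) (at y within {x..s})"
      by (rule derivative_eq_intros fy ky refl)+ (simp add: algebra_simps power2_eq_square power3_eq_cube)
  qed (use x in auto)
  moreover have "2 * y * k y * f'' y - (12 * y * k' y + 8 * y ^ 3 * k'' y) * f y
      = 2 * y * k y * f'' y - 4 * a * (2 * y * k y * f y) + 2 * (2 * y * k' y * f y) - 4 * x\<^sup>2 * (2 * y * k'' y * f y)" for y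
  proof -
    have "8 * y * ((y\<^sup>2 - x\<^sup>2) * k'' y + 2 * k' y) = 8 * y * (a * k y)"
      using bkernel_ode[of "y\<^sup>2 - x\<^sup>2" a] by (simp add: k_def k'_def k''_def)
    then have "12 * y * k' y + 8 * y ^ 3 * k'' y = - (4 * y * k' y) + 8 * a * y * k y + 8 * x\<^sup>2 * y * k'' y"
      by (simp add: algebra_simps power2_eq_square power3_eq_cube)
    then show ?thesis by (simp only:) (simp add: algebra_simps)
  qed
  moreover have "k x = a" "k' x = bkernel' a 0" by (simp_all add: k_def k'_def)
  ultimately have I: "((\<lambda>y. 2 * y * k y * f'' y - 4 * a * (2 * y * k y * f y) + 2 * (2 * y * k' y * f y) - 4 * x\<^sup>2 * (2 * y * k'' y * f y)) has_integral
      2 * s * k s * f' s - (2 * x * a * f' x - (2 * a + 4 * x\<^sup>2 * bkernel' a 0) * f x)) {x..s}"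
    using fs by (simp only:) simp
  have int: "((\<lambda>y. 2 * y * k y * f'' y) has_integral volterra (bkernel a) s f'' x) {x..s}"
    "((\<lambda>y. 2 * y * k y * f y) has_integral volterra (bkernel a) s f x) {x..s}"
    "((\<lambda>y. 2 * y * k' y * f y) has_integral volterra (bkernel' a) s f x) {x..s}"
    "((\<lambda>y. 2 * y * k'' y * f y) has_integral volterra (bkernel'' a) s f x) {x..s}"
    unfolding volterra_def k_def k'_def k''_def
    by (intro integrable_integral integrable_continuous_interval continuous_volterra_integrand ck fx fx'')+
  have V: "volterra (bkernel a) s f'' x - 4 * a * volterra (bkernel a) s f x + 2 * volterra (bkernel' a) s f x - 4 * x\<^sup>2 * volterra (bkernel'' a) s f x
      = 2 * s * k s * f' s - (2 * x * a * f' x - (2 * a + 4 * x\<^sup>2 * bkernel' a 0) * f x)"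
    by (rule has_integral_unique[OF _ I])
       (intro has_integral_diff has_integral_add has_integral_mult_right int)
  show "(g' has_real_derivative volterra (bkernel a) s f'' x - 2 * s * bkernel a (s\<^sup>2 - x\<^sup>2) * f' s
             - 4 * a * (f x + volterra (bkernel a) s f x)) (at x within {0..s})"
    by (rule DERIV_cong[OF d2]) (use V in \<open>simp add: k_def algebra_simps power2_eq_square\<close>)
qed

section \<open>Calculus on a moving interval\<close>

lemma continuous_on_slices:
  assumes "continuous_on (A \<times> B) (\<lambda>(x, y). h x y)"
  shows "a \<in> A \<Longrightarrow> continuous_on B (\<lambda>y. h a y)" and "b \<in> B \<Longrightarrow> continuous_on A (\<lambda>x. h x b)"
  by (rule continuous_on_compose_field[OF assms]; auto intro!: continuous_intros)+

text \<open>Formally the derivative of the integral of \<open>v_y^2\<close> is that of \<open>2 v_y v_yt\<close>, integrated by parts; but \<open>v_yt\<close>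
need not exist. Instead the difference of two energies is the integral of the product of the
difference and the sum of the two slopes. Integrated by parts, it involves \<open>v\<close> only through its
difference quotient in time, which is an average of \<open>v_t\<close> and hence continuous.\<close>

lemma H1_energy_derivative_unit_interval:
  fixes v vy vyy vt :: "real \<Rightarrow> real \<Rightarrow> real"
  assumes vy: "\<And>t e. 0 < t \<Longrightarrow> e \<in> {0..1} \<Longrightarrow> ((\<lambda>e. v e t) has_real_derivative vy e t) (at e within {0..1})"
    and vyy: "\<And>t e. 0 < t \<Longrightarrow> e \<in> {0..1} \<Longrightarrow> ((\<lambda>e. vy e t) has_real_derivative vyy e t) (at e within {0..1})"
    and vt: "\<And>t e. 0 < t \<Longrightarrow> e \<in> {0..1} \<Longrightarrow> ((\<lambda>t. v e t) has_real_derivative vt e t) (at t)"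
    and cy: "continuous_on ({0<..} \<times> {0..1}) (\<lambda>(t, e). vy e t)"
    and cyy: "continuous_on ({0<..} \<times> {0..1}) (\<lambda>(t, e). vyy e t)"
    and ct: "continuous_on ({0<..} \<times> {0..1}) (\<lambda>(t, e). vt e t)"
    and t: "0 < t"
  shows "((\<lambda>t. integral {0..1} (\<lambda>e. (vy e t)\<^sup>2)) has_real_derivative
           2 * (vy 1 t * vt 1 t - vy 0 t * vt 0 t) - 2 * integral {0..1} (\<lambda>e. vyy e t * vt e t)) (at t)"
proof -
  define Q where "Q e r = integral {0..1} (\<lambda>\<sigma>. vt e (t + \<sigma> * (r - t)))" for e r
  have seg: "0 < t + \<sigma> * (r - t)" if "0 < r" "0 \<le> \<sigma>" "\<sigma> \<le> 1" for \<sigma> r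
  proof -
    have "t + \<sigma> * (r - t) = (1 - \<sigma>) * t + \<sigma> * r" by (simp add: algebra_simps)
    moreover have "0 \<le> (1 - \<sigma>) * t" "0 \<le> \<sigma> * r" "0 < \<sigma> * r \<or> 0 < (1 - \<sigma>) * t"
      using that t by (auto simp: zero_less_mult_iff)
    ultimately show ?thesis by linarith
  qed
  have Q: "(r - t) * Q e r = v e r - v e t" if "0 < r" "e \<in> {0..1}" for e r
  proof -
    have "((\<lambda>\<sigma>. (r - t) * vt e (t + \<sigma> * (r - t))) has_integral v e (t + 1 * (r - t)) - v e (t + 0 * (r - t))) {0..1}"
    proof (rule has_integral_derivative)
      fix \<sigma> :: real assume "\<sigma> \<in> {0..1}"
      with seg[OF that(1)] have "0 < t + \<sigma> * (r - t)" by auto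
      from vt[OF this that(2)]
      have "((\<lambda>\<sigma>. v e (t + \<sigma> * (r - t))) has_real_derivative vt e (t + \<sigma> * (r - t)) * (r - t)) (at \<sigma> within {0..1})"
        by (rule DERIV_chain2) (auto intro!: derivative_eq_intros)
      then show "((\<lambda>\<sigma>. v e (t + \<sigma> * (r - t))) has_real_derivative (r - t) * vt e (t + \<sigma> * (r - t))) (at \<sigma> within {0..1})"
        by (simp add: mult.commute)
    qed simp
    then show ?thesis unfolding Q_def by (simp add: has_integral_iff)
  qed
  have cQ: "continuous_on ({0<..} \<times> {0..1}) (\<lambda>(r, e). Q e r)"
  proof -
    have "continuous_on ({0<..} \<times> {0..1}) (\<lambda>z. integral (cbox 0 1) (\<lambda>\<sigma>. vt (snd z) (t + \<sigma> * (fst z - t))))"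
    proof (rule integral_continuous_on_param)
      have "continuous_on (({0<..} \<times> {0..1}) \<times> cbox 0 1)
         (\<lambda>w. vt (snd (fst w)) (t + snd w * (fst (fst w) - t)))"
        by (rule continuous_on_compose_field[OF ct]) (auto intro!: continuous_intros seg)
      then show "continuous_on (({0<..} \<times> {0..1}) \<times> cbox 0 1) (\<lambda>(z, \<sigma>). vt (snd z) (t + \<sigma> * (fst z - t)))"
        by (simp add: case_prod_beta)
    qed
    then show ?thesis by (simp add: Q_def case_prod_beta)
  qed
  have sl: "continuous_on {0..1} (\<lambda>e. vy e r)" "continuous_on {0..1} (\<lambda>e. vyy e r)"
     "continuous_on {0..1} (\<lambda>e. Q e r)" "continuous_on {0..1} (\<lambda>e. vt e r)" if "0 < r" for r
    using that by (auto intro!: continuous_on_slices(1)[OF cy] continuous_on_slices(1)[OF cyy]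
        continuous_on_slices(1)[OF cQ] continuous_on_slices(1)[OF ct])
  define P where "P e r = vy e r + vy e t" for e r
  define P' where "P' e r = vyy e r + vyy e t" for e r
  define D where "D r = integral {0..1} (\<lambda>e. (vy e r)\<^sup>2)" for r
  define \<Psi> where "\<Psi> r = Q 1 r * P 1 r - Q 0 r * P 0 r - integral {0..1} (\<lambda>e. Q e r * P' e r)" for r
  have D: "D r - D t = (r - t) * \<Psi> r" if r: "0 < r" for r
  proof -
    define d where "d e = v e r - v e t" for e
    have "((\<lambda>e. (vy e r - vy e t) * P e r + d e * P' e r) has_integral d 1 * P 1 r - d 0 * P 0 r) {0..1}"
    proof (rule has_integral_derivative)
      fix e :: real assume e: "e \<in> {0..1}"
      show "((\<lambda>e. d e * P e r) has_real_derivative (vy e r - vy e t) * P e r + d e * P' e r) (at e within {0..1})"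
        unfolding d_def P_def P'_def
        by (rule derivative_eq_intros vy[OF t e] vy[OF r e] vyy[OF t e] vyy[OF r e] refl)+ (simp add: algebra_simps)
    qed simp
    then have i1: "((\<lambda>e. (vy e r)\<^sup>2 - (vy e t)\<^sup>2 + d e * P' e r) has_integral d 1 * P 1 r - d 0 * P 0 r) {0..1}"
      by (rule has_integral_eq[rotated]) (simp add: P_def power2_eq_square algebra_simps)
    have "((\<lambda>e. (r - t) * (Q e r * P' e r)) has_integral (r - t) * integral {0..1} (\<lambda>e. Q e r * P' e r)) {0..1}"
      unfolding P'_def by (intro has_integral_mult_right integrable_integral integrable_continuous_interval continuous_intros sl r t)
    then have i2: "((\<lambda>e. d e * P' e r) has_integral (r - t) * integral {0..1} (\<lambda>e. Q e r * P' e r)) {0..1}"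
      by (rule has_integral_eq[rotated]) (simp add: d_def flip: Q[OF r])
    have i3: "((\<lambda>e. (vy e r)\<^sup>2 - (vy e t)\<^sup>2) has_integral D r - D t) {0..1}"
      unfolding D_def by (intro has_integral_diff integrable_integral integrable_continuous_interval continuous_intros sl r t)
    have "D r - D t + (r - t) * integral {0..1} (\<lambda>e. Q e r * P' e r) = d 1 * P 1 r - d 0 * P 0 r"
      by (rule has_integral_unique[OF has_integral_add[OF i3 i2] i1])
    moreover have "d 1 = (r - t) * Q 1 r" "d 0 = (r - t) * Q 0 r" by (simp_all add: d_def Q[OF r])
    ultimately show ?thesis by (simp add: \<Psi>_def algebra_simps)
  qed
  have "continuous_on {0<..} \<Psi>"
  proof -
    have c1: "continuous_on {0<..} (\<lambda>r. Q e r)" "continuous_on {0<..} (\<lambda>r. vy e r)" if "e \<in> {0..1}" for e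
      using that by (auto intro!: continuous_on_slices(2)[OF cy] continuous_on_slices(2)[OF cQ])
    have cyyt: "continuous_on ({0<..} \<times> cbox 0 1) (\<lambda>z. vyy (snd z) t)"
      by (rule continuous_on_compose2[OF sl(2)[OF t]]) (auto intro!: continuous_intros)
    have "continuous_on ({0<..} \<times> cbox 0 1) (\<lambda>z. Q (snd z) (fst z) * (vyy (snd z) (fst z) + vyy (snd z) t))"
      using cQ cyy cyyt by (intro continuous_intros) (simp_all add: case_prod_beta)
    then have "continuous_on {0<..} (\<lambda>r. integral (cbox 0 1) (\<lambda>e. Q e r * P' e r))"
      by (intro integral_continuous_on_param) (simp add: case_prod_beta P'_def)
    then show ?thesis unfolding \<Psi>_def[abs_def] P_def box_real
      by (intro continuous_on_diff continuous_on_mult continuous_on_add c1 continuous_on_const) auto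
  qed
  then have "(\<Psi> \<longlongrightarrow> \<Psi> t) (at t)"
    using t by (simp add: continuous_on_eq_continuous_at isCont_def)
  moreover have "\<forall>\<^sub>F r in at t. \<Psi> r = (D r - D t) / (r - t)"
  proof -
    have "\<forall>\<^sub>F r in at t. 0 < r" using order_tendstoD(1)[OF tendsto_ident_at t] .
    then show ?thesis using eventually_neq_at_within[of t t UNIV] by eventually_elim (simp add: D)
  qed
  ultimately have "((\<lambda>r. (D r - D t) / (r - t)) \<longlongrightarrow> \<Psi> t) (at t)" by (rule Lim_transform_eventually)
  then have "(D has_real_derivative \<Psi> t) (at t)" by (simp add: has_field_derivative_iff)
  moreover have "\<Psi> t = 2 * (vy 1 t * vt 1 t - vy 0 t * vt 0 t) - 2 * integral {0..1} (\<lambda>e. vyy e t * vt e t)"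
    by (simp add: \<Psi>_def P_def P'_def Q_def mult_ac algebra_simps)
  ultimately show ?thesis by (simp add: D_def[abs_def])
qed

definition evolution_domain :: "(real \<Rightarrow> real) \<Rightarrow> (real \<times> real) set" where
  "evolution_domain s = {(x, t). 0 < t \<and> 0 \<le> x \<and> x \<le> s t}"

text \<open>The time derivative is one-sided at the interface, as in the definition of a solution. Only
first derivatives are recorded, so that squares of solutions and products of solutions with kernels
are again of this kind.\<close>

definition C1_field where
  "C1_field s f fx ft \<longleftrightarrow>
     continuous_on (evolution_domain s) (\<lambda>(x, t). f x t) \<and>
     continuous_on (evolution_domain s) (\<lambda>(x, t). fx x t) \<and>
     continuous_on (evolution_domain s) (\<lambda>(x, t). ft x t) \<and>
     (\<forall>t>0. \<forall>x\<in>{0..s t}. ((\<lambda>y. f y t) has_real_derivative fx x t) (at x within {0..s t}) \<and>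
        ((\<lambda>r. f x r) has_real_derivative ft x t) (at t within {r. (x, r) \<in> moving_domain s}))"

lemma C1_fieldD:
  assumes "C1_field s f fx ft"
  shows "continuous_on (evolution_domain s) (\<lambda>(x, t). f x t)"
    "continuous_on (evolution_domain s) (\<lambda>(x, t). fx x t)"
    "continuous_on (evolution_domain s) (\<lambda>(x, t). ft x t)"
    "\<And>t x. 0 < t \<Longrightarrow> x \<in> {0..s t} \<Longrightarrow> ((\<lambda>y. f y t) has_real_derivative fx x t) (at x within {0..s t})"
    "\<And>t x. 0 < t \<Longrightarrow> x \<in> {0..s t} \<Longrightarrow> ((\<lambda>r. f x r) has_real_derivative ft x t) (at t within {r. (x, r) \<in> moving_domain s})"
  using assms unfolding C1_field_def by blast+

lemma C1_field_mult:
  assumes "C1_field s f fx ft" "C1_field s g gx gt"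
  shows "C1_field s (\<lambda>x t. f x t * g x t) (\<lambda>x t. fx x t * g x t + gx x t * f x t) (\<lambda>x t. ft x t * g x t + gt x t * f x t)"
proof -
  note F = C1_fieldD[OF assms(1)] and G = C1_fieldD[OF assms(2)]
  show ?thesis unfolding C1_field_def
  proof (intro conjI allI impI ballI)
    show "continuous_on (evolution_domain s) (\<lambda>(x, t). f x t * g x t)"
      "continuous_on (evolution_domain s) (\<lambda>(x, t). fx x t * g x t + gx x t * f x t)"
      "continuous_on (evolution_domain s) (\<lambda>(x, t). ft x t * g x t + gt x t * f x t)"
      using F(1-3) G(1-3) by (simp_all add: case_prod_beta continuous_on_add continuous_on_mult)
  qed (intro DERIV_mult F G; assumption)+
qed

lemma C1_field_space_only:
  assumes "\<And>x. (h has_real_derivative h' x) (at x)" "continuous_on UNIV h'"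
  shows "C1_field s (\<lambda>x t. h x) (\<lambda>x t. h' x) (\<lambda>x t. 0)"
proof -
  have "continuous_on UNIV h" using assms(1) DERIV_isCont continuous_at_imp_continuous_on by blast
  note ch = this
  have c: "continuous_on S (\<lambda>z. h (fst z))" "continuous_on S (\<lambda>z. h' (fst z))" for S :: "(real \<times> real) set"
    by (rule continuous_on_compose2[OF ch] continuous_on_compose2[OF assms(2)]; auto intro!: continuous_intros)+
  show ?thesis unfolding C1_field_def case_prod_beta
    by (intro conjI allI impI ballI c continuous_on_const DERIV_const has_field_derivative_at_within[OF assms(1)])
qed

lemma continuous_on_rescaled:
  assumes "continuous_on (evolution_domain s) (\<lambda>(x, t). f x t)" "continuous_on {0<..} s" "\<And>t. 0 < t \<Longrightarrow> 0 < s t"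
  shows "continuous_on ({0<..} \<times> {0..1}) (\<lambda>(t, e). f (e * s t) t)"
proof -
  have "continuous_on ({0<..} \<times> {0..1::real}) (\<lambda>z. s (fst z))"
    by (rule continuous_on_compose2[OF assms(2)]) (auto intro!: continuous_intros)
  then have "continuous_on ({0<..} \<times> {0..1}) (\<lambda>z. f (snd z * s (fst z)) (fst z))"
    using assms(3) mult_right_mono[of _ 1 "s _"]
    by (intro continuous_on_compose_field[OF assms(1)] continuous_on_mult continuous_on_fst continuous_on_snd continuous_on_id)
       (auto simp: evolution_domain_def less_imp_le)
  then show ?thesis by (simp add: case_prod_beta)
qed

locale moving_interval =
  fixes s s' :: "real \<Rightarrow> real"
  assumes s_pos: "\<And>t. 0 \<le> t \<Longrightarrow> 0 < s t"
    and s_deriv: "\<And>t. 0 \<le> t \<Longrightarrow> (s has_real_derivative s' t) (at t within {0..})"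
    and continuous_s': "continuous_on {0..} s'"
begin

lemma continuous_s: "continuous_on {0..} s"
  using s_deriv by (meson DERIV_continuous atLeast_iff continuous_on_eq_continuous_within)

lemma DERIV_s: "0 < t \<Longrightarrow> (s has_real_derivative s' t) (at t)"
  using s_deriv[of t] at_within_interior[of t "{0..}"] by simp

lemma continuous_s_pos: "continuous_on {0<..} s" "continuous_on {0<..} s'"
  by (rule continuous_on_subset[OF continuous_s] continuous_on_subset[OF continuous_s']; auto)+

lemma in_evolution_domain: "0 < t \<Longrightarrow> e \<in> {0..1} \<Longrightarrow> e * s t \<in> {0..s t}"
  using s_pos[of t] by (auto simp: mult_left_le_one_le)

text \<open>For \<open>e < 1\<close> a rectangle \<open>[0, m] \<times> (t - d, t + d)\<close> containing the point lies in the domain, so the chain rule for continuous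
partial derivatives applies.\<close>

lemma DERIV_rescaled_interior:
  assumes F: "C1_field s f fx ft" and t: "0 < t" and e: "0 \<le> e" "e < 1"
  shows "((\<lambda>r. f (e * s r) r) has_real_derivative ft (e * s t) t + e * s' t * fx (e * s t) t) (at t)"
proof -
  note F = C1_fieldD[OF F]
  define x where "x = e * s t"
  have "x < s t" "0 \<le> x" using e s_pos[of t] t by (auto simp: x_def)
  define m where "m = (x + s t) / 2"
  have m: "x < m" "m < s t" using \<open>x < s t\<close> by (auto simp: m_def)
  have st: "(s \<longlongrightarrow> s t) (at t)" using DERIV_isCont[OF DERIV_s[OF t]] by (simp add: isCont_def)
  have "\<forall>\<^sub>F r in at t. m < s r" by (rule order_tendstoD(1)[OF st m(2)])
  moreover have "\<forall>\<^sub>F r in at t. e * s r < m"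
    by (rule order_tendstoD(2)[OF tendsto_mult_left[OF st]]) (use m in \<open>simp add: x_def\<close>)
  ultimately have "\<forall>\<^sub>F r in at t. m < s r \<and> e * s r < m" by eventually_elim simp
  then obtain d0 where d0: "d0 > 0" "\<And>r. r \<noteq> t \<Longrightarrow> dist r t < d0 \<Longrightarrow> m < s r \<and> e * s r < m"
    unfolding eventually_at by auto
  define d where "d = min d0 t"
  define X where "X = {t - d<..<t + d}"
  have d: "d > 0" "d \<le> t" "d \<le> d0" using d0 t by (auto simp: d_def)
  have X: "0 < r" "m < s r" "e * s r < m" if "r \<in> X" for r
    using that d d0(2)[of r] m by (cases "r = t"; auto simp: X_def dist_real_def x_def)+
  have tX: "t \<in> X" "open X" using d by (auto simp: X_def)
  have "((\<lambda>(r, y). f y r) has_derivative (\<lambda>(h, k). ft x t * h + blinfun_mult_right (fx x t) k)) (at (t, x) within X \<times> {0..m})"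
  proof (rule has_derivative_partialsI[where fy = "\<lambda>r y. blinfun_mult_right (fx y r)"])
    have "((\<lambda>r. f x r) has_real_derivative ft x t) (at t within X)"
      by (rule DERIV_subset[OF F(5)])
         (use t \<open>0 \<le> x\<close> \<open>x < s t\<close> m X in \<open>force simp: moving_domain_def\<close>)+
    then show "((\<lambda>r. f x r) has_derivative (*) (ft x t)) (at t within X)" by (simp add: has_field_derivative_def)
    show "((\<lambda>y. f y r) has_derivative blinfun_apply (blinfun_mult_right (fx y r))) (at y within {0..m})" if "r \<in> X" "y \<in> {0..m}" for r y
    proof -
      have "((\<lambda>y. f y r) has_real_derivative fx y r) (at y within {0..m})"
        by (rule DERIV_subset[OF F(4)]) (use X[OF that(1)] that in auto)
      then show ?thesis by (simp add: has_field_derivative_def)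
    qed
    have "continuous_on (X \<times> {0..m}) (\<lambda>z. fx (snd z) (fst z))"
      by (rule continuous_on_compose_field[OF F(2)])
         (auto simp: evolution_domain_def intro!: continuous_intros dest: X)
    then have c: "continuous_on (X \<times> {0..m}) (\<lambda>z. blinfun_mult_right (fx (snd z) (fst z)))"
      by (intro continuous_intros)
    have tx: "(t, x) \<in> X \<times> {0..m}" using tX m \<open>0 \<le> x\<close> by auto
    have eq: "(\<lambda>(r, y). blinfun_mult_right (fx y r)) = (\<lambda>z. blinfun_mult_right (fx (snd z) (fst z)))"
      by (rule ext) (simp only: case_prod_beta)
    show "continuous (at (t, x) within X \<times> {0..m}) (\<lambda>(r, y). blinfun_mult_right (fx y r))"
      unfolding eq by (rule bspec[OF iffD1[OF continuous_on_eq_continuous_within c] tx])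
  qed (use m \<open>0 \<le> x\<close> in auto)
  then have A: "((\<lambda>(r, y). f y r) has_derivative (\<lambda>(h, k). ft x t * h + fx x t * k)) (at (t, e * s t) within X \<times> {0..m})"
    by (simp only: x_def[symmetric] blinfun_mult_right.rep_eq)
  have "(s has_derivative (*) (s' t)) (at t within X)"
    by (rule has_derivative_at_withinI) (use DERIV_s[OF t] in \<open>simp add: has_field_derivative_def\<close>)
  then have curve: "((\<lambda>r. (r, e * s r)) has_derivative (\<lambda>h. (h, e * (s' t * h)))) (at t within X)"
    by (intro has_derivative_Pair has_derivative_ident has_derivative_mult_right)
  have "(\<lambda>r. (r, e * s r)) ` X \<subseteq> X \<times> {0..m}"
  proof (intro image_subsetI SigmaI)
    fix r assume "r \<in> X"
    then show "e * s r \<in> {0..m}" using X[of r] e s_pos[of r] by auto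
  qed
  from has_derivative_in_compose[OF curve has_derivative_subset[OF A this]]
  have "((\<lambda>r. f (e * s r) r) has_derivative (\<lambda>h. ft x t * h + fx x t * (e * (s' t * h)))) (at t within X)"
    by simp
  moreover have "(\<lambda>h. ft x t * h + fx x t * (e * (s' t * h))) = (*) (ft x t + e * s' t * fx x t)"
    by (simp add: fun_eq_iff algebra_simps)
  ultimately have "((\<lambda>r. f (e * s r) r) has_real_derivative ft x t + e * s' t * fx x t) (at t within X)"
    by (simp add: has_field_derivative_def)
  then show ?thesis by (simp add: at_within_open[OF tX] x_def)
qed

lemma continuous_rescaled_derivative:
  assumes "C1_field s f fx ft"
  shows "continuous_on ({0<..} \<times> {0..1}) (\<lambda>(t, e). ft (e * s t) t + e * s' t * fx (e * s t) t)"
proof -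
  note F = C1_fieldD[OF assms]
  have "continuous_on ({0<..} \<times> {0..1::real}) (\<lambda>z. s' (fst z))"
    by (rule continuous_on_compose2[OF continuous_s_pos(2)]) (auto intro!: continuous_intros)
  then show ?thesis
    using continuous_on_rescaled[OF F(2) continuous_s_pos(1)] continuous_on_rescaled[OF F(3) continuous_s_pos(1)] s_pos
    by (simp add: case_prod_beta continuous_on_add continuous_on_mult continuous_on_snd continuous_on_id)
qed

text \<open>At \<open>e = 1\<close> the point moves along the interface and no rectangle around it lies in the domain. The formula is
inherited from \<open>e < 1\<close> by passing to the limit in its integrated form.\<close>

lemma DERIV_rescaled:
  assumes F: "C1_field s f fx ft" and t: "0 < t" and e: "e \<in> {0..1}"
  shows "((\<lambda>r. f (e * s r) r) has_real_derivative ft (e * s t) t + e * s' t * fx (e * s t) t) (at t)"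
proof (cases "e = 1")
  case True
  define W where "W e t = ft (e * s t) t + e * s' t * fx (e * s t) t" for e t
  note cW = continuous_rescaled_derivative[OF F, folded W_def]
  note cf = continuous_on_rescaled[OF C1_fieldD(1)[OF F] continuous_s_pos(1) s_pos[OF less_imp_le]]
  define t1 t2 where "t1 = t / 2" and "t2 = 2 * t"
  have t12: "0 < t1" "t1 < t" "t < t2" using t by (auto simp: t1_def t2_def)
  have cW1: "continuous_on {t1..t2} (W e)" if "e \<in> {0..1}" for e
    by (rule continuous_on_subset[OF continuous_on_slices(2)[OF cW that]]) (use t12 in auto)
  have eq: "f (1 * s r) r = f (1 * s t1) t1 + integral {t1..r} (W 1)" if r: "r \<in> {t1..t2}" for r
  proof -
    define \<phi> where "\<phi> e = f (e * s r) r - f (e * s t1) t1 - integral {t1..r} (W e)" for e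
    have 1: "continuous_on {0..1} (\<lambda>e. f (e * s r) r)" if "0 < r" for r
      using continuous_on_slices(1)[OF cf, of r] that by simp
    have "continuous_on ({0..1} \<times> cbox t1 r) (\<lambda>z. W (fst z) (snd z))"
      by (rule continuous_on_compose_field[OF cW]) (use t12 in \<open>auto intro!: continuous_intros\<close>)
    then have "continuous_on {0..1} (\<lambda>e. integral (cbox t1 r) (W e))"
      by (intro integral_continuous_on_param) (simp add: case_prod_beta)
    then have "continuous_on (closure {0..<1}) \<phi>"
      unfolding \<phi>_def[abs_def] using 1[of r] 1[of t1] that t12 by (simp add: continuous_on_diff)
    moreover have "\<phi> e = 0" if "e \<in> {0..<1}" for e
    proof -
      have "(W e has_integral f (e * s r) r - f (e * s t1) t1) {t1..r}"
      proof (rule has_integral_derivative)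
        fix \<sigma> assume "\<sigma> \<in> {t1..r}"
        then have "0 < \<sigma>" using t12 by auto
        with \<open>e \<in> {0..<1}\<close> have "((\<lambda>r. f (e * s r) r) has_real_derivative W e \<sigma>) (at \<sigma>)"
          using DERIV_rescaled_interior[OF F, of \<sigma> e] by (simp add: W_def)
        then show "((\<lambda>r. f (e * s r) r) has_real_derivative W e \<sigma>) (at \<sigma> within {t1..r})"
          by (rule has_field_derivative_at_within)
      qed (use r in auto)
      then show ?thesis by (simp add: \<phi>_def integral_unique)
    qed
    ultimately have "\<phi> 1 = 0"
      using continuous_constant_on_closure[of "{0..<1}" \<phi> 0 1] by simp
    then show ?thesis by (simp add: \<phi>_def)
  qed
  have "((\<lambda>r. f (1 * s t1) t1 + integral {t1..r} (W 1)) has_real_derivative W 1 t) (at t within {t1..t2})"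
    using DERIV_add[OF DERIV_const integral_has_real_derivative[OF cW1[of 1], of t]] t12 by simp
  then have "((\<lambda>r. f (1 * s r) r) has_real_derivative W 1 t) (at t within {t1..t2})"
    by (rule has_field_derivative_transform_within[OF _ zero_less_one]) (use t12 in simp, rule eq[symmetric])
  then show ?thesis using t12 True at_within_interior[of t "{t1..t2}"] by (simp add: W_def)
qed (use DERIV_rescaled_interior[OF F t, of e] e in auto)

lemma integral_rescaled: "0 \<le> t \<Longrightarrow> integral {0..s t} g = s t * integral {0..1} (\<lambda>e. g (e * s t))"
  using integral_unit_interval[of 0 "s t" g] s_pos[of t] by (simp add: mult.commute)

lemma DERIV_rescaled_space:
  assumes g: "\<And>x. x \<in> {0..s t} \<Longrightarrow> ((\<lambda>y. g y t) has_real_derivative g' x t) (at x within {0..s t})"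
    and t: "0 < t" and e: "e \<in> {0..1}"
  shows "((\<lambda>e. g (e * s t) t) has_real_derivative g' (e * s t) t * s t) (at e within {0..1})"
proof (rule DERIV_image_chain[unfolded o_def, where g = "\<lambda>e. e * s t" and f = "\<lambda>y. g y t"])
  show "((\<lambda>y. g y t) has_real_derivative g' (e * s t) t) (at (e * s t) within (\<lambda>e. e * s t) ` {0..1})"
    by (rule DERIV_subset[OF g[OF in_evolution_domain[OF t e]]]) (use in_evolution_domain[OF t] in auto)
qed (auto intro!: derivative_eq_intros)

lemma continuous_slice:
  assumes "continuous_on (evolution_domain s) (\<lambda>(x, t). f x t)" "0 < t"
  shows "continuous_on {0..s t} (\<lambda>x. f x t)"
  by (rule continuous_on_compose_field[OF assms(1)]) (use assms(2) in \<open>auto simp: evolution_domain_def intro!: continuous_intros\<close>)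

lemma continuous_slice_0:
  assumes "continuous_on (moving_domain s) (\<lambda>(x, t). f x t)" "0 \<le> t"
  shows "continuous_on {0..s t} (\<lambda>x. f x t)"
  by (rule continuous_on_compose_field[OF assms(1)]) (use assms(2) in \<open>auto simp: moving_domain_def intro!: continuous_intros\<close>)

text \<open>Leibniz' rule on \<open>[0, 1]\<close>; the drift \<open>e s' fx\<close> of the moving frame is integrated by parts and leaves
the value at the interface.\<close>

lemma transport_theorem:
  assumes F: "C1_field s f fx ft" and t: "0 < t"
  shows "((\<lambda>t. integral {0..s t} (\<lambda>x. f x t)) has_real_derivative integral {0..s t} (\<lambda>x. ft x t) + s' t * f (s t) t) (at t)"
proof -
  note FF = C1_fieldD[OF F]
  define W where "W t e = ft (e * s t) t + e * s' t * fx (e * s t) t" for e t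
  note cW = continuous_rescaled_derivative[OF F, folded W_def]
  note cresc = continuous_on_rescaled[OF _ continuous_s_pos(1) s_pos[OF less_imp_le]]
  have sl: "continuous_on {0..1} (\<lambda>e. g (e * s t) t)"
    if "continuous_on (evolution_domain s) (\<lambda>(x, t). g x t)" "0 < t" for g t
    using continuous_on_slices(1)[OF cresc[OF that(1)], of t] that by simp
  have "((\<lambda>t. integral (cbox 0 1) (\<lambda>e. f (e * s t) t)) has_real_derivative integral (cbox 0 1) (W t)) (at t within {0<..})"
    by (rule leibniz_rule_field_derivative)
       (use t cW in \<open>auto simp: W_def intro!: DERIV_subset[OF DERIV_rescaled[OF F]] integrable_continuous_interval sl FF\<close>)
  then have "((\<lambda>t. integral {0..1} (\<lambda>e. f (e * s t) t)) has_real_derivative integral {0..1} (W t)) (at t)"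
    using t by (simp add: at_within_open_NO_MATCH)
  from DERIV_mult[OF DERIV_s[OF t] this]
  have d: "((\<lambda>t. s t * integral {0..1} (\<lambda>e. f (e * s t) t)) has_real_derivative
      s' t * integral {0..1} (\<lambda>e. f (e * s t) t) + integral {0..1} (W t) * s t) (at t)" .
  have i1: "((\<lambda>e. f (e * s t) t + e * s t * fx (e * s t) t) has_integral 1 * f (1 * s t) t - 0 * f (0 * s t) t) {0..1}"
  proof (rule has_integral_derivative)
    fix e :: real assume e: "e \<in> {0..1}"
    show "((\<lambda>e. e * f (e * s t) t) has_real_derivative f (e * s t) t + e * s t * fx (e * s t) t) (at e within {0..1})"
      using DERIV_rescaled_space[of t f fx e, OF FF(4)[OF t] t e] by (auto intro!: derivative_eq_intros)
  qed simp
  have i2: "((\<lambda>e. f (e * s t) t) has_integral integral {0..1} (\<lambda>e. f (e * s t) t)) {0..1}"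
    "((\<lambda>e. ft (e * s t) t) has_integral integral {0..1} (\<lambda>e. ft (e * s t) t)) {0..1}"
    by (intro integrable_integral integrable_continuous_interval sl FF t)+
  have "((\<lambda>e. s' t * (f (e * s t) t + e * s t * fx (e * s t) t) - s' t * f (e * s t) t + s t * ft (e * s t) t) has_integral
     s' t * f (s t) t - s' t * integral {0..1} (\<lambda>e. f (e * s t) t) + s t * integral {0..1} (\<lambda>e. ft (e * s t) t)) {0..1}"
    using i1 by (intro has_integral_add has_integral_diff has_integral_mult_right i2) simp
  then have "((\<lambda>e. s t * W t e) has_integral
     s' t * f (s t) t - s' t * integral {0..1} (\<lambda>e. f (e * s t) t) + s t * integral {0..1} (\<lambda>e. ft (e * s t) t)) {0..1}"
    by (rule has_integral_eq[rotated]) (simp add: W_def algebra_simps)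
  then have "s t * integral {0..1} (W t) =
     s' t * f (s t) t - s' t * integral {0..1} (\<lambda>e. f (e * s t) t) + s t * integral {0..1} (\<lambda>e. ft (e * s t) t)"
    by (metis integral_mult_right integral_unique)
  then have "((\<lambda>t. s t * integral {0..1} (\<lambda>e. f (e * s t) t)) has_real_derivative
      integral {0..s t} (\<lambda>x. ft x t) + s' t * f (s t) t) (at t)"
    using t by (intro DERIV_cong[OF d]) (simp add: integral_rescaled mult.commute)
  then show ?thesis
    by (rule has_field_derivative_transform_within_open[of _ _ _ "{0<..}"]) (use t in \<open>auto simp: integral_rescaled\<close>)
qed

text \<open>Differentiate \<open>f (s t) t = 0\<close> along the interface.\<close>

lemma boundary_time_derivative:
  assumes F: "C1_field s f fx ft" and t: "0 < t" and "\<And>t. 0 < t \<Longrightarrow> f (s t) t = 0"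
  shows "ft (s t) t = - s' t * fx (s t) t"
proof -
  have "((\<lambda>r. f (1 * s r) r) has_real_derivative ft (1 * s t) t + 1 * s' t * fx (1 * s t) t) (at t)"
    by (rule DERIV_rescaled[OF F t]) simp
  moreover have "((\<lambda>r. f (1 * s r) r) has_real_derivative 0) (at t)"
    by (rule has_field_derivative_transform_within_open[of "\<lambda>_. 0" _ _ "{0<..}"]) (use t assms(3) in auto)
  ultimately show ?thesis using DERIV_unique by fastforce
qed

text \<open>After rescaling to \<open>[0, 1]\<close> the interface contributes nothing; undoing the rescaling produces the
term with \<open>s'\<close>, whose sign is favourable when the interface advances.\<close>

lemma H1_energy_derivative:
  assumes F: "C1_field s f fx ft" and t: "0 < t" and f0: "\<And>t. 0 < t \<Longrightarrow> f (s t) t = 0"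
    and fxx: "\<And>t x. 0 < t \<Longrightarrow> x \<in> {0..s t} \<Longrightarrow> ((\<lambda>y. fx y t) has_real_derivative fxx x t) (at x within {0..s t})"
    and cxx: "continuous_on (evolution_domain s) (\<lambda>(x, t). fxx x t)"
  shows "((\<lambda>t. integral {0..s t} (\<lambda>x. (fx x t)\<^sup>2)) has_real_derivative
      - 2 * fx 0 t * ft 0 t - 2 * integral {0..s t} (\<lambda>x. fxx x t * ft x t) - s' t * (fx (s t) t)\<^sup>2) (at t)"
proof -
  note FF = C1_fieldD[OF F]
  define W where "W t e = ft (e * s t) t + e * s' t * fx (e * s t) t" for e t
  note cW = continuous_rescaled_derivative[OF F, folded W_def]
  note cresc = continuous_on_rescaled[OF _ continuous_s_pos(1) s_pos[OF less_imp_le]]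
  have cs: "continuous_on ({0<..} \<times> {0..1::real}) (\<lambda>z. s (fst z))"
    by (rule continuous_on_compose2[OF continuous_s_pos(1)]) (auto intro!: continuous_intros)
  let ?A = "integral {0..1} (\<lambda>e. (s t)\<^sup>2 * fxx (e * s t) t * W t e)" and ?C = "integral {0..s t} (\<lambda>x. fxx x t * ft x t)"
  let ?B = "\<lambda>t. integral {0..1} (\<lambda>e. (s t * fx (e * s t) t)\<^sup>2)"
  have "((\<lambda>t. ?B t) has_real_derivative
      2 * (s t * fx (1 * s t) t * W t 1 - s t * fx (0 * s t) t * W t 0)
      - 2 * ?A) (at t)"
  proof (rule H1_energy_derivative_unit_interval[where v = "\<lambda>e t. f (e * s t) t" and vt = "\<lambda>e t. W t e"])
    show "((\<lambda>e. f (e * s t) t) has_real_derivative s t * fx (e * s t) t) (at e within {0..1})" if "0 < t" "e \<in> {0..1}" for t e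
      using DERIV_rescaled_space[of t f fx, OF FF(4)[OF that(1)] that] by (simp add: mult.commute)
    show "((\<lambda>e. s t * fx (e * s t) t) has_real_derivative (s t)\<^sup>2 * fxx (e * s t) t) (at e within {0..1})" if "0 < t" "e \<in> {0..1}" for t e
      using DERIV_cmult[OF DERIV_rescaled_space[of t fx fxx, OF fxx[OF that(1)] that], of "s t"] by (simp add: power2_eq_square mult_ac)
    show "((\<lambda>t. f (e * s t) t) has_real_derivative W t e) (at t)" if "0 < t" "e \<in> {0..1}" for t e
      using DERIV_rescaled[OF F that] by (simp add: W_def)
    show "continuous_on ({0<..} \<times> {0..1}) (\<lambda>(t, e). s t * fx (e * s t) t)"
      using cs cresc[OF FF(2)] by (simp add: case_prod_beta continuous_on_mult)
    show "continuous_on ({0<..} \<times> {0..1}) (\<lambda>(t, e). (s t)\<^sup>2 * fxx (e * s t) t)"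
      using cs cresc[OF cxx] by (simp add: case_prod_beta continuous_on_mult continuous_on_power)
  qed (fact cW t)+
  note d0 = this
  have W01: "W t 1 = 0" "W t 0 = ft 0 t" using boundary_time_derivative[OF F t f0] by (simp_all add: W_def)
  have d: "((\<lambda>t. ?B t) has_real_derivative
      - 2 * s t * fx 0 t * ft 0 t - 2 * ?A) (at t)"
    by (rule DERIV_cong[OF d0]) (simp add: W01)
  define N where "N t = integral {0..s t} (\<lambda>x. (fx x t)\<^sup>2)" for t
  have N: "?B t = s t * N t" if "0 < t" for t
    using that by (simp add: N_def integral_rescaled power_mult_distrib power2_eq_square mult_ac)
  have sl: "continuous_on {0..s t} (\<lambda>x. f x t)" "continuous_on {0..s t} (\<lambda>x. fx x t)" "continuous_on {0..s t} (\<lambda>x. fxx x t)" "continuous_on {0..s t} (\<lambda>x. ft x t)"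
    by (intro continuous_slice FF cxx t)+
  have "s t > 0" using s_pos t by simp
  have I: "?A = s t * ?C + s' t * (s t * (fx (s t) t)\<^sup>2 / 2 - N t / 2)"
  proof -
    have i1: "((\<lambda>x. (fx x t)\<^sup>2 + 2 * (x * fx x t * fxx x t)) has_integral s t * (fx (s t) t)\<^sup>2 - 0 * (fx 0 t)\<^sup>2) {0..s t}"
    proof (rule has_integral_derivative)
      fix x assume x: "x \<in> {0..s t}"
      show "((\<lambda>x. x * (fx x t)\<^sup>2) has_real_derivative (fx x t)\<^sup>2 + 2 * (x * fx x t * fxx x t)) (at x within {0..s t})"
        by (rule derivative_eq_intros fxx[OF t x] refl)+ (simp add: algebra_simps)
    qed (use \<open>s t > 0\<close> in simp)
    have i2: "((\<lambda>x. (fx x t)\<^sup>2) has_integral N t) {0..s t}"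
      unfolding N_def by (intro integrable_integral integrable_continuous_interval continuous_intros sl)
    from has_integral_diff[OF i1 i2]
    have "((\<lambda>x. 2 * (x * fx x t * fxx x t)) has_integral s t * (fx (s t) t)\<^sup>2 - N t) {0..s t}" by simp
    from has_integral_mult_right[OF this, of "1/2"]
    have j: "((\<lambda>x. x * fx x t * fxx x t) has_integral s t * (fx (s t) t)\<^sup>2 / 2 - N t / 2) {0..s t}"
      by (simp add: diff_divide_distrib)
    have "((\<lambda>x. s t * (fxx x t * ft x t) + s' t * (x * fx x t * fxx x t)) has_integral
        s t * ?C + s' t * (s t * (fx (s t) t)\<^sup>2 / 2 - N t / 2)) {0..s t}"
      by (intro has_integral_add has_integral_mult_right j integrable_integral integrable_continuous_interval continuous_intros sl)
    then have "integral {0..s t} (\<lambda>x. s t * (fxx x t * ft x t) + s' t * (x * fx x t * fxx x t)) =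
        s t * ?C + s' t * (s t * (fx (s t) t)\<^sup>2 / 2 - N t / 2)"
      by (rule integral_unique)
    moreover have "integral {0..s t} (\<lambda>x. s t * (fxx x t * ft x t) + s' t * (x * fx x t * fxx x t)) = ?A"
      using t by (simp add: integral_rescaled W_def power2_eq_square algebra_simps flip: integral_mult_right)
    ultimately show ?thesis by simp
  qed
  have "((\<lambda>t. ?B t / s t) has_real_derivative
     ((- 2 * s t * fx 0 t * ft 0 t - 2 * ?A) * s t - ?B t * s' t) / (s t * s t)) (at t)"
    by (rule DERIV_divide[OF d DERIV_s[OF t]]) (use \<open>s t > 0\<close> in simp)
  also have "((- 2 * s t * fx 0 t * ft 0 t - 2 * ?A) * s t - ?B t * s' t) / (s t * s t)
    = - 2 * fx 0 t * ft 0 t - 2 * ?C - s' t * (fx (s t) t)\<^sup>2"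
    unfolding I N[OF t] using \<open>s t > 0\<close> by (simp add: field_simps)
  finally have d3: "((\<lambda>t. ?B t / s t) has_real_derivative
     - 2 * fx 0 t * ft 0 t - 2 * ?C - s' t * (fx (s t) t)\<^sup>2) (at t)" .
  show ?thesis
    by (rule has_field_derivative_transform_within_open[OF d3, of "{0<..}"]) (use t N s_pos[OF less_imp_le] in \<open>auto simp: N_def less_imp_neq[symmetric]\<close>)
qed

end

section \<open>Minimum principle and energy inequalities\<close>

lemma exponential_decay:
  fixes V V' :: "real \<Rightarrow> real"
  assumes "continuous_on {0..} V" and V': "\<And>t. 0 < t \<Longrightarrow> (V has_real_derivative V' t) (at t)"
    and le: "\<And>t. 0 < t \<Longrightarrow> V' t \<le> - \<kappa> * V t" and "0 \<le> t"
  shows "V t \<le> exp (- \<kappa> * t) * V 0"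
proof -
  have "exp (\<kappa> * t) * V t \<le> exp (\<kappa> * 0) * V 0"
  proof (rule DERIV_nonpos_imp_decreasing_open[of 0 t "\<lambda>t. exp (\<kappa> * t) * V t"])
    fix x :: real assume "0 < x"
    then have "((\<lambda>t. exp (\<kappa> * t) * V t) has_real_derivative exp (\<kappa> * x) * (\<kappa> * V x + V' x)) (at x)"
      by (auto intro!: derivative_eq_intros V' simp: algebra_simps)
    moreover have "exp (\<kappa> * x) * (\<kappa> * V x + V' x) \<le> 0"
      using le[OF \<open>0 < x\<close>] by (intro mult_nonneg_nonpos) auto
    ultimately show "\<exists>y. ((\<lambda>t. exp (\<kappa> * t) * V t) has_real_derivative y) (at x) \<and> y \<le> 0" by blast
  qed (use assms in \<open>auto intro!: continuous_intros intro: continuous_on_subset\<close>)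
  then show ?thesis by (simp add: exp_minus field_simps)
qed

text \<open>The variance of \<open>g\<close> is nonnegative.\<close>

lemma square_integral_le:
  fixes g :: "real \<Rightarrow> real"
  assumes "continuous_on {a..b} g" "a \<le> b"
  shows "(integral {a..b} g)\<^sup>2 \<le> (b - a) * integral {a..b} (\<lambda>x. (g x)\<^sup>2)"
proof (cases "a = b")
  case False
  define c where "c = integral {a..b} g / (b - a)"
  have ab: "b - a > 0" using False assms by simp
  have "((\<lambda>x. (g x)\<^sup>2 - (2 * c) * g x + c\<^sup>2) has_integral
      integral {a..b} (\<lambda>x. (g x)\<^sup>2) - (2 * c) * integral {a..b} g + c\<^sup>2 * (b - a)) {a..b}"
    using has_integral_const_real[of "c\<^sup>2" a b] assms(2)
    by (intro has_integral_add has_integral_diff has_integral_mult_right integrable_integral integrable_continuous_interval continuous_intros assms)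
       (simp add: mult.commute)
  moreover have "0 \<le> (g x)\<^sup>2 - (2 * c) * g x + c\<^sup>2" for x
    using zero_le_power2[of "g x - c"] by (simp add: power2_diff algebra_simps)
  ultimately have "0 \<le> integral {a..b} (\<lambda>x. (g x)\<^sup>2) - (2 * c) * integral {a..b} g + c\<^sup>2 * (b - a)"
    by (rule has_integral_nonneg)
  moreover have "integral {a..b} g = c * (b - a)" using ab by (simp add: c_def)
  ultimately have "0 \<le> integral {a..b} (\<lambda>x. (g x)\<^sup>2) - c\<^sup>2 * (b - a)"
    by (simp add: power2_eq_square algebra_simps)
  then have "0 \<le> (b - a) * (integral {a..b} (\<lambda>x. (g x)\<^sup>2) - c\<^sup>2 * (b - a))" using ab by simp
  also have "\<dots> = (b - a) * integral {a..b} (\<lambda>x. (g x)\<^sup>2) - (c * (b - a))\<^sup>2"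
    by (simp add: power2_eq_square algebra_simps)
  finally show ?thesis using \<open>integral {a..b} g = c * (b - a)\<close> by simp
qed simp

lemma square_le_energy:
  fixes f f' :: "real \<Rightarrow> real"
  assumes f': "\<And>x. x \<in> {0..L} \<Longrightarrow> (f has_real_derivative f' x) (at x within {0..L})"
    and c: "continuous_on {0..L} f'" and f: "f L = 0" and x: "x \<in> {0..L}"
  shows "(f x)\<^sup>2 \<le> L * integral {0..L} (\<lambda>x. (f' x)\<^sup>2)"
proof -
  have cx: "continuous_on {x..L} f'" by (rule continuous_on_subset[OF c]) (use x in auto)
  have "(f' has_integral f L - f x) {x..L}"
  proof (rule has_integral_derivative)
    fix y assume "y \<in> {x..L}"
    then show "(f has_real_derivative f' y) (at y within {x..L})"
      by (intro DERIV_subset[OF f']) (use x in auto)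
  qed (use x in auto)
  then have "(f x)\<^sup>2 = (integral {x..L} f')\<^sup>2" using f by (simp add: has_integral_iff)
  also have "\<dots> \<le> (L - x) * integral {x..L} (\<lambda>x. (f' x)\<^sup>2)" by (rule square_integral_le[OF cx]) (use x in auto)
  also have "\<dots> \<le> L * integral {0..L} (\<lambda>x. (f' x)\<^sup>2)"
    using x by (intro mult_mono integral_subset_le integral_nonneg integrable_continuous_interval continuous_intros c cx) auto
  finally show ?thesis .
qed

lemma poincare:
  fixes f f' :: "real \<Rightarrow> real"
  assumes f': "\<And>x. x \<in> {0..L} \<Longrightarrow> (f has_real_derivative f' x) (at x within {0..L})"
    and c: "continuous_on {0..L} f'" and f: "f L = 0" and "0 \<le> L"
  shows "integral {0..L} (\<lambda>x. (f x)\<^sup>2) \<le> L\<^sup>2 * integral {0..L} (\<lambda>x. (f' x)\<^sup>2)"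
proof -
  have cf: "continuous_on {0..L} f" by (meson DERIV_continuous continuous_on_eq_continuous_within f')
  have "integral {0..L} (\<lambda>x. (f x)\<^sup>2) \<le> integral {0..L} (\<lambda>x. L * integral {0..L} (\<lambda>x. (f' x)\<^sup>2))"
    by (intro integral_le integrable_continuous_interval continuous_intros cf square_le_energy[OF f' c f])
  also have "\<dots> = L\<^sup>2 * integral {0..L} (\<lambda>x. (f' x)\<^sup>2)"
    using assms(4) by (simp add: power2_eq_square)
  finally show ?thesis .
qed

text \<open>If \<open>D\<close> were negative, \<open>g'\<close> would be negative immediately to the right of the minimum. The argument only
looks to the right, so it covers the left end point, where the slope is assumed to be nonpositive.\<close>

lemma second_derivative_at_minimum:
  fixes g g' :: "real \<Rightarrow> real"
  assumes g': "\<And>y. y \<in> {0..L} \<Longrightarrow> (g has_real_derivative g' y) (at y within {0..L})"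
    and g'': "(g' has_real_derivative D) (at x within {0..L})"
    and x: "0 \<le> x" "x < L" and min: "\<And>y. y \<in> {0..L} \<Longrightarrow> g x \<le> g y" and 0: "x = 0 \<Longrightarrow> g' 0 \<le> 0"
  shows "0 \<le> D"
proof (rule ccontr)
  assume D: "\<not> 0 \<le> D"
  have "0 \<le> g' x"
  proof (rule ccontr)
    assume "\<not> 0 \<le> g' x"
    with has_real_derivative_neg_dec_right[OF g'[of x]] x obtain d where
      d: "d > 0" "\<And>h. 0 < h \<Longrightarrow> x + h \<in> {0..L} \<Longrightarrow> h < d \<Longrightarrow> g (x + h) < g x" by auto
    define h where "h = min (d / 2) (L - x)"
    have "0 < h" "h < d" "x + h \<in> {0..L}" using d x by (auto simp: h_def)
    with d(2)[of h] min[of "x + h"] show False by auto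
  qed
  moreover have "g' x \<le> 0"
  proof (cases "x = 0")
    case False
    show ?thesis
    proof (rule ccontr)
      assume "\<not> g' x \<le> 0"
      with has_real_derivative_pos_inc_left[OF g'[of x]] x obtain d where
        d: "d > 0" "\<And>h. 0 < h \<Longrightarrow> x - h \<in> {0..L} \<Longrightarrow> h < d \<Longrightarrow> g (x - h) < g x" by auto
      define h where "h = min (d / 2) x"
      have "0 < h" "h < d" "x - h \<in> {0..L}" using d x False by (auto simp: h_def)
      with d(2)[of h] min[of "x - h"] show False by auto
    qed
  qed (use 0 in simp)
  ultimately have g0: "g' x = 0" by simp
  from has_real_derivative_neg_dec_right[OF g''] D obtain d where
    d: "d > 0" "\<And>h. 0 < h \<Longrightarrow> x + h \<in> {0..L} \<Longrightarrow> h < d \<Longrightarrow> g' (x + h) < g' x" by auto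
  define h where "h = min (d / 2) (L - x)"
  have h: "0 < h" "h < d" "x + h \<in> {0..L}" using d x by (auto simp: h_def)
  have "g x > g (x + h)"
  proof (rule DERIV_neg_imp_decreasing_open[where f = g and a = x and b = "x + h"])
    fix y assume y: "x < y" "y < x + h"
    then have "g' y < 0" using d(2)[of "y - x"] h x g0 by auto
    moreover have "(g has_real_derivative g' y) (at y)"
      using g'[of y] y x h at_within_interior[of y "{0..L}"] by auto
    ultimately show "\<exists>z. (g has_real_derivative z) (at y) \<and> z < 0" by blast
  next
    have "continuous_on {0..L} g" by (meson DERIV_continuous continuous_on_eq_continuous_within g')
    then show "continuous_on {x..x + h} g" by (rule continuous_on_subset) (use x h in auto)
  qed (use h in auto)
  with min[OF h(3)] show False by simp
qed

lemma integrable_bounded_continuous: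
  fixes g :: "real \<Rightarrow> real"
  assumes "continuous_on {0<..b} g" "\<And>x. x \<in> {0<..b} \<Longrightarrow> \<bar>g x\<bar> \<le> B"
  shows "g integrable_on {0<..b}"
proof (rule measurable_bounded_by_integrable_imp_integrable)
  show "g \<in> borel_measurable (lebesgue_on {0<..b})"
    by (rule continuous_imp_measurable_on_sets_lebesgue[OF assms(1)]) simp
  show "(\<lambda>x. B) integrable_on {0<..b}"
    by (rule integrable_on_const) (rule fmeasurableI2[of "{0..b}"], auto)
qed (use assms in auto)

lemma half_open_spike:
  fixes g :: "real \<Rightarrow> real"
  shows "integral {0<..b} g = integral {0..b} g" "g integrable_on {0<..b} \<longleftrightarrow> g integrable_on {0..b}"
proof -
  have n: "negligible ({0<..b} - {0..b} \<union> ({0..b} - {0<..b}))"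
    by (rule negligible_subset[of "{0}"]) auto
  have "(g has_integral i) {0<..b} \<longleftrightarrow> (g has_integral i) {0..b}" for i
    by (rule has_integral_spike_set_eq; rule negligible_subset[OF n]) auto
  then show "integral {0<..b} g = integral {0..b} g" "g integrable_on {0<..b} \<longleftrightarrow> g integrable_on {0..b}"
    by (simp_all add: integral_def integrable_on_def)
qed

context moving_interval begin

lemma at_within_moving_domain:
  assumes "0 < t" "0 \<le> x" "x < s t"
  shows "at t within {\<tau>. (x, \<tau>) \<in> moving_domain s} = at t"
proof (rule at_within_interior)
  have "open ({0<..} \<inter> s -` {x<..})"
    by (rule continuous_open_preimage[OF continuous_s_pos(1)]) auto
  moreover have "{0<..} \<inter> s -` {x<..} \<subseteq> {\<tau>. (x, \<tau>) \<in> moving_domain s}"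
    using assms by (auto simp: moving_domain_def)
  moreover have "t \<in> {0<..} \<inter> s -` {x<..}" using assms by auto
  ultimately show "t \<in> interior {\<tau>. (x, \<tau>) \<in> moving_domain s}" by (meson interiorI)
qed

text \<open>If \<open>f\<close> took a negative value, \<open>exp (- t) * f x t\<close> would have a negative minimum over the times considered.
It is attained at a positive time and off the interface, where \<open>f_t \<le> f < 0\<close> and \<open>f_xx \<ge> 0\<close>, against the
differential inequality. The exponential factor makes the contradiction strict even for \<open>\<nu> = 0\<close>.\<close>

lemma minimum_principle:
  fixes f fx fxx ft :: "real \<Rightarrow> real \<Rightarrow> real"
  assumes cont: "continuous_on (moving_domain s) (\<lambda>(x, t). f x t)"
    and fx: "\<And>t x. 0 < t \<Longrightarrow> x \<in> {0..s t} \<Longrightarrow> ((\<lambda>y. f y t) has_real_derivative fx x t) (at x within {0..s t})"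
    and fxx: "\<And>t x. 0 < t \<Longrightarrow> x \<in> {0..s t} \<Longrightarrow> ((\<lambda>y. fx y t) has_real_derivative fxx x t) (at x within {0..s t})"
    and ft: "\<And>t x. 0 < t \<Longrightarrow> 0 \<le> x \<Longrightarrow> x < s t \<Longrightarrow> ((\<lambda>\<tau>. f x \<tau>) has_real_derivative ft x t) (at t)"
    and pde: "\<And>t x. 0 < t \<Longrightarrow> 0 \<le> x \<Longrightarrow> x < s t \<Longrightarrow> \<alpha> * fxx x t - \<nu> * f x t \<le> ft x t"
    and "0 \<le> \<alpha>" "0 \<le> \<nu>"
    and left: "\<And>t. 0 < t \<Longrightarrow> fx 0 t \<le> 0" and right: "\<And>t. 0 \<le> t \<Longrightarrow> 0 \<le> f (s t) t"
    and init: "\<And>x. x \<in> {0..s 0} \<Longrightarrow> 0 \<le> f x 0"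
    and t: "0 \<le> t" and x: "x \<in> {0..s t}"
  shows "0 \<le> f x t"
proof (rule ccontr)
  assume neg: "\<not> 0 \<le> f x t"
  define \<phi> where "\<phi> z = exp (- fst z) * f (snd z * s (fst z)) (fst z)" for z
  let ?K = "{0..t} \<times> {0..1::real}"
  have "continuous_on ?K (\<lambda>z. s (fst z))"
    by (rule continuous_on_compose2[OF continuous_s]) (auto intro!: continuous_intros)
  then have "continuous_on ?K (\<lambda>z. f (snd z * s (fst z)) (fst z))"
    using s_pos
    by (intro continuous_on_compose_field[OF cont] continuous_on_mult continuous_on_fst continuous_on_snd continuous_on_id)
       (auto simp: moving_domain_def mult_left_le_one_le less_imp_le)
  then have "continuous_on ?K \<phi>"
    unfolding \<phi>_def by (intro continuous_on_mult continuous_on_exp continuous_on_minus continuous_on_fst continuous_on_id)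
  moreover have "compact ?K" by (intro compact_Times compact_Icc)
  moreover have "?K \<noteq> {}" using t by auto
  ultimately obtain z where z: "z \<in> ?K" "\<And>w. w \<in> ?K \<Longrightarrow> \<phi> z \<le> \<phi> w"
    using continuous_attains_inf[of ?K \<phi>] by blast
  define \<tau> X where "\<tau> = fst z" and "X = snd z * s \<tau>"
  have \<tau>: "0 \<le> \<tau>" "\<tau> \<le> t" using z(1) by (auto simp: \<tau>_def)
  have X: "0 \<le> X" "X \<le> s \<tau>" using z(1) s_pos[OF \<tau>(1)] by (auto simp: X_def mult_left_le_one_le)
  have min: "exp (- \<tau>) * f X \<tau> \<le> exp (- r) * f y r" if "0 \<le> r" "r \<le> t" "0 \<le> y" "y \<le> s r" for r y
  proof -
    have "(r, y / s r) \<in> ?K" using that s_pos[of r] by auto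
    from z(2)[OF this] show ?thesis using s_pos[of r] that by (simp add: \<phi>_def \<tau>_def X_def)
  qed
  have "exp (- t) * f x t < 0" using neg by (simp add: mult_pos_neg)
  with min[of t x] t x have "exp (- \<tau>) * f X \<tau> < 0" by auto
  then have fneg: "f X \<tau> < 0" by (simp add: mult_less_0_iff)
  have "\<tau> \<noteq> 0" using init[of X] X fneg by auto
  then have \<tau>0: "0 < \<tau>" using \<tau> by simp
  have "X \<noteq> s \<tau>" using right[OF \<tau>(1)] fneg by auto
  then have Xs: "X < s \<tau>" using X by simp
  have fxx0: "0 \<le> fxx X \<tau>"
  proof (rule second_derivative_at_minimum[OF fx[OF \<tau>0] fxx[OF \<tau>0]])
    show "f X \<tau> \<le> f y \<tau>" if "y \<in> {0..s \<tau>}" for y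
      using min[of \<tau> y] that \<tau> by simp
  qed (use X Xs left[OF \<tau>0] in auto)
  define D where "D = exp (- \<tau>) * (ft X \<tau> - f X \<tau>)"
  have D: "((\<lambda>r. exp (- r) * f X r) has_real_derivative D) (at \<tau>)"
    unfolding D_def by (rule derivative_eq_intros ft[OF \<tau>0 X(1) Xs] refl)+ (simp add: algebra_simps)
  have "D \<le> 0"
  proof (rule ccontr)
    assume "\<not> D \<le> 0"
    with has_real_derivative_pos_inc_left[OF D] obtain d where
      d: "d > 0" "\<And>h. 0 < h \<Longrightarrow> h < d \<Longrightarrow> exp (- (\<tau> - h)) * f X (\<tau> - h) < exp (- \<tau>) * f X \<tau>" by auto
    have "(s \<longlongrightarrow> s \<tau>) (at \<tau>)" using DERIV_isCont[OF DERIV_s[OF \<tau>0]] by (simp add: isCont_def)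
    from order_tendstoD(1)[OF this Xs] obtain e where e: "e > 0" "\<And>r. r \<noteq> \<tau> \<Longrightarrow> dist r \<tau> < e \<Longrightarrow> X < s r"
      unfolding eventually_at by auto
    define h where "h = min (min d e) \<tau> / 2"
    have h: "0 < h" "h < d" "h < e" "h < \<tau>" using d e \<tau>0 by (auto simp: h_def)
    have "X < s (\<tau> - h)" using e(2)[of "\<tau> - h"] h by (simp add: dist_real_def)
    with min[of "\<tau> - h" X] d(2)[OF h(1,2)] h \<tau> X show False by auto
  qed
  then have "ft X \<tau> \<le> f X \<tau>" by (simp add: D_def mult_le_0_iff)
  moreover have "0 \<le> \<alpha> * fxx X \<tau> - \<nu> * f X \<tau>"
    using mult_nonneg_nonneg[OF \<open>0 \<le> \<alpha>\<close> fxx0] mult_nonneg_nonpos[OF \<open>0 \<le> \<nu>\<close> less_imp_le[OF fneg]] by linarith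
  ultimately show False using pde[OF \<tau>0 X(1) Xs] fneg by simp
qed

lemma continuous_on_integral_field:
  fixes f :: "real \<Rightarrow> real \<Rightarrow> real"
  assumes "continuous_on (moving_domain s) (\<lambda>(x, t). f x t)"
  shows "continuous_on {0..} (\<lambda>t. integral {0..s t} (\<lambda>x. f x t))"
proof (rule continuous_on_integral_moving)
  have "continuous_on (SIGMA t:{0..}. {0..s t}) (\<lambda>z. f (snd z) (fst z))"
    by (rule continuous_on_compose_field[OF assms]) (auto simp: moving_domain_def intro!: continuous_intros)
  then show "continuous_on (SIGMA t:{0..}. {0..s t}) (\<lambda>(t, x). f x t)" by (simp add: case_prod_beta)
qed (use continuous_s s_pos in \<open>auto intro: less_imp_le\<close>)

text \<open>The first space derivative may jump at the corner \<open>(0, 0)\<close>. Being bounded there, it still has integrals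
that are continuous in time, by dominated convergence after rescaling.\<close>

lemma integral_field_corner:
  fixes g :: "real \<Rightarrow> real \<Rightarrow> real"
  assumes cont: "continuous_on (moving_domain s - {(0, 0)}) (\<lambda>(x, t). g x t)"
    and B: "\<And>x t. (x, t) \<in> moving_domain s \<Longrightarrow> t \<le> 1 \<Longrightarrow> \<bar>g x t\<bar> \<le> B"
  shows "continuous_on {0..} (\<lambda>t. integral {0..s t} (\<lambda>x. g x t))" "(\<lambda>x. g x 0) integrable_on {0..s 0}"
proof -
  have slice: "continuous_on {0<..s 0} (\<lambda>x. g x 0)"
    by (rule continuous_on_compose_field[OF cont]) (auto simp: moving_domain_def intro!: continuous_intros)
  show "(\<lambda>x. g x 0) integrable_on {0..s 0}"
    unfolding half_open_spike(2)[symmetric]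
    by (rule integrable_bounded_continuous[OF slice, of B]) (auto intro!: B simp: moving_domain_def)
  let ?G = "\<lambda>t. integral {0..s t} (\<lambda>x. g x t)"
  have "continuous_on {0<..} ?G"
  proof (rule continuous_on_integral_moving)
    have "continuous_on (SIGMA t:{0<..}. {0..s t}) (\<lambda>z. g (snd z) (fst z))"
      by (rule continuous_on_compose_field[OF cont]) (auto simp: moving_domain_def intro!: continuous_intros)
    then show "continuous_on (SIGMA t:{0<..}. {0..s t}) (\<lambda>(t, x). g x t)" by (simp add: case_prod_beta)
  qed (use continuous_s_pos s_pos in \<open>auto intro: less_imp_le\<close>)
  then have pos: "isCont ?G t" if "0 < t" for t using that by (simp add: continuous_on_eq_continuous_at)
  have zero: "continuous (at 0 within {0..}) ?G"
    unfolding continuous_within_sequentially o_def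
  proof (intro allI impI, elim conjE)
    fix r :: "nat \<Rightarrow> real" assume r: "\<forall>n. r n \<in> {0..}" "r \<longlonglongrightarrow> 0"
    from order_tendstoD(2)[OF r(2), of 1] obtain N where N: "\<And>n. N \<le> n \<Longrightarrow> r n < 1"
      by (auto simp: eventually_sequentially)
    define q where "q n = r (n + N)" for n
    have q: "0 \<le> q n" "q n \<le> 1" for n using r(1) N[of "n + N"] by (auto simp: q_def intro: less_imp_le)
    have q0: "q \<longlonglongrightarrow> 0" unfolding q_def by (rule LIMSEQ_ignore_initial_segment[OF r(2)])
    have sq: "(\<lambda>n. s (q n)) \<longlonglongrightarrow> s 0"
      using continuous_on_tendsto_compose[OF continuous_s q0] q by auto
    define h where "h n e = g (e * s (q n)) (q n)" for n e
    have dom: "(e * s t, t) \<in> moving_domain s - {(0, 0)}" if "e \<in> {0<..1}" "0 \<le> t" for e t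
      using that s_pos[of t] by (auto simp: moving_domain_def mult_left_le_one_le)
    have "(\<lambda>n. integral {0<..1} (h n)) \<longlonglongrightarrow> integral {0<..1} (\<lambda>e. g (e * s 0) 0)"
    proof (rule dominated_convergence)
      fix n
      have c: "continuous_on {0<..1} (h n)"
        unfolding h_def[abs_def] by (intro continuous_on_compose_field[OF cont] continuous_intros dom q)
      have b: "\<bar>h n e\<bar> \<le> B" if "e \<in> {0<..1}" for e
        unfolding h_def using B[of "e * s (q n)" "q n"] dom[OF that q(1)] q(2) by auto
      show "h n integrable_on {0<..1}" by (rule integrable_bounded_continuous[OF c b])
      show "norm (h n e) \<le> B" if "e \<in> {0<..1}" for e using b[OF that] by simp
    next
      show "(\<lambda>x. B) integrable_on {0<..1::real}"
        using half_open_spike(2)[where b = 1 and g = "\<lambda>x. B"] integrable_continuous_interval[OF continuous_on_const] by simp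
      fix e :: real assume e: "e \<in> {0<..1}"
      have "(\<lambda>n. case (e * s (q n), q n) of (x, t) \<Rightarrow> g x t) \<longlonglongrightarrow> (case (e * s 0, 0) of (x, t) \<Rightarrow> g x t)"
        by (rule continuous_on_tendsto_compose[OF cont])
           (intro tendsto_Pair tendsto_mult_left sq q0 dom[OF e] order_refl always_eventually allI q)+
      then show "(\<lambda>n. h n e) \<longlonglongrightarrow> g (e * s 0) 0" by (simp add: h_def)
    qed
    then have "(\<lambda>n. s (q n) * integral {0..1} (\<lambda>e. g (e * s (q n)) (q n))) \<longlonglongrightarrow> s 0 * integral {0..1} (\<lambda>e. g (e * s 0) 0)"
      unfolding half_open_spike h_def by (intro tendsto_mult sq)
    then have "(\<lambda>n. ?G (q n)) \<longlonglongrightarrow> ?G 0" using q by (simp add: integral_rescaled)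
    then show "(\<lambda>n. ?G (r n)) \<longlonglongrightarrow> ?G 0"
      unfolding q_def by (rule LIMSEQ_offset)
  qed
  show "continuous_on {0..} ?G"
    unfolding continuous_on_eq_continuous_within
  proof
    fix t :: real assume "t \<in> {0..}"
    then show "continuous (at t within {0..}) ?G"
      using zero continuous_at_imp_continuous_at_within[OF pos[of t]] by (cases "t = 0") auto
  qed
qed

end

section \<open>Sign of the observer error\<close>

lemma bkernel_nonneg: "0 \<le> a \<Longrightarrow> 0 \<le> \<zeta> \<Longrightarrow> 0 \<le> bkernel a \<zeta>"
  by (simp add: bkernel_def bessel_series_ge_0)

lemma volterra_nonneg:
  assumes "continuous_on UNIV \<kappa>" "continuous_on {x..s} f" "0 \<le> x"
    and "\<And>\<zeta>. 0 \<le> \<zeta> \<Longrightarrow> 0 \<le> \<kappa> \<zeta>" "\<And>y. y \<in> {x..s} \<Longrightarrow> 0 \<le> f y"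
  shows "0 \<le> volterra \<kappa> s f x"
  unfolding volterra_def
proof (rule integral_nonneg)
  show "(\<lambda>y. 2 * y * \<kappa> (y\<^sup>2 - x\<^sup>2) * f y) integrable_on {x..s}"
    by (intro integrable_continuous_interval continuous_volterra_integrand assms)
  fix y assume y: "y \<in> {x..s}"
  then have "0 \<le> y\<^sup>2 - x\<^sup>2" using assms(3) by (simp add: power_mono)
  then show "0 \<le> 2 * y * \<kappa> (y\<^sup>2 - x\<^sup>2) * f y" using y assms by (intro mult_nonneg_nonneg) auto
qed

text \<open>As long as \<open>a (y^2 - x^2) \<le> 1\<close>, the kernel is at least \<open>- a\<close>, so the integral term takes away at most
\<open>a L^2 Hhat (L - x)\<close>. The bound on \<open>a\<close> is exactly what the gap between the two slopes can pay for.\<close>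

lemma backstepping_transform_nonneg:
  fixes f :: "real \<Rightarrow> real"
  assumes f: "continuous_on {0..L} f" and a: "0 < a" "a * L\<^sup>2 \<le> 1 - H / Hhat" and H: "0 < H" "H < Hhat"
    and bounds: "\<And>x. x \<in> {0..L} \<Longrightarrow> (Hhat - H) * (L - x) \<le> f x \<and> f x \<le> Hhat * (L - x)"
    and x: "x \<in> {0..L}"
  shows "0 \<le> f x + volterra (bkernel (- a)) L f x"
proof -
  have fx: "continuous_on {x..L} f" by (rule continuous_on_subset[OF f]) (use x in auto)
  have ck: "continuous_on UNIV (bkernel (- a))" by (intro continuous_intros continuous_on_id[unfolded id_def])
  have "integral {x..L} (\<lambda>y. (- (a * Hhat * (L - x))) * (2 * y)) \<le> volterra (bkernel (- a)) L f x"
    unfolding volterra_def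
  proof (rule integral_le)
    show "(\<lambda>y. 2 * y * bkernel (- a) (y\<^sup>2 - x\<^sup>2) * f y) integrable_on {x..L}"
      by (intro integrable_continuous_interval continuous_volterra_integrand ck fx)
    fix y assume y: "y \<in> {x..L}"
    have "x\<^sup>2 \<le> y\<^sup>2" "y\<^sup>2 \<le> L\<^sup>2" using x y by (auto intro!: power_mono)
    moreover from this have "y\<^sup>2 - x\<^sup>2 \<le> L\<^sup>2" using zero_le_power2[of x] by linarith
    ultimately have "0 \<le> a * (y\<^sup>2 - x\<^sup>2)" "a * (y\<^sup>2 - x\<^sup>2) \<le> a * L\<^sup>2" using a by auto
    moreover have "a * L\<^sup>2 \<le> 1" using a(2) H by (smt (verit) divide_pos_pos)
    ultimately have "bessel_series 1 (- (a * (y\<^sup>2 - x\<^sup>2))) \<le> 1"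
      using bessel_series_minus_le[of "a * (y\<^sup>2 - x\<^sup>2)" 1] by simp
    then have k: "- a \<le> bkernel (- a) (y\<^sup>2 - x\<^sup>2)" using a(1) by (simp add: bkernel_def)
    have fy: "0 \<le> f y" "f y \<le> Hhat * (L - x)"
    proof -
      have "0 \<le> (Hhat - H) * (L - y)" using H y by simp
      then show "0 \<le> f y" using bounds[of y] x y by auto
      have "Hhat * (L - y) \<le> Hhat * (L - x)" using H y by simp
      then show "f y \<le> Hhat * (L - x)" using bounds[of y] x y by auto
    qed
    have "- a * (Hhat * (L - x)) \<le> - a * f y" using fy a by simp
    also have "\<dots> \<le> bkernel (- a) (y\<^sup>2 - x\<^sup>2) * f y" using k fy by (intro mult_right_mono)
    finally have "2 * y * (- a * (Hhat * (L - x))) \<le> 2 * y * (bkernel (- a) (y\<^sup>2 - x\<^sup>2) * f y)"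
      using x y by (intro mult_left_mono) auto
    then show "(- (a * Hhat * (L - x))) * (2 * y) \<le> 2 * y * bkernel (- a) (y\<^sup>2 - x\<^sup>2) * f y"
      by (simp add: mult_ac)
  qed (intro integrable_continuous_interval continuous_intros)
  also have "integral {x..L} (\<lambda>y. (- (a * Hhat * (L - x))) * (2 * y)) = (- (a * Hhat * (L - x))) * (L\<^sup>2 - x\<^sup>2)"
  proof -
    have "((\<lambda>y. 2 * y) has_integral L\<^sup>2 - x\<^sup>2) {x..L}"
      by (rule has_integral_derivative)
         (use x in \<open>auto intro!: derivative_eq_intros\<close>)
    from has_integral_mult_right[OF this, of "- (a * Hhat * (L - x))"] show ?thesis by (rule integral_unique)
  qed
  finally have 1: "- (a * Hhat * (L - x)) * (L\<^sup>2 - x\<^sup>2) \<le> volterra (bkernel (- a)) L f x" .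
  have "a * Hhat * (L - x) * (L\<^sup>2 - x\<^sup>2) \<le> a * Hhat * (L - x) * L\<^sup>2"
    using a H x by (intro mult_left_mono) auto
  also have "\<dots> = (a * L\<^sup>2) * Hhat * (L - x)" by (simp add: mult_ac)
  also have "\<dots> \<le> (1 - H / Hhat) * Hhat * (L - x)" using a H x by (intro mult_right_mono) auto
  also have "\<dots> = (Hhat - H) * (L - x)" using H by (simp add: field_simps)
  also have "\<dots> \<le> f x" using bounds[OF x] by simp
  finally show ?thesis using 1 by simp
qed

lemma nonpos_derivative_at_right_end:
  fixes g :: "real \<Rightarrow> real"
  assumes "(g has_real_derivative D) (at L within {0..L})" "0 < L" "g L = 0" "\<And>x. x \<in> {0..L} \<Longrightarrow> 0 \<le> g x"
  shows "D \<le> 0"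
proof (rule ccontr)
  assume "\<not> D \<le> 0"
  with has_real_derivative_pos_inc_left[OF assms(1)] obtain d where
    d: "d > 0" "\<And>h. 0 < h \<Longrightarrow> L - h \<in> {0..L} \<Longrightarrow> h < d \<Longrightarrow> g (L - h) < g L" by auto
  define h where "h = min (d / 2) L"
  have "0 < h" "h < d" "L - h \<in> {0..L}" using d assms(2) by (auto simp: h_def)
  with d(2)[of h] assms(3) assms(4)[of "L - h"] show False by auto
qed

context moving_interval begin

text \<open>The integral from \<open>x\<close> to the interface is split at \<open>x\<close> into an integral from 0 over the moving
interval, where nothing enters at the interface because \<open>f\<close> vanishes there, and one over \<open>[0, x]\<close>.\<close>

lemma DERIV_volterra_time:
  assumes F: "C1_field s f fx ft" and f0: "\<And>t. 0 < t \<Longrightarrow> f (s t) t = 0"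
    and t: "0 < t" and x: "0 \<le> x" "x < s t"
  shows "((\<lambda>t. volterra (bkernel b) (s t) (\<lambda>y. f y t) x) has_real_derivative volterra (bkernel b) (s t) (\<lambda>y. ft y t) x) (at t)"
proof -
  note FF = C1_fieldD[OF F]
  define K where "K y = 2 * y * bkernel b (y\<^sup>2 - x\<^sup>2)" for y
  define K' where "K' y = 2 * bkernel b (y\<^sup>2 - x\<^sup>2) + 2 * y * (bkernel' b (y\<^sup>2 - x\<^sup>2) * (2 * y))" for y
  have K: "(K has_real_derivative K' y) (at y)" for y
    unfolding K_def[abs_def] K'_def
    by (rule derivative_eq_intros DERIV_chain2[OF DERIV_bkernel] refl)+ simp
  have "continuous_on UNIV K'" unfolding K'_def[abs_def] by (intro continuous_intros)
  from C1_field_mult[OF C1_field_space_only[OF K this] F]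
  have "C1_field s (\<lambda>y t. K y * f y t) (\<lambda>y t. K' y * f y t + fx y t * K y) (\<lambda>y t. 0 * f y t + ft y t * K y)" .
  from transport_theorem[OF this t]
  have d1: "((\<lambda>t. integral {0..s t} (\<lambda>y. K y * f y t)) has_real_derivative integral {0..s t} (\<lambda>y. ft y t * K y)) (at t)"
    using f0[OF t] by simp
  have op: "open ({0<..} \<inter> s -` {x<..})"
    by (rule continuous_open_preimage[OF continuous_s_pos(1)]) auto
  moreover have "t \<in> {0<..} \<inter> s -` {x<..}" using t x by auto
  ultimately obtain e where e: "e > 0" "ball t e \<subseteq> {0<..} \<inter> s -` {x<..}" unfolding open_contains_ball by blast
  have te: "t \<in> ball t e" using e by simp
  have near: "0 < r" "x < s r" if "r \<in> ball t e" for r using e(2) that by auto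
  have sub: "{0..x} \<subseteq> {0..s r}" "\<And>y. y \<in> {0..x} \<Longrightarrow> y < s r" if "r \<in> ball t e" for r using near[OF that] by auto
  have cK: "continuous_on S K" for S using K DERIV_isCont continuous_at_imp_continuous_on by blast
  have cKf: "continuous_on {0..s r} (\<lambda>y. K y * f y r)" "continuous_on {0..s r} (\<lambda>y. ft y r * K y)" if "0 < r" for r
    by (intro continuous_intros continuous_slice[OF FF(1)] continuous_slice[OF FF(3)] cK that)+
  have "((\<lambda>t. integral (cbox 0 x) (\<lambda>y. K y * f y t)) has_real_derivative integral (cbox 0 x) (\<lambda>y. ft y t * K y)) (at t within ball t e)"
  proof (rule leibniz_rule_field_derivative)
    fix r y assume r: "r \<in> ball t e" and y: "y \<in> cbox 0 x"
    from y sub[OF r] have y': "y \<in> {0..s r}" "y < s r" "0 \<le> y" by auto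
    have "((\<lambda>r. f y r) has_real_derivative ft y r) (at r)"
      using FF(5)[OF near(1)[OF r] y'(1)] at_within_moving_domain[OF near(1)[OF r] y'(3,2)] by simp
    from DERIV_cmult[OF this, of "K y"] have "((\<lambda>r. K y * f y r) has_real_derivative ft y r * K y) (at r)" by (simp add: mult.commute)
    then show "((\<lambda>r. K y * f y r) has_real_derivative ft y r * K y) (at r within ball t e)"
      by (rule has_field_derivative_at_within)
  next
    fix r assume r: "r \<in> ball t e"
    show "(\<lambda>y. K y * f y r) integrable_on cbox 0 x"
      unfolding box_real
      by (rule integrable_continuous_interval, rule continuous_on_subset[OF cKf(1)[OF near(1)[OF r]] sub(1)[OF r]])
  next
    have "continuous_on (ball t e \<times> cbox 0 x) (\<lambda>z. ft (snd z) (fst z))"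
    proof (rule continuous_on_compose_field[OF FF(3)])
      fix z assume "z \<in> ball t e \<times> cbox 0 x"
      then have "fst z \<in> ball t e" "snd z \<in> {0..x}" by auto
      with near[OF this(1)] show "(snd z, fst z) \<in> evolution_domain s" by (auto simp: evolution_domain_def)
    qed (intro continuous_intros)+
    moreover have "continuous_on (ball t e \<times> cbox 0 x) (\<lambda>z. K (snd z))"
      by (rule continuous_on_compose2[OF cK[of UNIV]]) (intro continuous_intros, simp)
    ultimately have "continuous_on (ball t e \<times> cbox 0 x) (\<lambda>z. ft (snd z) (fst z) * K (snd z))"
      by (rule continuous_on_mult)
    then show "continuous_on (ball t e \<times> cbox 0 x) (\<lambda>(r, y). ft y r * K y)"
      by (simp add: case_prod_beta)
  qed (use te in auto)
  then have d2: "((\<lambda>t. integral {0..x} (\<lambda>y. K y * f y t)) has_real_derivative integral {0..x} (\<lambda>y. ft y t * K y)) (at t)"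
    using at_within_open[OF te open_ball] by simp
  have split: "integral {0..s r} g - integral {0..x} g = integral {x..s r} g"
    if "r \<in> ball t e" "continuous_on {0..s r} g" for r and g :: "real \<Rightarrow> real"
    using Henstock_Kurzweil_Integration.integral_combine[of 0 x "s r" g] near[OF that(1)] x integrable_continuous_interval[OF that(2)] by simp
  have "((\<lambda>t. integral {0..s t} (\<lambda>y. K y * f y t) - integral {0..x} (\<lambda>y. K y * f y t)) has_real_derivative
       integral {x..s t} (\<lambda>y. ft y t * K y)) (at t)"
    using DERIV_diff[OF d1 d2] split[OF te cKf(2)[OF t]] by simp
  then have "((\<lambda>t. volterra (bkernel b) (s t) (\<lambda>y. f y t) x) has_real_derivative integral {x..s t} (\<lambda>y. ft y t * K y)) (at t)"
  proof (rule has_field_derivative_transform_within_open[OF _ open_ball te])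
    fix r assume r: "r \<in> ball t e"
    show "integral {0..s r} (\<lambda>y. K y * f y r) - integral {0..x} (\<lambda>y. K y * f y r) = volterra (bkernel b) (s r) (\<lambda>y. f y r) x"
      using split[OF r cKf(1)[OF near(1)[OF r]]] by (simp add: volterra_def K_def)
  qed
  then show ?thesis by (simp add: volterra_def K_def mult_ac)
qed

text \<open>The transformed error \<open>w\<close> satisfies \<open>w_t = \<alpha> w_xx - 4 a \<alpha> w\<close>: the flux terms from the commutator, from
the source and from the transformed source add up to zero by \<open>bkernel_resolvent\<close>. So \<open>w\<close> obeys the
minimum principle, and both claims follow from \<open>w \<ge> 0\<close> since \<open>w\<close> and \<open>p\<close> have the same slope at the
interface and \<open>p\<close> is recovered from \<open>w\<close> with a nonnegative kernel.\<close>

lemma observer_error_sign: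
  assumes F: "C1_field s p px pt" and cont: "continuous_on (moving_domain s) (\<lambda>(x, t). p x t)"
    and pxx: "\<And>t x. 0 < t \<Longrightarrow> x \<in> {0..s t} \<Longrightarrow> ((\<lambda>y. px y t) has_real_derivative pxx x t) (at x within {0..s t})"
    and cxx: "continuous_on (evolution_domain s) (\<lambda>(x, t). pxx x t)"
    and \<alpha>: "0 < \<alpha>" and a: "0 < a"
    and pde: "\<And>t x. 0 < t \<Longrightarrow> x \<in> {0..s t} \<Longrightarrow>
       pt x t = \<alpha> * pxx x t + 2 * \<alpha> * s t * bkernel a ((s t)\<^sup>2 - x\<^sup>2) * px (s t) t"
    and left: "\<And>t. 0 < t \<Longrightarrow> px 0 t = 0" and right: "\<And>t. 0 \<le> t \<Longrightarrow> p (s t) t = 0"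
    and init: "\<And>x. x \<in> {0..s 0} \<Longrightarrow> 0 \<le> p x 0 + volterra (bkernel (- a)) (s 0) (\<lambda>x. p x 0) x"
  shows "\<And>t x. 0 \<le> t \<Longrightarrow> x \<in> {0..s t} \<Longrightarrow> 0 \<le> p x t" and "\<And>t. 0 < t \<Longrightarrow> px (s t) t \<le> 0"
proof -
  note FF = C1_fieldD[OF F]
  define V where "V f t x = volterra (bkernel (- a)) (s t) (\<lambda>y. f y t) x" for f :: "real \<Rightarrow> real \<Rightarrow> real" and t x
  define w where "w x t = p x t + V p t x" for x t
  define wx where "wx x t = px x t + - 2 * x * (- a * p x t + volterra (bkernel' (- a)) (s t) (\<lambda>y. p y t) x)" for x t
  define wxx where "wxx x t = pxx x t + (V pxx t x - 2 * s t * bkernel (- a) ((s t)\<^sup>2 - x\<^sup>2) * px (s t) t - 4 * (- a) * (p x t + V p t x))" for x t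
  define wt where "wt x t = pt x t + V pt t x" for x t
  note slice0 = continuous_slice_0[OF cont]
  have slice: "continuous_on {0..s t} (\<lambda>x. pxx x t)" "continuous_on {0..s t} (\<lambda>x. pt x t)" if "0 < t" for t
    by (intro continuous_slice cxx FF that)+
  have ck: "continuous_on UNIV (bkernel b)" for b by (intro continuous_intros continuous_on_id[unfolded id_def])
  have dw: "((\<lambda>y. w y t) has_real_derivative wx x t) (at x within {0..s t})"
    "((\<lambda>y. wx y t) has_real_derivative wxx x t) (at x within {0..s t})" if t: "0 < t" and x: "x \<in> {0..s t}" for t x
    unfolding w_def wx_def wxx_def V_def
    using volterra_commutator[OF FF(4)[OF t] pxx[OF t] slice(1)[OF t] right[OF less_imp_le[OF t]] x, of "- a"]
    by (intro DERIV_add FF(4)[OF t x] pxx[OF t x]; simp)+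
  have dt: "((\<lambda>r. w x r) has_real_derivative wt x t) (at t)" if t: "0 < t" and x: "0 \<le> x" "x < s t" for t x
    unfolding w_def wt_def V_def
  proof (rule DERIV_add)
    show "((\<lambda>r. p x r) has_real_derivative pt x t) (at t)"
      using FF(5)[OF t, of x] at_within_moving_domain[OF t x] x by simp
    show "((\<lambda>r. volterra (bkernel (- a)) (s r) (\<lambda>y. p y r) x) has_real_derivative volterra (bkernel (- a)) (s t) (\<lambda>y. pt y t) x) (at t)"
      by (rule DERIV_volterra_time[OF F right[OF less_imp_le] t x])
  qed
  have wpde: "wt x t = \<alpha> * wxx x t - 4 * a * \<alpha> * w x t" if t: "0 < t" and x: "x \<in> {0..s t}" for t x
  proof -
    define \<rho> where "\<rho> = 2 * \<alpha> * s t * px (s t) t"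
    have sub: "{x..s t} \<subseteq> {0..s t}" using x by auto
    have "V pt t x = integral {x..s t} (\<lambda>y. \<alpha> * (2 * y * bkernel (- a) (y\<^sup>2 - x\<^sup>2) * pxx y t)
          + \<rho> * (2 * y * bkernel (- a) (y\<^sup>2 - x\<^sup>2) * bkernel a ((s t)\<^sup>2 - y\<^sup>2)))"
      unfolding V_def volterra_def
    proof (rule integral_cong)
      fix y assume "y \<in> {x..s t}"
      then have "y \<in> {0..s t}" using x by auto
      then show "2 * y * bkernel (- a) (y\<^sup>2 - x\<^sup>2) * pt y t = \<alpha> * (2 * y * bkernel (- a) (y\<^sup>2 - x\<^sup>2) * pxx y t)
          + \<rho> * (2 * y * bkernel (- a) (y\<^sup>2 - x\<^sup>2) * bkernel a ((s t)\<^sup>2 - y\<^sup>2))"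
        by (simp add: pde[OF t] \<rho>_def algebra_simps)
    qed
    also have "\<dots> = \<alpha> * V pxx t x + \<rho> * - (bkernel a ((s t)\<^sup>2 - x\<^sup>2) + bkernel (- a) ((s t)\<^sup>2 - x\<^sup>2))"
      unfolding V_def volterra_def
      by (intro integral_unique has_integral_add has_integral_mult_right bkernel_resolvent integrable_integral
           integrable_continuous_interval continuous_volterra_integrand ck continuous_on_subset[OF slice(1)[OF t] sub])
         (use x in auto)
    finally show ?thesis
      unfolding wt_def wxx_def w_def pde[OF t x] \<rho>_def by (simp add: algebra_simps)
  qed
  have cw: "continuous_on (moving_domain s) (\<lambda>(x, t). w x t)"
  proof -
    have cs: "continuous_on (moving_domain s) (\<lambda>z. s (snd z))"
      by (rule continuous_on_compose2[OF continuous_s]) (auto simp: moving_domain_def intro!: continuous_intros)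
    have "continuous_on (moving_domain s) (\<lambda>z. integral {fst z..s (snd z)} (\<lambda>y. 2 * y * bkernel (- a) (y\<^sup>2 - (fst z)\<^sup>2) * p y (snd z)))"
    proof (rule continuous_on_integral_moving)
      have "continuous_on (SIGMA z:moving_domain s. {fst z..s (snd z)}) (\<lambda>w. p (snd w) (snd (fst w)))"
        by (rule continuous_on_compose_field[OF cont]) (auto simp: moving_domain_def intro!: continuous_intros)
      then have "continuous_on (SIGMA z:moving_domain s. {fst z..s (snd z)})
          (\<lambda>w. 2 * snd w * bkernel (- a) ((snd w)\<^sup>2 - (fst (fst w))\<^sup>2) * p (snd w) (snd (fst w)))"
        by (intro continuous_intros)
      then show "continuous_on (SIGMA z:moving_domain s. {fst z..s (snd z)})
          (\<lambda>(z, y). 2 * y * bkernel (- a) (y\<^sup>2 - (fst z)\<^sup>2) * p y (snd z))"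
        by (simp add: case_prod_beta)
    qed (use cs in \<open>auto simp: moving_domain_def intro!: continuous_intros\<close>)
    then show ?thesis
      using cont by (simp add: w_def V_def volterra_def case_prod_beta continuous_on_add)
  qed
  have w0: "w (s t) t = 0" if "0 \<le> t" for t using right[OF that] by (simp add: w_def V_def)
  have wpos: "0 \<le> w x t" if "0 \<le> t" "x \<in> {0..s t}" for t x
  proof (rule minimum_principle[where f = w and fx = wx and fxx = wxx and ft = wt and \<alpha> = \<alpha> and \<nu> = "4 * a * \<alpha>", OF cw dw dt])
    show "\<alpha> * wxx x t - 4 * a * \<alpha> * w x t \<le> wt x t" if "0 < t" "0 \<le> x" "x < s t" for t x
      using wpde[of t x] that by simp
    show "wx 0 t \<le> 0" if "0 < t" for t using left[OF that] by (simp add: wx_def)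
    show "0 \<le> w x 0" if "x \<in> {0..s 0}" for x using init[OF that] by (simp add: w_def V_def)
    show "0 \<le> w (s t) t" if "0 \<le> t" for t using w0[OF that] by simp
    show "0 \<le> \<alpha>" "0 \<le> 4 * a * \<alpha>" using \<alpha> a by simp_all
  qed (assumption | fact that)+
  show "px (s t) t \<le> 0" if t: "0 < t" for t
  proof -
    have "wx (s t) t \<le> 0"
      by (rule nonpos_derivative_at_right_end[OF dw(1)[OF t, of "s t"]])
         (use t s_pos[of t] w0[of t] wpos[of t] in auto)
    then show ?thesis using right[of t] t by (simp add: wx_def)
  qed
  show "0 \<le> p x t" if t: "0 \<le> t" and x: "x \<in> {0..s t}" for t x
  proof -
    have "p x t = w x t + volterra (bkernel a) (s t) (\<lambda>x. w x t) x"
      unfolding w_def V_def by (rule bkernel_volterra_inverse[OF slice0[OF t] x])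
    moreover have "0 \<le> volterra (bkernel a) (s t) (\<lambda>x. w x t) x"
    proof (rule volterra_nonneg[OF ck])
      have "continuous_on {0..s t} (\<lambda>x. w x t)"
        unfolding w_def V_def by (rule continuous_on_add[OF slice0[OF t] continuous_on_volterra[OF ck slice0[OF t]]])
      then show "continuous_on {x..s t} (\<lambda>x. w x t)" by (rule continuous_on_subset) (use x in auto)
      show "0 \<le> x" using x by simp
      show "0 \<le> bkernel a \<zeta>" if "0 \<le> \<zeta>" for \<zeta> using bkernel_nonneg[of a \<zeta>] a that by simp
      show "0 \<le> w y t" if "y \<in> {x..s t}" for y using wpos[OF t, of y] that x by simp
    qed
    ultimately show ?thesis using wpos[OF t x] by linarith
  qed
qed

end

section \<open>Energies of the closed loop\<close>

lemma integral_by_parts: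
  fixes g g' h h' :: "real \<Rightarrow> real"
  assumes "0 \<le> L"
    and g: "\<And>x. x \<in> {0..L} \<Longrightarrow> (g has_real_derivative g' x) (at x within {0..L})"
    and h: "\<And>x. x \<in> {0..L} \<Longrightarrow> (h has_real_derivative h' x) (at x within {0..L})"
    and c: "continuous_on {0..L} g'" "continuous_on {0..L} h'"
  shows "integral {0..L} (\<lambda>x. g x * h' x) = g L * h L - g 0 * h 0 - integral {0..L} (\<lambda>x. g' x * h x)"
proof -
  have cg: "continuous_on {0..L} g" by (meson DERIV_continuous continuous_on_eq_continuous_within g)
  have ch: "continuous_on {0..L} h" by (meson DERIV_continuous continuous_on_eq_continuous_within h)
  have "((\<lambda>x. g' x * h x + h' x * g x) has_integral g L * h L - g 0 * h 0) {0..L}"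
  proof (rule has_integral_derivative)
    show "((\<lambda>x. g x * h x) has_real_derivative g' x * h x + h' x * g x) (at x within {0..L})" if "x \<in> {0..L}" for x
      by (rule DERIV_mult[OF g[OF that] h[OF that]])
  qed fact
  moreover have "((\<lambda>x. g' x * h x + h' x * g x) has_integral integral {0..L} (\<lambda>x. g' x * h x) + integral {0..L} (\<lambda>x. h' x * g x)) {0..L}"
    by (intro has_integral_add integrable_integral integrable_continuous_interval continuous_intros c cg ch)
  ultimately have "integral {0..L} (\<lambda>x. g' x * h x) + integral {0..L} (\<lambda>x. h' x * g x) = g L * h L - g 0 * h 0"
    by (rule has_integral_unique[rotated])
  then show ?thesis by (simp add: mult.commute)
qed

lemma bkernel'_nonneg: "0 \<le> \<zeta> \<Longrightarrow> 0 \<le> a \<Longrightarrow> 0 \<le> bkernel' a \<zeta>"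
  by (simp add: bkernel'_def bessel_series_ge_0)

lemma bkernel'_mono: "0 \<le> a \<Longrightarrow> 0 \<le> \<zeta> \<Longrightarrow> \<zeta> \<le> \<xi> \<Longrightarrow> bkernel' a \<zeta> \<le> bkernel' a \<xi>"
  unfolding bkernel'_def by (intro mult_left_mono bessel_series_mono) auto

text \<open>What the estimates use of the closed loop: \<open>u\<close> is the temperature above melting, \<open>p\<close> the observer
error (estimate minus temperature) and \<open>b\<close> the heat input divided by the conductivity, with the control
law written in terms of \<open>u\<close> and \<open>p\<close>. The initial condition on \<open>p\<close> is the nonnegativity of its
backstepping transform.\<close>

locale closed_loop_fields = moving_interval s s'
  for s s' :: "real \<Rightarrow> real" +
  fixes \<alpha> \<beta> c a s_r :: real and u ux uxx p px pxx pt :: "real \<Rightarrow> real \<Rightarrow> real" and b :: "real \<Rightarrow> real"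
  assumes pos: "0 < \<alpha>" "0 < \<beta>" "0 < c" "0 < a"
    and cont_u: "continuous_on (moving_domain s) (\<lambda>(x, t). u x t)"
    and cont_ux: "continuous_on (moving_domain s - {(0, 0)}) (\<lambda>(x, t). ux x t)"
    and bound_ux: "\<exists>B. \<forall>(x, t)\<in>moving_domain s. t \<le> 1 \<longrightarrow> \<bar>ux x t\<bar> \<le> B"
    and C1_u: "C1_field s u ux (\<lambda>x t. \<alpha> * uxx x t)"
    and uxx: "\<And>t x. 0 < t \<Longrightarrow> x \<in> {0..s t} \<Longrightarrow> ((\<lambda>y. ux y t) has_real_derivative uxx x t) (at x within {0..s t})"
    and cont_uxx: "continuous_on (evolution_domain s) (\<lambda>(x, t). uxx x t)"
    and cont_p: "continuous_on (moving_domain s) (\<lambda>(x, t). p x t)"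
    and cont_px: "continuous_on (moving_domain s - {(0, 0)}) (\<lambda>(x, t). px x t)"
    and bound_px: "\<exists>B. \<forall>(x, t)\<in>moving_domain s. t \<le> 1 \<longrightarrow> \<bar>px x t\<bar> \<le> B"
    and C1_p: "C1_field s p px pt"
    and pxx: "\<And>t x. 0 < t \<Longrightarrow> x \<in> {0..s t} \<Longrightarrow> ((\<lambda>y. px y t) has_real_derivative pxx x t) (at x within {0..s t})"
    and cont_pxx: "continuous_on (evolution_domain s) (\<lambda>(x, t). pxx x t)"
    and p_pde: "\<And>t x. 0 < t \<Longrightarrow> x \<in> {0..s t} \<Longrightarrow>
       pt x t = \<alpha> * pxx x t + 2 * \<alpha> * s t * bkernel a ((s t)\<^sup>2 - x\<^sup>2) * px (s t) t"
    and u_end: "\<And>t. 0 \<le> t \<Longrightarrow> u (s t) t = 0" and p_end: "\<And>t. 0 \<le> t \<Longrightarrow> p (s t) t = 0"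
    and px_0: "\<And>t. 0 < t \<Longrightarrow> px 0 t = 0" and ux_0: "\<And>t. 0 < t \<Longrightarrow> ux 0 t = - b t"
    and stefan: "\<And>t. 0 < t \<Longrightarrow> s' t = - \<beta> * ux (s t) t"
    and b: "\<And>t. 0 \<le> t \<Longrightarrow> b t = c * ((s_r - s t) / \<beta> - (integral {0..s t} (\<lambda>x. u x t) + integral {0..s t} (\<lambda>x. p x t)) / \<alpha>)"
    and u_init: "\<And>x. x \<in> {0..s 0} \<Longrightarrow> 0 \<le> u x 0"
    and p_init: "\<And>x. x \<in> {0..s 0} \<Longrightarrow> 0 \<le> p x 0 + volterra (bkernel (- a)) (s 0) (\<lambda>x. p x 0) x"
    and b_init: "0 \<le> b 0"
begin

lemmas u_props = C1_fieldD[OF C1_u]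
lemmas p_props = C1_fieldD[OF C1_p]

lemma slices:
  assumes "0 < t"
  shows "continuous_on {0..s t} (\<lambda>x. u x t)" "continuous_on {0..s t} (\<lambda>x. ux x t)" "continuous_on {0..s t} (\<lambda>x. uxx x t)"
    "continuous_on {0..s t} (\<lambda>x. p x t)" "continuous_on {0..s t} (\<lambda>x. px x t)" "continuous_on {0..s t} (\<lambda>x. pxx x t)"
    "continuous_on {0..s t} (\<lambda>x. pt x t)"
  by (intro continuous_slice u_props p_props cont_uxx cont_pxx assms)+

lemma s_nonneg: "0 \<le> t \<Longrightarrow> 0 \<le> s t" using s_pos[of t] by simp

lemma p_nonneg: "0 \<le> t \<Longrightarrow> x \<in> {0..s t} \<Longrightarrow> 0 \<le> p x t"
  using observer_error_sign(1)[OF C1_p cont_p pxx cont_pxx pos(1) pos(4) p_pde px_0 p_end p_init] by blast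

lemma px_end: "0 < t \<Longrightarrow> px (s t) t \<le> 0"
  using observer_error_sign(2)[OF C1_p cont_p pxx cont_pxx pos(1) pos(4) p_pde px_0 p_end p_init] by blast

definition gain :: "real \<Rightarrow> real \<Rightarrow> real" where "gain t x = 2 * \<alpha> * s t * bkernel a ((s t)\<^sup>2 - x\<^sup>2)"

lemma gain_nonneg: "0 < t \<Longrightarrow> x \<in> {0..s t} \<Longrightarrow> 0 \<le> gain t x"
  unfolding gain_def using pos s_nonneg[of t]
  by (intro mult_nonneg_nonneg bkernel_nonneg) (auto intro: power_mono)

lemma continuous_gain: "continuous_on S (gain t)"
  unfolding gain_def[abs_def] by (intro continuous_intros)

lemma p_pde_gain: "0 < t \<Longrightarrow> x \<in> {0..s t} \<Longrightarrow> pt x t = \<alpha> * pxx x t + gain t x * px (s t) t"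
  by (simp add: p_pde gain_def)

abbreviation "U t \<equiv> integral {0..s t} (\<lambda>x. u x t)"
abbreviation "P t \<equiv> integral {0..s t} (\<lambda>x. p x t)"

lemma DERIV_U: "0 < t \<Longrightarrow> (U has_real_derivative \<alpha> * (ux (s t) t + b t)) (at t)"
  using transport_theorem[OF C1_u, of t] integral_unique[OF has_integral_derivative[OF s_nonneg uxx, of t]] u_end[of t] ux_0[of t] by simp

lemma DERIV_P:
  assumes t: "0 < t"
  shows "(P has_real_derivative px (s t) t * (\<alpha> + integral {0..s t} (gain t))) (at t)"
proof -
  have "integral {0..s t} (\<lambda>x. pt x t) = integral {0..s t} (\<lambda>x. \<alpha> * pxx x t + px (s t) t * gain t x)"
    by (rule integral_cong) (simp add: p_pde_gain[OF t])
  also have "\<dots> = \<alpha> * integral {0..s t} (\<lambda>x. pxx x t) + px (s t) t * integral {0..s t} (gain t)"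
    by (intro integral_unique has_integral_add has_integral_mult_right integrable_integral integrable_continuous_interval slices[OF t] continuous_gain)
  also have "integral {0..s t} (\<lambda>x. pxx x t) = px (s t) t"
    using integral_unique[OF has_integral_derivative[OF s_nonneg pxx, of t]] t px_0[OF t] by simp
  finally show ?thesis
    using transport_theorem[OF C1_p t] p_end[of t] t by (simp add: algebra_simps)
qed

lemma continuous_b: "continuous_on {0..} b"
proof -
  have "continuous_on {0..} (\<lambda>t. c * ((s_r - s t) / \<beta> - (U t + P t) / \<alpha>))"
    by (intro continuous_on_mult continuous_on_diff continuous_on_divide continuous_on_add continuous_on_const
        continuous_s continuous_on_integral_field cont_u cont_p) (use pos in auto)
  then show ?thesis by (rule continuous_on_eq) (simp add: b)
qed

definition \<mu> :: "real \<Rightarrow> real" where "\<mu> t = 1 + integral {0..s t} (gain t) / \<alpha>"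

lemma \<mu>_nonneg: "0 < t \<Longrightarrow> 0 \<le> \<mu> t"
  unfolding \<mu>_def using pos gain_nonneg[of t]
  by (intro add_nonneg_nonneg divide_nonneg_pos integral_nonneg integrable_continuous_interval continuous_gain) auto

text \<open>The flux \<open>ux (s t) t\<close> cancels between the temperature integral and the interface position; only the
error flux, which has a sign, perturbs the linear decay of the heat input.\<close>

lemma DERIV_b:
  assumes t: "0 < t"
  shows "(b has_real_derivative - c * b t - c * \<mu> t * px (s t) t) (at t)"
proof -
  have "((\<lambda>t. c * ((s_r - s t) / \<beta> - (U t + P t) / \<alpha>)) has_real_derivative
      c * ((0 - s' t) / \<beta> - (\<alpha> * (ux (s t) t + b t) + px (s t) t * (\<alpha> + integral {0..s t} (gain t))) / \<alpha>)) (at t)"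
    by (intro DERIV_cmult DERIV_diff DERIV_cdivide DERIV_add DERIV_const DERIV_s DERIV_U DERIV_P t)
  then have "((\<lambda>t. c * ((s_r - s t) / \<beta> - (U t + P t) / \<alpha>)) has_real_derivative - c * b t - c * \<mu> t * px (s t) t) (at t)"
    by (rule DERIV_cong) (use pos stefan[OF t] in \<open>simp add: \<mu>_def field_simps\<close>)
  then show ?thesis
    by (rule has_field_derivative_transform_within_open[of _ _ _ "{0<..}"]) (use t b in auto)
qed

lemma b_nonneg: assumes t: "0 \<le> t" shows "0 \<le> b t"
proof -
  have "exp (c * 0) * b 0 \<le> exp (c * t) * b t"
  proof (rule DERIV_nonneg_imp_increasing_open[of 0 t "\<lambda>t. exp (c * t) * b t"])
    fix x :: real assume x: "0 < x"
    have "((\<lambda>t. exp (c * t) * b t) has_real_derivative exp (c * x) * (c * \<mu> x * (- px (s x) x))) (at x)"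
      by (rule derivative_eq_intros DERIV_b x refl)+ (simp add: algebra_simps)
    moreover have "0 \<le> exp (c * x) * (c * \<mu> x * (- px (s x) x))"
      using pos \<mu>_nonneg[OF x] px_end[OF x] by (intro mult_nonneg_nonneg) auto
    ultimately show "\<exists>y. ((\<lambda>t. exp (c * t) * b t) has_real_derivative y) (at x) \<and> 0 \<le> y" by blast
  next
    show "continuous_on {0..t} (\<lambda>t. exp (c * t) * b t)"
      by (intro continuous_intros continuous_on_subset[OF continuous_b]) auto
  qed (use t in auto)
  then have "0 \<le> exp (c * t) * b t" using b_init by simp
  then show ?thesis by (simp add: zero_le_mult_iff)
qed

lemma u_nonneg:
  assumes "0 \<le> t" "x \<in> {0..s t}" shows "0 \<le> u x t"
proof (rule minimum_principle[where f = u and fx = ux and fxx = uxx and ft = "\<lambda>x t. \<alpha> * uxx x t" and \<alpha> = \<alpha> and \<nu> = 0, OF cont_u u_props(4) uxx])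
  show "((\<lambda>\<tau>. u x \<tau>) has_real_derivative \<alpha> * uxx x t) (at t)" if "0 < t" "0 \<le> x" "x < s t" for t x
    using u_props(5)[of t x] at_within_moving_domain[OF that] that by simp
  show "ux 0 t \<le> 0" if "0 < t" for t using ux_0[OF that] b_nonneg[of t] that by simp
qed (use pos u_end u_init assms in auto)

lemma ux_end: "0 < t \<Longrightarrow> ux (s t) t \<le> 0"
  by (rule nonpos_derivative_at_right_end[OF u_props(4)]) (use s_pos[of t] u_end[of t] u_nonneg[of t] in auto)

lemma s'_nonneg: "0 < t \<Longrightarrow> 0 \<le> s' t"
  using stefan[of t] ux_end[of t] pos by (simp add: mult_nonneg_nonpos)

lemma U_nonneg: "0 \<le> t \<Longrightarrow> 0 \<le> U t" and P_nonneg: "0 \<le> t \<Longrightarrow> 0 \<le> P t"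
  by (intro integral_nonneg integrable_continuous_interval continuous_slice_0 cont_u cont_p; simp add: u_nonneg p_nonneg)+

text \<open>Nonnegative heat input means that the energy still missing is nonnegative; the temperature and the
estimate lie above melting, so the missing energy is attributed to the interface alone.\<close>

lemma s_le: assumes t: "0 \<le> t" shows "s t \<le> s_r"
proof -
  have "0 \<le> (s_r - s t) / \<beta> - (U t + P t) / \<alpha>" using b_nonneg[OF t] pos b[OF t] by (simp add: zero_le_mult_iff)
  moreover have "0 \<le> (U t + P t) / \<alpha>" using U_nonneg[OF t] P_nonneg[OF t] pos by simp
  ultimately have "0 \<le> (s_r - s t) / \<beta>" by linarith
  then show ?thesis using pos by (simp add: zero_le_divide_iff)
qed

lemma s_r_pos: "0 < s_r" using s_le[of 0] s_pos[of 0] by simp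

definition "Lp t = integral {0..s t} (\<lambda>x. (p x t)\<^sup>2)"
definition "Np t = integral {0..s t} (\<lambda>x. (px x t)\<^sup>2)"
definition "Lu t = integral {0..s t} (\<lambda>x. (u x t)\<^sup>2)"
definition "Nu t = integral {0..s t} (\<lambda>x. (ux x t)\<^sup>2)"

text \<open>The internal energy relative to the setpoint. It changes only through the heat input, and the control
law feeds back its estimate.\<close>

definition "E t = U t / \<alpha> + (s t - s_r) / \<beta>"

lemma nonneg:
  shows "0 \<le> t \<Longrightarrow> 0 \<le> Lp t" "0 < t \<Longrightarrow> 0 \<le> Np t" "0 \<le> t \<Longrightarrow> 0 \<le> Lu t" "0 < t \<Longrightarrow> 0 \<le> Nu t"
  unfolding Lp_def Np_def Lu_def Nu_def
  by (intro integral_nonneg integrable_continuous_interval continuous_on_power continuous_slice_0 cont_u cont_p slices; simp)+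

text \<open>The source term is the product of the nonnegative gain, the nonnegative error and the nonpositive
error flux; it can be dropped.\<close>

lemma DERIV_Lp:
  assumes t: "0 < t"
  obtains D where "(Lp has_real_derivative D) (at t)" "D \<le> - 2 * \<alpha> * Np t"
proof
  have "Lp = (\<lambda>t. integral {0..s t} (\<lambda>x. p x t * p x t))" by (simp add: Lp_def fun_eq_iff power2_eq_square)
  then show "(Lp has_real_derivative integral {0..s t} (\<lambda>x. pt x t * p x t + pt x t * p x t)) (at t)"
    using transport_theorem[OF C1_field_mult[OF C1_p C1_p] t] p_end[of t] t by simp
  have "integral {0..s t} (\<lambda>x. pt x t * p x t + pt x t * p x t) \<le> integral {0..s t} (\<lambda>x. 2 * \<alpha> * (p x t * pxx x t))"
  proof (intro integral_le integrable_continuous_interval continuous_intros slices t)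
    fix x assume x: "x \<in> {0..s t}"
    have "gain t x * px (s t) t * p x t \<le> 0"
      using gain_nonneg[OF t x] px_end[OF t] p_nonneg[OF less_imp_le[OF t] x] by (simp add: mult_nonneg_nonpos mult_nonpos_nonneg)
    then show "pt x t * p x t + pt x t * p x t \<le> 2 * \<alpha> * (p x t * pxx x t)"
      unfolding p_pde_gain[OF t x] by (simp add: algebra_simps)
  qed
  also have "\<dots> = 2 * \<alpha> * integral {0..s t} (\<lambda>x. p x t * pxx x t)" by (rule integral_mult_right)
  also have "integral {0..s t} (\<lambda>x. p x t * pxx x t) = - Np t"
    using integral_by_parts[OF s_nonneg p_props(4) pxx slices(5) slices(6), of t] t p_end[of t] px_0[of t]
    by (simp add: Np_def power2_eq_square)
  finally show "integral {0..s t} (\<lambda>x. pt x t * p x t + pt x t * p x t) \<le> - 2 * \<alpha> * Np t" by simp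
qed

text \<open>Integrating the source against \<open>pxx\<close> by parts yields \<open>- d^2\<close> with a positive factor, where \<open>- d\<close> is the error
flux, and a term that is linear in \<open>d\<close>; the former absorbs the latter.\<close>

lemma DERIV_Np:
  assumes t: "0 < t"
  defines "C \<equiv> 4 * \<alpha> * s_r ^ 4 * (bkernel' a (s_r\<^sup>2))\<^sup>2 / a"
  obtains D where "(Np has_real_derivative D) (at t)" "D \<le> C * Np t"
proof
  define d where "d = - px (s t) t"
  have d: "0 \<le> d" using px_end[OF t] by (simp add: d_def)
  have st: "0 < s t" "s t \<le> s_r" using s_pos[of t] s_le[of t] t by auto
  define J where "J = integral {0..s t} (\<lambda>x. x * bkernel' a ((s t)\<^sup>2 - x\<^sup>2) * px x t)"
  define I where "I = integral {0..s t} (\<lambda>x. pxx x t * pt x t)"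
  show "(Np has_real_derivative - 2 * px 0 t * pt 0 t - 2 * I - s' t * (px (s t) t)\<^sup>2) (at t)"
    unfolding Np_def[abs_def] I_def by (rule H1_energy_derivative[OF C1_p t p_end[OF less_imp_le] pxx cont_pxx])
  have "I = integral {0..s t} (\<lambda>x. \<alpha> * (pxx x t)\<^sup>2 - d * (gain t x * pxx x t))"
    unfolding I_def by (rule integral_cong) (simp add: p_pde_gain[OF t] d_def power2_eq_square algebra_simps)
  also have "\<dots> = \<alpha> * integral {0..s t} (\<lambda>x. (pxx x t)\<^sup>2) - d * integral {0..s t} (\<lambda>x. gain t x * pxx x t)"
    by (intro integral_unique has_integral_diff has_integral_mult_right integrable_integral integrable_continuous_interval continuous_intros slices t continuous_gain)
  also have "integral {0..s t} (\<lambda>x. gain t x * pxx x t) = - 2 * \<alpha> * a * s t * d + 4 * \<alpha> * s t * J"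
  proof -
    define gx where "gx x = - 4 * \<alpha> * s t * (x * bkernel' a ((s t)\<^sup>2 - x\<^sup>2))" for x
    have g: "(gain t has_real_derivative gx x) (at x within {0..s t})" for x
      unfolding gain_def[abs_def] gx_def
      by (rule derivative_eq_intros DERIV_chain2[OF DERIV_bkernel] refl)+ simp
    have "integral {0..s t} (\<lambda>x. gain t x * pxx x t) = gain t (s t) * px (s t) t - gain t 0 * px 0 t - integral {0..s t} (\<lambda>x. gx x * px x t)"
      by (rule integral_by_parts[OF less_imp_le[OF st(1)] g pxx[OF t]])
         (auto simp: gx_def[abs_def] intro!: continuous_intros slices t)
    also have "integral {0..s t} (\<lambda>x. gx x * px x t) = - 4 * \<alpha> * s t * J"
      unfolding J_def gx_def by (subst integral_mult_right[symmetric]) (simp add: mult_ac)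
    finally show ?thesis using px_0[OF t] by (simp add: gain_def d_def algebra_simps)
  qed
  finally have I: "I = \<alpha> * integral {0..s t} (\<lambda>x. (pxx x t)\<^sup>2) + 2 * \<alpha> * a * s t * d\<^sup>2 - 4 * \<alpha> * s t * (d * J)"
    by (simp add: power2_eq_square algebra_simps)
  have "0 \<le> \<alpha> * integral {0..s t} (\<lambda>x. (pxx x t)\<^sup>2)"
    using pos by (intro mult_nonneg_nonneg integral_nonneg integrable_continuous_interval continuous_intros slices t) auto
  moreover have "2 * (d * J) \<le> a * d\<^sup>2 + J\<^sup>2 / a"
  proof -
    have "0 \<le> (a * d - J)\<^sup>2 / a" using pos by simp
    also have "(a * d - J)\<^sup>2 / a = a * d\<^sup>2 + J\<^sup>2 / a - 2 * (d * J)"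
      using pos by (simp add: field_simps power2_eq_square)
    finally show ?thesis by simp
  qed
  then have "4 * \<alpha> * s t * (2 * (d * J)) \<le> 4 * \<alpha> * s t * (a * d\<^sup>2 + J\<^sup>2 / a)"
    using pos st by (intro mult_left_mono) auto
  moreover have "4 * \<alpha> * s t * (J\<^sup>2 / a) \<le> C * Np t"
  proof -
    have "J\<^sup>2 \<le> (s t - 0) * integral {0..s t} (\<lambda>x. (x * bkernel' a ((s t)\<^sup>2 - x\<^sup>2) * px x t)\<^sup>2)"
      unfolding J_def by (rule square_integral_le) (use st in \<open>auto intro!: continuous_intros slices t\<close>)
    also have "integral {0..s t} (\<lambda>x. (x * bkernel' a ((s t)\<^sup>2 - x\<^sup>2) * px x t)\<^sup>2)
        \<le> integral {0..s t} (\<lambda>x. (s_r * bkernel' a (s_r\<^sup>2))\<^sup>2 * (px x t)\<^sup>2)"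
    proof (intro integral_le integrable_continuous_interval continuous_intros slices t)
      fix x assume x: "x \<in> {0..s t}"
      have z: "0 \<le> (s t)\<^sup>2 - x\<^sup>2" "(s t)\<^sup>2 - x\<^sup>2 \<le> s_r\<^sup>2"
        using x st power_mono[of x "s t" 2] power_mono[of "s t" s_r 2] zero_le_power2[of x] by (simp, linarith+)
      have "x * bkernel' a ((s t)\<^sup>2 - x\<^sup>2) \<le> s_r * bkernel' a (s_r\<^sup>2)"
        using x st z pos by (intro mult_mono bkernel'_mono bkernel'_nonneg) auto
      moreover have "0 \<le> x * bkernel' a ((s t)\<^sup>2 - x\<^sup>2)" using x z pos by (simp add: bkernel'_nonneg)
      ultimately show "(x * bkernel' a ((s t)\<^sup>2 - x\<^sup>2) * px x t)\<^sup>2 \<le> (s_r * bkernel' a (s_r\<^sup>2))\<^sup>2 * (px x t)\<^sup>2"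
        unfolding power_mult_distrib[of _ "px x t"] by (intro mult_right_mono power_mono) auto
    qed
    also have "\<dots> = (s_r * bkernel' a (s_r\<^sup>2))\<^sup>2 * Np t" by (simp add: Np_def)
    finally have "J\<^sup>2 \<le> s t * ((s_r * bkernel' a (s_r\<^sup>2))\<^sup>2 * Np t)" using st by simp
    also have "\<dots> \<le> s_r * ((s_r * bkernel' a (s_r\<^sup>2))\<^sup>2 * Np t)"
      using st nonneg(2)[OF t] by (intro mult_right_mono) auto
    finally have "4 * \<alpha> * s t * (J\<^sup>2 / a) \<le> 4 * \<alpha> * s_r * (s_r * ((s_r * bkernel' a (s_r\<^sup>2))\<^sup>2 * Np t) / a)"
      using pos st by (intro mult_mono divide_right_mono) auto
    also have "\<dots> = C * Np t" by (simp add: C_def power2_eq_square power4_eq_xxxx mult_ac)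
    finally show ?thesis .
  qed
  moreover have "0 \<le> s' t * (px (s t) t)\<^sup>2" using s'_nonneg[OF t] by simp
  ultimately show "- 2 * px 0 t * pt 0 t - 2 * I - s' t * (px (s t) t)\<^sup>2 \<le> C * Np t"
    unfolding I using px_0[OF t] by (simp add: algebra_simps)
qed

lemma DERIV_E: "0 < t \<Longrightarrow> (E has_real_derivative b t) (at t)"
  unfolding E_def[abs_def]
  by (rule DERIV_cong[OF DERIV_add[OF DERIV_cdivide[OF DERIV_U] DERIV_cdivide[OF DERIV_diff[OF DERIV_s DERIV_const]]]])
     (use pos stefan[of t] in \<open>auto simp: field_simps\<close>)

lemma b_eq: "0 \<le> t \<Longrightarrow> b t = - c * E t - c * P t / \<alpha>"
  using pos by (simp add: b E_def field_simps)

lemma DERIV_Lu: assumes t: "0 < t" shows "(Lu has_real_derivative 2 * \<alpha> * (u 0 t * b t - Nu t)) (at t)"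
proof -
  have "Lu = (\<lambda>t. integral {0..s t} (\<lambda>x. u x t * u x t))" by (simp add: Lu_def fun_eq_iff power2_eq_square)
  then have "(Lu has_real_derivative integral {0..s t} (\<lambda>x. \<alpha> * uxx x t * u x t + \<alpha> * uxx x t * u x t)) (at t)"
    using transport_theorem[OF C1_field_mult[OF C1_u C1_u] t] u_end[of t] t by simp
  moreover have "integral {0..s t} (\<lambda>x. \<alpha> * uxx x t * u x t + \<alpha> * uxx x t * u x t) = 2 * \<alpha> * integral {0..s t} (\<lambda>x. u x t * uxx x t)"
    by (subst integral_mult_right[symmetric]) (simp add: algebra_simps)
  moreover have "integral {0..s t} (\<lambda>x. u x t * uxx x t) = u 0 t * b t - Nu t"
    using integral_by_parts[OF s_nonneg u_props(4) uxx slices(2) slices(3), of t] t u_end[of t] ux_0[of t]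
    by (simp add: Nu_def power2_eq_square)
  ultimately show ?thesis by (simp add: mult.assoc)
qed

text \<open>The derivative of \<open>Nu\<close> contains \<open>2 b(t) u_t(0, t)\<close>, over which there is no control. Subtracting \<open>2 b(t) u(0, t)\<close>
trades it for \<open>- 2 b'(t) u(0, t)\<close>, where the signs of the error flux and of \<open>u\<close> give an upper bound
without \<open>b'\<close>.\<close>

lemma DERIV_Z:
  assumes t: "0 < t"
  obtains D where "((\<lambda>t. Nu t - 2 * b t * u 0 t) has_real_derivative D) (at t)" "D \<le> 2 * c * b t * u 0 t"
proof
  define I where "I = integral {0..s t} (\<lambda>x. uxx x t * (\<alpha> * uxx x t))"
  have "(Nu has_real_derivative - 2 * ux 0 t * (\<alpha> * uxx 0 t) - 2 * I - s' t * (ux (s t) t)\<^sup>2) (at t)"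
    unfolding Nu_def[abs_def] I_def by (rule H1_energy_derivative[OF C1_u t u_end[OF less_imp_le] uxx cont_uxx])
  moreover have "((\<lambda>t. u 0 t) has_real_derivative \<alpha> * uxx 0 t) (at t)"
    using u_props(5)[OF t, of 0] at_within_moving_domain[OF t, of 0] s_pos[of t] t by simp
  ultimately show "((\<lambda>t. Nu t - 2 * b t * u 0 t) has_real_derivative
      (- 2 * ux 0 t * (\<alpha> * uxx 0 t) - 2 * I - s' t * (ux (s t) t)\<^sup>2)
       - (2 * (- c * b t - c * \<mu> t * px (s t) t) * u 0 t + \<alpha> * uxx 0 t * (2 * b t))) (at t)"
    by (intro DERIV_diff DERIV_mult DERIV_cmult DERIV_b t)
  have "0 \<le> I" unfolding I_def
    using pos by (intro integral_nonneg integrable_continuous_interval continuous_intros slices t) (simp add: mult.left_commute[of _ \<alpha>])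
  moreover have "0 \<le> s' t * (ux (s t) t)\<^sup>2" using s'_nonneg[OF t] by simp
  moreover have "c * \<mu> t * px (s t) t * u 0 t \<le> 0"
    using pos \<mu>_nonneg[OF t] px_end[OF t] u_nonneg[of t 0] s_pos[of t] t by (simp add: mult_nonneg_nonpos mult_nonpos_nonneg)
  ultimately show "(- 2 * ux 0 t * (\<alpha> * uxx 0 t) - 2 * I - s' t * (ux (s t) t)\<^sup>2)
       - (2 * (- c * b t - c * \<mu> t * px (s t) t) * u 0 t + \<alpha> * uxx 0 t * (2 * b t)) \<le> 2 * c * b t * u 0 t"
    using ux_0[OF t] by (simp add: algebra_simps)
qed

lemma energy_bounds:
  assumes t: "0 < t"
  shows "Lp t \<le> s_r\<^sup>2 * Np t" "Lu t \<le> s_r\<^sup>2 * Nu t" "(u 0 t)\<^sup>2 \<le> s_r * Nu t" "(P t)\<^sup>2 \<le> s_r ^ 3 * Np t" "(U t)\<^sup>2 \<le> s_r ^ 3 * Nu t"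
proof -
  have st: "0 \<le> s t" "s t \<le> s_r" "(s t)\<^sup>2 \<le> s_r\<^sup>2" using s_nonneg[of t] s_le[of t] t by (auto intro: power_mono)
  have N: "0 \<le> Np t" "0 \<le> Nu t" using nonneg t by auto
  have "Lp t \<le> (s t)\<^sup>2 * Np t"
    unfolding Lp_def Np_def by (rule poincare[OF p_props(4)[OF t] slices(5)[OF t] p_end[OF less_imp_le[OF t]] st(1)])
  also have "\<dots> \<le> s_r\<^sup>2 * Np t" using st N by (intro mult_right_mono)
  finally show Lp: "Lp t \<le> s_r\<^sup>2 * Np t" .
  have "Lu t \<le> (s t)\<^sup>2 * Nu t"
    unfolding Lu_def Nu_def by (rule poincare[OF u_props(4)[OF t] slices(2)[OF t] u_end[OF less_imp_le[OF t]] st(1)])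
  also have "\<dots> \<le> s_r\<^sup>2 * Nu t" using st N by (intro mult_right_mono)
  finally show Lu: "Lu t \<le> s_r\<^sup>2 * Nu t" .
  have "(u 0 t)\<^sup>2 \<le> s t * Nu t"
    unfolding Nu_def by (rule square_le_energy[OF u_props(4)[OF t] slices(2)[OF t] u_end[OF less_imp_le[OF t]]]) (use st in auto)
  also have "\<dots> \<le> s_r * Nu t" using st N by (intro mult_right_mono)
  finally show "(u 0 t)\<^sup>2 \<le> s_r * Nu t" .
  have "(P t)\<^sup>2 \<le> (s t - 0) * Lp t" unfolding Lp_def by (rule square_integral_le[OF slices(4)[OF t] st(1)])
  also have "\<dots> \<le> s_r * (s_r\<^sup>2 * Np t)" using st Lp nonneg(1)[of t] t by (intro mult_mono) auto
  finally show "(P t)\<^sup>2 \<le> s_r ^ 3 * Np t" by (simp add: power2_eq_square power3_eq_cube mult_ac)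
  have "(U t)\<^sup>2 \<le> (s t - 0) * Lu t" unfolding Lu_def by (rule square_integral_le[OF slices(1)[OF t] st(1)])
  also have "\<dots> \<le> s_r * (s_r\<^sup>2 * Nu t)" using st Lu nonneg(3)[of t] t by (intro mult_mono) auto
  finally show "(U t)\<^sup>2 \<le> s_r ^ 3 * Nu t" by (simp add: power2_eq_square power3_eq_cube mult_ac)
qed

lemma corner_squares:
  shows "continuous_on {0..} Np" "continuous_on {0..} Nu"
    "(\<lambda>x. (px x 0)\<^sup>2) integrable_on {0..s 0}" "(\<lambda>x. (ux x 0)\<^sup>2) integrable_on {0..s 0}"
proof -
  have *: "continuous_on {0..} (\<lambda>t. integral {0..s t} (\<lambda>x. (g x t)\<^sup>2)) \<and> (\<lambda>x. (g x 0)\<^sup>2) integrable_on {0..s 0}"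
    if g: "continuous_on (moving_domain s - {(0, 0)}) (\<lambda>(x, t). g x t)"
      "\<exists>B. \<forall>(x, t)\<in>moving_domain s. t \<le> 1 \<longrightarrow> \<bar>g x t\<bar> \<le> B" for g :: "real \<Rightarrow> real \<Rightarrow> real"
  proof -
    obtain B where B: "\<And>x t. (x, t) \<in> moving_domain s \<Longrightarrow> t \<le> 1 \<Longrightarrow> \<bar>g x t\<bar> \<le> B" using g(2) by blast
    have c: "continuous_on (moving_domain s - {(0, 0)}) (\<lambda>(x, t). (g x t)\<^sup>2)"
      using continuous_on_power[OF g(1), of 2] by (simp add: case_prod_beta)
    have "\<bar>(g x t)\<^sup>2\<bar> \<le> B\<^sup>2" if "(x, t) \<in> moving_domain s" "t \<le> 1" for x t
      using B[OF that] by (simp add: abs_le_square_iff[symmetric])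
    from integral_field_corner[OF c this] show ?thesis by blast
  qed
  show "continuous_on {0..} Np" "continuous_on {0..} Nu"
    "(\<lambda>x. (px x 0)\<^sup>2) integrable_on {0..s 0}" "(\<lambda>x. (ux x 0)\<^sup>2) integrable_on {0..s 0}"
    using *[OF cont_px bound_px] *[OF cont_ux bound_ux] by (simp_all add: Np_def[abs_def] Nu_def[abs_def])
qed

lemma continuous_energies: "continuous_on {0..} Lp" "continuous_on {0..} Lu" "continuous_on {0..} E" "continuous_on {0..} (\<lambda>t. u 0 t)"
proof -
  have sq: "continuous_on (moving_domain s) (\<lambda>(x, t). (u x t)\<^sup>2)" "continuous_on (moving_domain s) (\<lambda>(x, t). (p x t)\<^sup>2)"
    using continuous_on_power[OF cont_u, of 2] continuous_on_power[OF cont_p, of 2] by (simp_all add: case_prod_beta)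
  show "continuous_on {0..} Lp" "continuous_on {0..} Lu"
    unfolding Lp_def[abs_def] Lu_def[abs_def] by (intro continuous_on_integral_field sq)+
  show "continuous_on {0..} E" unfolding E_def[abs_def]
    by (intro continuous_on_add continuous_on_divide continuous_on_diff continuous_on_const continuous_s continuous_on_integral_field cont_u)
       (use pos in auto)
  show "continuous_on {0..} (\<lambda>t. u 0 t)"
    by (rule continuous_on_compose_field[OF cont_u]) (auto simp: moving_domain_def s_nonneg intro!: continuous_intros)
qed

end

section \<open>Exponential decay of a Lyapunov function\<close>

context closed_loop_fields begin

definition "state_norm t = Lp t + Np t + Lu t + Nu t + (s t - s_r)\<^sup>2"

lemma nonneg_init: "0 \<le> Lp 0" "0 \<le> Lu 0" "0 \<le> Np 0" "0 \<le> Nu 0"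
  using nonneg(1,3)[of 0] corner_squares(3,4) by (auto simp: Np_def Nu_def intro!: integral_nonneg)

lemma state_norm_init_nonneg: "0 \<le> state_norm 0"
  using nonneg_init by (simp add: state_norm_def)

text \<open>The Lyapunov function is \<open>w1 Lp + w2 Np + w3 E^2 + Lu / \<alpha> + Nu - 2 b(t) u(0, t)\<close>. Its weights are chosen
against the couplings: \<open>w2\<close> and \<open>w3\<close> keep it positive in spite of the term \<open>- 2 b(t) u(0, t)\<close>,
\<open>w3\<close> also makes the damping of \<open>E\<close> absorb the input \<open>b\<close> into the temperature, and
\<open>w1\<close> is taken so large that the dissipation of \<open>Lp\<close> pays for every occurrence of \<open>Np\<close> elsewhere.
\<open>K\<close> compares the function with its dissipation \<open>Np + E^2 + Nu\<close>, while \<open>K2\<close> and \<open>K3\<close> compare it with the norm.\<close>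

lemma lyapunov_decay:
  fixes C q r w1 w2 w3 K K2 K3 :: real
  assumes C: "C = 4 * \<alpha> * s_r ^ 4 * (bkernel' a (s_r\<^sup>2))\<^sup>2 / a"
    and r: "r = s_r ^ 3 / \<alpha>\<^sup>2" and q: "q = 2 * c\<^sup>2 * ((1 + c)\<^sup>2 * s_r)"
    and w2: "w2 = 1 + 4 * s_r * c\<^sup>2 * r" and w3: "w3 = (q + 1) / c + 4 * s_r * c\<^sup>2 + 1"
    and w1: "w1 = (1 + w2 * C + w3 * c * r + q * r) / (2 * \<alpha>)"
    and K: "K = w1 * s_r\<^sup>2 + w2 + w3 + s_r\<^sup>2 / \<alpha> + 1"
    and K2: "K2 = s_r\<^sup>2 + 1 + 2 * \<beta>\<^sup>2 + 2 * \<beta>\<^sup>2 * r"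
    and K3: "K3 = w1 + w2 + w3 * (2 * s_r / \<alpha>\<^sup>2 + 2 / \<beta>\<^sup>2) + 1 / \<alpha> + 1"
    and t: "0 < t"
  shows "state_norm t \<le> 2 * K2 * K3 * exp (- (1 / K) * t) * state_norm 0"
proof -
  have R: "0 < s_r" by (rule s_r_pos)
  have cst: "0 \<le> C" "0 \<le> r" "0 \<le> q" "0 \<le> w2" "0 \<le> w3" using pos R by (simp_all add: C r q w2 w3)
  then have "0 \<le> w1" using pos by (simp add: w1)
  then have K0: "0 < K" using cst pos by (simp add: K add_nonneg_pos)
  define V where "V t = w1 * Lp t + w2 * Np t + w3 * (E t)\<^sup>2 + Lu t / \<alpha> + (Nu t - 2 * b t * u 0 t)" for t
  define F where "F t = Np t + (E t)\<^sup>2 + Nu t" for t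
  have r_alpha: "s_r ^ 3 * x / \<alpha>\<^sup>2 = r * x" for x by (simp add: r)
  have P: "(P t / \<alpha>)\<^sup>2 \<le> r * Np t" if "0 < t" for t
    using divide_right_mono[OF energy_bounds(4)[OF that], of "\<alpha>\<^sup>2"] by (simp add: power_divide r_alpha)
  have b2: "(b t)\<^sup>2 \<le> 2 * c\<^sup>2 * ((E t)\<^sup>2 + r * Np t)" if "0 < t" for t
  proof -
    have eq: "(b t)\<^sup>2 = c\<^sup>2 * (E t + P t / \<alpha>)\<^sup>2"
      using b_eq[of t] that by (simp flip: power_mult_distrib) (simp add: power2_eq_square algebra_simps)
    have "(E t + P t / \<alpha>)\<^sup>2 \<le> 2 * ((E t)\<^sup>2 + (P t / \<alpha>)\<^sup>2)"
      using zero_le_power2[of "E t - P t / \<alpha>"] by (simp add: power2_sum power2_diff)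
    also have "\<dots> \<le> 2 * ((E t)\<^sup>2 + r * Np t)" using P[OF that] by simp
    finally have "c\<^sup>2 * (E t + P t / \<alpha>)\<^sup>2 \<le> c\<^sup>2 * (2 * ((E t)\<^sup>2 + r * Np t))" by (intro mult_left_mono) auto
    then show ?thesis unfolding eq by (simp only: mult_ac)
  qed
  have young: "2 * y * b t * u 0 t \<le> z * Nu t + y\<^sup>2 * s_r / z * (b t)\<^sup>2" if "0 < t" "0 < z" for t y z
  proof -
    have "0 \<le> (u 0 t - y * s_r / z * b t)\<^sup>2 * (z / s_r)" using R that by simp
    also have "\<dots> = (u 0 t)\<^sup>2 * (z / s_r) - 2 * y * b t * u 0 t + y\<^sup>2 * s_r / z * (b t)\<^sup>2"
      using R that by (simp add: power2_diff power_mult_distrib power_divide power2_eq_square field_simps)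
    finally have "2 * y * b t * u 0 t \<le> (u 0 t)\<^sup>2 * (z / s_r) + y\<^sup>2 * s_r / z * (b t)\<^sup>2" by simp
    moreover have "(u 0 t)\<^sup>2 * (z / s_r) \<le> s_r * Nu t * (z / s_r)"
      using energy_bounds(3)[OF that(1)] R that by (intro mult_right_mono) auto
    ultimately show ?thesis using R by (simp add: mult_ac)
  qed
  have lower: "Np t + (E t)\<^sup>2 + Nu t / 2 \<le> V t" if t: "0 < t" for t
  proof -
    have "2 * b t * u 0 t \<le> Nu t / 2 + 2 * s_r * (b t)\<^sup>2" using young[OF t, of "1/2" 1] by simp
    also have "2 * s_r * (b t)\<^sup>2 \<le> 2 * s_r * (2 * c\<^sup>2 * ((E t)\<^sup>2 + r * Np t))"
      using b2[OF t] R by (intro mult_left_mono) auto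
    finally have "2 * b t * u 0 t \<le> Nu t / 2 + 4 * s_r * c\<^sup>2 * (E t)\<^sup>2 + 4 * s_r * c\<^sup>2 * r * Np t"
      by (simp add: algebra_simps)
    moreover have "0 \<le> w1 * Lp t" "0 \<le> Lu t / \<alpha>" "0 \<le> (q + 1) / c * (E t)\<^sup>2"
      using \<open>0 \<le> w1\<close> nonneg(1,3)[of t] t pos cst by simp_all
    ultimately show ?thesis unfolding V_def w2 w3 by (simp add: algebra_simps)
  qed
  have upper: "V t \<le> K * F t" if t: "0 < t" for t
  proof -
    have N: "0 \<le> Np t" "0 \<le> Nu t" using nonneg t by auto
    have "0 \<le> b t * u 0 t" using b_nonneg[of t] u_nonneg[of t 0] s_pos[of t] t by simp
    moreover have "w1 * Lp t \<le> w1 * (s_r\<^sup>2 * Np t)" using energy_bounds(1)[OF t] \<open>0 \<le> w1\<close> by (intro mult_left_mono)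
    moreover have "Lu t / \<alpha> \<le> s_r\<^sup>2 * Nu t / \<alpha>" using energy_bounds(2)[OF t] pos by (intro divide_right_mono) auto
    ultimately have "V t \<le> (w1 * s_r\<^sup>2 + w2) * Np t + w3 * (E t)\<^sup>2 + (s_r\<^sup>2 / \<alpha> + 1) * Nu t"
      unfolding V_def by (simp add: algebra_simps)
    also have "\<dots> \<le> K * Np t + K * (E t)\<^sup>2 + K * Nu t"
      using N cst \<open>0 \<le> w1\<close> pos by (intro add_mono mult_right_mono) (auto simp: K)
    finally show ?thesis by (simp add: F_def algebra_simps)
  qed
  have deriv: "\<exists>D. (V has_real_derivative D) (at t) \<and> D \<le> - (1 / K) * V t" if t: "0 < t" for t
  proof -
    obtain D1 where D1: "(Lp has_real_derivative D1) (at t)" "D1 \<le> - 2 * \<alpha> * Np t" by (rule DERIV_Lp[OF t])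
    obtain D2 where D2: "(Np has_real_derivative D2) (at t)" "D2 \<le> C * Np t" using DERIV_Np[OF t] unfolding C by blast
    obtain D4 where D4: "((\<lambda>t. Nu t - 2 * b t * u 0 t) has_real_derivative D4) (at t)" "D4 \<le> 2 * c * b t * u 0 t"
      by (rule DERIV_Z[OF t])
    define D where "D = w1 * D1 + w2 * D2 + w3 * (2 * E t * b t) + 2 * \<alpha> * (u 0 t * b t - Nu t) / \<alpha> + D4"
    have dE: "((\<lambda>t. (E t)\<^sup>2) has_real_derivative 2 * E t * b t) (at t)"
      using DERIV_power[OF DERIV_E[OF t], of 2] by (simp add: mult_ac)
    have "(V has_real_derivative D) (at t)"
      unfolding V_def[abs_def] D_def
      by (intro DERIV_add DERIV_cmult DERIV_cdivide D1(1) D2(1) D4(1) dE DERIV_Lu[OF t])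
    moreover have "D \<le> - F t"
    proof -
      have e1: "w1 * D1 \<le> w1 * (- 2 * \<alpha> * Np t)" using D1(2) \<open>0 \<le> w1\<close> by (intro mult_left_mono)
      have "2 * \<alpha> * w1 = 1 + w2 * C + w3 * c * r + q * r" using pos by (simp add: w1)
      moreover have "w1 * (- 2 * \<alpha> * Np t) = - (2 * \<alpha> * w1) * Np t" by simp
      ultimately have "w1 * (- 2 * \<alpha> * Np t) = - (1 + w2 * C + w3 * c * r + q * r) * Np t" by (simp only:)
      note e1 = e1[unfolded this]
      have e2: "w2 * D2 \<le> w2 * (C * Np t)" using D2(2) cst by (intro mult_left_mono)
      have "2 * E t * b t \<le> - c * (E t)\<^sup>2 + c * (r * Np t)"
      proof -
        have bt: "b t = - c * (E t + P t / \<alpha>)" using b_eq[of t] t by (simp add: algebra_simps)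
        have "0 \<le> c * (E t + P t / \<alpha>)\<^sup>2" using pos by simp
        also have "\<dots> = - 2 * E t * b t - c * (E t)\<^sup>2 + c * (P t / \<alpha>)\<^sup>2"
          unfolding bt by (simp add: power2_eq_square algebra_simps)
        finally have "2 * E t * b t \<le> - c * (E t)\<^sup>2 + c * (P t / \<alpha>)\<^sup>2" by simp
        moreover have "c * (P t / \<alpha>)\<^sup>2 \<le> c * (r * Np t)" using P[OF t] pos by (intro mult_left_mono) auto
        ultimately show ?thesis by linarith
      qed
      then have e3: "w3 * (2 * E t * b t) \<le> w3 * (- c * (E t)\<^sup>2 + c * (r * Np t))" using cst by (intro mult_left_mono)
      have "2 * (1 + c) * b t * u 0 t \<le> Nu t + (1 + c)\<^sup>2 * s_r * (b t)\<^sup>2" using young[OF t, of 1 "1 + c"] by simp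
      also have "(1 + c)\<^sup>2 * s_r * (b t)\<^sup>2 \<le> (1 + c)\<^sup>2 * s_r * (2 * c\<^sup>2 * ((E t)\<^sup>2 + r * Np t))"
        using b2[OF t] R by (intro mult_left_mono) auto
      also have "\<dots> = q * (E t)\<^sup>2 + q * r * Np t" by (simp add: q algebra_simps)
      finally have e4: "2 * (1 + c) * b t * u 0 t \<le> Nu t + (q * (E t)\<^sup>2 + q * r * Np t)" by simp
      have "w3 * c = q + 1 + (4 * s_r * c\<^sup>2 + 1) * c" using pos by (simp add: w3 field_simps)
      moreover have "0 \<le> (4 * s_r * c\<^sup>2 + 1) * c" using pos R by simp
      ultimately have "(q + 1) * (E t)\<^sup>2 \<le> w3 * c * (E t)\<^sup>2" by (intro mult_right_mono) auto
      moreover have "2 * \<alpha> * (u 0 t * b t - Nu t) / \<alpha> = 2 * (u 0 t * b t - Nu t)" using pos by simp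
      ultimately show ?thesis
        using e1 e2 e3 e4 D4(2) unfolding D_def F_def by (simp add: algebra_simps)
    qed
    moreover have "- F t \<le> - (1 / K) * V t" using upper[OF t] K0 by (simp add: field_simps)
    ultimately show ?thesis by force
  qed
  define V' where "V' t = (SOME D. (V has_real_derivative D) (at t) \<and> D \<le> - (1 / K) * V t)" for t
  have V': "(V has_real_derivative V' t) (at t)" "V' t \<le> - (1 / K) * V t" if "0 < t" for t
    using someI_ex[OF deriv[OF that]] by (simp_all add: V'_def)
  have "continuous_on {0..} V"
    unfolding V_def[abs_def]
    by (intro continuous_intros continuous_energies corner_squares continuous_b) (use pos in auto)
  then have decay: "V t \<le> exp (- (1 / K) * t) * V 0"
    by (rule exponential_decay[OF _ V']) (use t in auto)
  have final: "state_norm t \<le> 2 * K2 * V t"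
  proof -
    have N: "0 \<le> Np t" "0 \<le> Nu t" using nonneg t by auto
    have "s t - s_r = \<beta> * (E t - U t / \<alpha>)" using pos by (simp add: E_def)
    then have eq: "(s t - s_r)\<^sup>2 = \<beta>\<^sup>2 * (E t - U t / \<alpha>)\<^sup>2" by (simp add: power_mult_distrib)
    have "(E t - U t / \<alpha>)\<^sup>2 \<le> 2 * ((E t)\<^sup>2 + (U t / \<alpha>)\<^sup>2)"
      using zero_le_power2[of "E t + U t / \<alpha>"] by (simp add: power2_sum power2_diff)
    also have "(U t / \<alpha>)\<^sup>2 \<le> r * Nu t"
      using divide_right_mono[OF energy_bounds(5)[OF t], of "\<alpha>\<^sup>2"] by (simp add: power_divide r_alpha)
    finally have "\<beta>\<^sup>2 * (E t - U t / \<alpha>)\<^sup>2 \<le> \<beta>\<^sup>2 * (2 * ((E t)\<^sup>2 + r * Nu t))" by (intro mult_left_mono) auto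
    then have "(s t - s_r)\<^sup>2 \<le> 2 * \<beta>\<^sup>2 * (E t)\<^sup>2 + 2 * \<beta>\<^sup>2 * r * Nu t" unfolding eq by (simp add: algebra_simps)
    then have "state_norm t \<le> (s_r\<^sup>2 + 1) * Np t + 2 * \<beta>\<^sup>2 * (E t)\<^sup>2 + (s_r\<^sup>2 + 1 + 2 * \<beta>\<^sup>2 * r) * Nu t"
      unfolding state_norm_def using energy_bounds(1,2)[OF t] by (simp add: algebra_simps)
    also have "\<dots> \<le> K2 * Np t + K2 * (E t)\<^sup>2 + K2 * Nu t"
      using N cst by (intro add_mono mult_right_mono) (auto simp: K2)
    also have "\<dots> = K2 * (Np t + (E t)\<^sup>2 + Nu t)" by (simp add: algebra_simps)
    also have "\<dots> \<le> K2 * (2 * V t)"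
    proof (rule mult_left_mono)
      show "Np t + (E t)\<^sup>2 + Nu t \<le> 2 * V t" using lower[OF t] N zero_le_power2[of "E t"] by linarith
    qed (use cst in \<open>simp add: K2\<close>)
    finally show ?thesis by simp
  qed
  have init: "V 0 \<le> K3 * state_norm 0"
  proof -
    note N0 = nonneg_init
    have "(U 0)\<^sup>2 \<le> (s 0 - 0) * Lu 0"
      unfolding Lu_def by (rule square_integral_le[OF continuous_slice_0[OF cont_u order_refl] s_nonneg[OF order_refl]])
    also have "\<dots> \<le> s_r * Lu 0" using s_le[of 0] N0 by (intro mult_right_mono) auto
    finally have "(U 0 / \<alpha>)\<^sup>2 \<le> s_r / \<alpha>\<^sup>2 * Lu 0"
      using pos by (simp add: power_divide divide_right_mono)
    moreover have "(E 0)\<^sup>2 \<le> 2 * ((U 0 / \<alpha>)\<^sup>2 + ((s 0 - s_r) / \<beta>)\<^sup>2)"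
      unfolding E_def using zero_le_power2[of "U 0 / \<alpha> - (s 0 - s_r) / \<beta>"] by (simp add: power2_sum power2_diff)
    ultimately have "(E 0)\<^sup>2 \<le> 2 * s_r / \<alpha>\<^sup>2 * Lu 0 + 2 / \<beta>\<^sup>2 * (s 0 - s_r)\<^sup>2"
      by (simp add: power_divide)
    also have "\<dots> \<le> 2 * s_r / \<alpha>\<^sup>2 * state_norm 0 + 2 / \<beta>\<^sup>2 * state_norm 0"
      using N0 R pos by (intro add_mono mult_left_mono) (auto simp: state_norm_def)
    finally have "w3 * (E 0)\<^sup>2 \<le> w3 * (2 * s_r / \<alpha>\<^sup>2 * state_norm 0 + 2 / \<beta>\<^sup>2 * state_norm 0)"
      using cst by (intro mult_left_mono)
    moreover have "w1 * Lp 0 \<le> w1 * state_norm 0" "w2 * Np 0 \<le> w2 * state_norm 0" "1 / \<alpha> * Lu 0 \<le> 1 / \<alpha> * state_norm 0" "Nu 0 \<le> state_norm 0"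
      using N0 cst \<open>0 \<le> w1\<close> pos by (auto simp: state_norm_def intro!: mult_left_mono divide_right_mono)
    moreover have "0 \<le> b 0 * u 0 0" using b_init u_init[of 0] s_pos[of 0] by simp
    ultimately show ?thesis unfolding V_def K3 by (simp add: algebra_simps)
  qed
  have "0 \<le> K2" using cst by (simp add: K2)
  have "state_norm t \<le> 2 * K2 * (exp (- (1 / K) * t) * (K3 * state_norm 0))"
    by (rule order_trans[OF final]) (use decay init \<open>0 \<le> K2\<close> in \<open>auto intro!: mult_left_mono intro: order_trans\<close>)
  then show ?thesis by (simp add: mult_ac)
qed

end

section \<open>Solutions of the closed-loop system\<close>

lemma classical_fieldD:
  assumes f: "classical_field s f"
  shows "continuous_on (moving_domain s) (\<lambda>(x, t). f x t)"
    "\<And>t x. 0 \<le> t \<Longrightarrow> x \<in> {0..s t} \<Longrightarrow> ((\<lambda>y. f y t) has_real_derivative space_deriv s f x t) (at x within {0..s t})"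
    "continuous_on (moving_domain s - {(0, 0)}) (\<lambda>(x, t). space_deriv s f x t)"
    "\<exists>B. \<forall>(x, t)\<in>moving_domain s. t \<le> 1 \<longrightarrow> \<bar>space_deriv s f x t\<bar> \<le> B"
    "\<And>t x. 0 < t \<Longrightarrow> x \<in> {0..s t} \<Longrightarrow> ((\<lambda>y. space_deriv s f y t) has_real_derivative space_deriv s (space_deriv s f) x t) (at x within {0..s t})"
    "continuous_on (evolution_domain s) (\<lambda>(x, t). f x t)"
    "continuous_on (evolution_domain s) (\<lambda>(x, t). space_deriv s f x t)"
    "continuous_on (evolution_domain s) (\<lambda>(x, t). space_deriv s (space_deriv s f) x t)"
proof -
  have ev: "evolution_domain s = {(x, t) \<in> moving_domain s. 0 < t}" "evolution_domain s \<subseteq> moving_domain s - {(0, 0)}"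
    by (auto simp: evolution_domain_def moving_domain_def)
  show 1: "continuous_on (moving_domain s) (\<lambda>(x, t). f x t)"
    and 2: "continuous_on (moving_domain s - {(0, 0)}) (\<lambda>(x, t). space_deriv s f x t)"
    and "\<exists>B. \<forall>(x, t)\<in>moving_domain s. t \<le> 1 \<longrightarrow> \<bar>space_deriv s f x t\<bar> \<le> B"
    and "continuous_on (evolution_domain s) (\<lambda>(x, t). space_deriv s (space_deriv s f) x t)"
    using f unfolding classical_field_def ev(1) by blast+
  show "continuous_on (evolution_domain s) (\<lambda>(x, t). f x t)" "continuous_on (evolution_domain s) (\<lambda>(x, t). space_deriv s f x t)"
    using 1 2 ev(2) by (auto intro: continuous_on_subset)
  show "((\<lambda>y. f y t) has_real_derivative space_deriv s f x t) (at x within {0..s t})" if "0 \<le> t" "x \<in> {0..s t}" for t x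
  proof -
    have "(\<lambda>y. f y t) differentiable (at x within {0..s t})"
      using f that unfolding classical_field_def moving_domain_def by auto
    then show ?thesis
      by (simp add: vector_derivative_works has_real_derivative_iff_has_vector_derivative space_deriv_def)
  qed
  show "((\<lambda>y. space_deriv s f y t) has_real_derivative space_deriv s (space_deriv s f) x t) (at x within {0..s t})" if "0 < t" "x \<in> {0..s t}" for t x
  proof -
    have "(\<lambda>y. space_deriv s f y t) differentiable (at x within {0..s t})"
      using f that unfolding classical_field_def moving_domain_def by auto
    then show ?thesis
      by (simp add: vector_derivative_works has_real_derivative_iff_has_vector_derivative space_deriv_def[of s "space_deriv s f"])
  qed
qed

lemma space_deriv_eq:
  assumes "((\<lambda>y. f y t) has_real_derivative D) (at x within {0..s t})" "x \<in> {0..s t}" "0 < s t"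
  shows "space_deriv s f x t = D"
  unfolding space_deriv_def
  using vector_derivative_within_cbox[of 0 "s t" x "\<lambda>y. f y t" D] assms
  by (simp add: has_real_derivative_iff_has_vector_derivative)

lemma observer_gain_eq:
  assumes "0 < \<alpha>" "0 < lam" "0 \<le> x" "x \<le> L"
  shows "observer_gain \<alpha> lam x L = - (2 * \<alpha> * L * bkernel (lam / (4 * \<alpha>)) (L\<^sup>2 - x\<^sup>2))"
proof -
  have "0 \<le> lam / \<alpha> * (L\<^sup>2 - x\<^sup>2)" using assms by (intro mult_nonneg_nonneg) (auto intro: power_mono)
  from bessel_I1_quot_sqrt[OF this] show ?thesis
    using assms by (simp add: observer_gain_def bkernel_def field_simps)
qed

text \<open>Stefan condition and observer equation combine to the error equation: the injected residual
\<open>s' / \<beta> + That_x(s, t)\<close> is the error flux at the interface. The bounds on the initial estimate, on \<open>lam\<close>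
and on \<open>s_r\<close> supply the initial conditions of \<open>closed_loop_fields\<close>.\<close>

lemma closed_loop_fields_of_solution:
  fixes \<alpha> \<beta> k Tm c lam s_r s0 H Hhat :: real
  assumes pos: "\<alpha> > 0" "\<beta> > 0" "k > 0" "c > 0" "lam > 0" and s0: "s0 > 0" and H: "H > 0" "Hhat > H"
    and T0: "\<forall>x\<in>{0..s0}. 0 \<le> T0 x - Tm \<and> T0 x - Tm \<le> H * (s0 - x)"
    and That0: "\<forall>x\<in>{0..s0}. That0 x = Tm + Hhat * (s0 - x)"
    and lam: "lam < 4 * \<alpha> / s0\<^sup>2 * (1 - H / Hhat)"
    and s_r: "s_r > s0 + \<beta> * s0\<^sup>2 / (2 * \<alpha>) * Hhat"
    and sol: "closed_loop_solution \<alpha> \<beta> k Tm c lam s_r s0 T0 That0 s T That"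
  defines "px \<equiv> \<lambda>x t. space_deriv s That x t - space_deriv s T x t"
    and "pxx \<equiv> \<lambda>x t. space_deriv s (space_deriv s That) x t - space_deriv s (space_deriv s T) x t"
    and "a \<equiv> lam / (4 * \<alpha>)"
  shows "closed_loop_fields s (\<lambda>t. - \<beta> * space_deriv s T (s t) t) \<alpha> \<beta> c a s_r
           (\<lambda>x t. T x t - Tm) (space_deriv s T) (space_deriv s (space_deriv s T))
           (\<lambda>x t. That x t - T x t) px pxx
           (\<lambda>x t. \<alpha> * pxx x t + 2 * \<alpha> * s t * bkernel a ((s t)\<^sup>2 - x\<^sup>2) * px (s t) t)
           (\<lambda>t. control_law \<alpha> \<beta> k Tm c s_r (\<lambda>x. That x t) (s t) / k)"
proof -
  let ?Tx = "space_deriv s T" and ?Thx = "space_deriv s That"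
  let ?Txx = "space_deriv s ?Tx" and ?Thxx = "space_deriv s ?Thx"
  let ?ctrl = "\<lambda>t. control_law \<alpha> \<beta> k Tm c s_r (\<lambda>x. That x t) (s t)"
  define q where "q t = ?ctrl t" for t
  from sol have st: "stefan_solution \<alpha> \<beta> k Tm q s0 T0 s T" and ob: "observer_solution \<alpha> \<beta> k Tm lam q That0 s That"
    unfolding closed_loop_solution_def q_def[abs_def] by (simp_all add: Let_def)
  have s_pos: "\<And>t. 0 \<le> t \<Longrightarrow> 0 < s t" and cT: "classical_field s T"
    and eT: "evolves_by s T (\<lambda>x t. \<alpha> * ?Txx x t)"
    and qT: "\<And>t. 0 < t \<Longrightarrow> - k * ?Tx 0 t = q t" and Te: "\<And>t. 0 \<le> t \<Longrightarrow> T (s t) t = Tm"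
    and ds: "\<And>t. 0 \<le> t \<Longrightarrow> (s has_real_derivative (- \<beta> * ?Tx (s t) t)) (at t within {0..})"
    and s_0: "s 0 = s0" and T_0: "\<And>x. x \<in> {0..s0} \<Longrightarrow> T x 0 = T0 x"
    using st unfolding stefan_solution_def by auto
  have cTh: "classical_field s That"
    and eTh: "evolves_by s That (\<lambda>x t. \<alpha> * ?Thxx x t
        - observer_gain \<alpha> lam x (s t) * (deriv s t / \<beta> + ?Thx (s t) t))"
    and qTh: "\<And>t. 0 < t \<Longrightarrow> - k * ?Thx 0 t = q t" and The: "\<And>t. 0 \<le> t \<Longrightarrow> That (s t) t = Tm"
    and Th_0: "\<And>x. x \<in> {0..s0} \<Longrightarrow> That x 0 = That0 x"
    using ob s_0 unfolding observer_solution_def by auto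
  note DT = classical_fieldD[OF cT] and DTh = classical_fieldD[OF cTh]
  have cs: "continuous_on {0..} s"
    using ds by (meson DERIV_continuous atLeast_iff continuous_on_eq_continuous_within)
  have end_cont: "continuous_on {0..} (\<lambda>t. g (s t) t)"
    if "continuous_on (moving_domain s - {(0, 0)}) (\<lambda>(x, t). g x t)" for g :: "real \<Rightarrow> real \<Rightarrow> real"
    by (rule continuous_on_compose_field[OF that])
       (use s_pos in \<open>auto simp: moving_domain_def less_imp_le less_imp_neq[symmetric] intro!: continuous_intros cs\<close>)
  have aa: "0 < a" "a * s0\<^sup>2 \<le> 1 - H / Hhat"
  proof -
    show "0 < a" using pos by (simp add: a_def)
    have "lam * s0\<^sup>2 < 4 * \<alpha> * (1 - H / Hhat)" using lam s0 by (simp add: field_simps)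
    then show "a * s0\<^sup>2 \<le> 1 - H / Hhat" using pos by (simp add: a_def field_simps)
  qed
  interpret moving_interval s "\<lambda>t. - \<beta> * ?Tx (s t) t"
    by unfold_locales (use s_pos ds end_cont[OF DT(3)] in \<open>auto intro!: continuous_intros\<close>)
  have qk: "q t / k = c * ((s_r - s t) / \<beta> - (integral {0..s t} (\<lambda>x. T x t - Tm) + integral {0..s t} (\<lambda>x. That x t - T x t)) / \<alpha>)"
    if t: "0 \<le> t" for t
  proof -
    have sl: "continuous_on {0..s t} (\<lambda>x. T x t)" "continuous_on {0..s t} (\<lambda>x. That x t)"
      using DT(2)[OF t] DTh(2)[OF t] by (meson DERIV_continuous continuous_on_eq_continuous_within)+
    have "integral {0..s t} (\<lambda>x. T x t - Tm) + integral {0..s t} (\<lambda>x. That x t - T x t)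
       = integral {0..s t} (\<lambda>x. (T x t - Tm) + (That x t - T x t))"
      by (intro integral_add[symmetric] integrable_continuous_interval continuous_intros sl)
    then have "integral {0..s t} (\<lambda>x. T x t - Tm) + integral {0..s t} (\<lambda>x. That x t - T x t) = integral {0..s t} (\<lambda>x. That x t - Tm)"
      by simp
    then show ?thesis unfolding q_def control_law_def using pos by (simp add: field_simps)
  qed
  have C1_T: "C1_field s (\<lambda>x t. T x t - Tm) (?Tx) (\<lambda>x t. \<alpha> * ?Txx x t)"
    unfolding C1_field_def
  proof (intro conjI allI impI ballI)
    show "continuous_on (evolution_domain s) (\<lambda>(x, t). T x t - Tm)" "continuous_on (evolution_domain s) (\<lambda>(x, t). \<alpha> * ?Txx x t)"
      using DT(6,8) by (simp_all add: case_prod_beta continuous_on_diff continuous_on_mult)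
    fix t x assume t: "0 < t" and x: "x \<in> {0..s t}"
    show "((\<lambda>y. T y t - Tm) has_real_derivative ?Tx x t) (at x within {0..s t})"
      using DERIV_diff[OF DT(2)[OF less_imp_le[OF t] x] DERIV_const] by simp
    have "((\<lambda>\<tau>. T x \<tau>) has_real_derivative \<alpha> * ?Txx x t) (at t within {\<tau>. (x, \<tau>) \<in> moving_domain s})"
      using eT t x unfolding evolves_by_def moving_domain_def by auto
    from DERIV_diff[OF this DERIV_const]
    show "((\<lambda>\<tau>. T x \<tau> - Tm) has_real_derivative \<alpha> * ?Txx x t) (at t within {\<tau>. (x, \<tau>) \<in> moving_domain s})"
      by simp
  qed (rule DT(7))
  have cpx: "continuous_on (moving_domain s - {(0, 0)}) (\<lambda>(x, t). px x t)"
    using DT(3) DTh(3) by (simp add: px_def case_prod_beta continuous_on_diff)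
  have cpxx: "continuous_on (evolution_domain s) (\<lambda>(x, t). pxx x t)"
    using DT(8) DTh(8) by (simp add: pxx_def case_prod_beta continuous_on_diff)
  have C1_p: "C1_field s (\<lambda>x t. That x t - T x t) px
      (\<lambda>x t. \<alpha> * pxx x t + 2 * \<alpha> * s t * bkernel a ((s t)\<^sup>2 - x\<^sup>2) * px (s t) t)"
    unfolding C1_field_def
  proof (intro conjI allI impI ballI)
    show "continuous_on (evolution_domain s) (\<lambda>(x, t). That x t - T x t)" "continuous_on (evolution_domain s) (\<lambda>(x, t). px x t)"
      using DT(6,7) DTh(6,7) by (simp_all add: px_def case_prod_beta continuous_on_diff)
    have "continuous_on (evolution_domain s) (\<lambda>z. s (snd z))" "continuous_on (evolution_domain s) (\<lambda>z. px (s (snd z)) (snd z))"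
      by (rule continuous_on_compose2[OF cs] continuous_on_compose2[OF end_cont[OF cpx]];
          auto simp: evolution_domain_def intro!: continuous_intros)+
    moreover have "continuous_on (evolution_domain s) (\<lambda>z. pxx (fst z) (snd z))" using cpxx by (simp add: case_prod_beta)
    ultimately have "continuous_on (evolution_domain s)
        (\<lambda>z. \<alpha> * pxx (fst z) (snd z) + 2 * \<alpha> * s (snd z) * bkernel a ((s (snd z))\<^sup>2 - (fst z)\<^sup>2) * px (s (snd z)) (snd z))"
      by (intro continuous_intros)
    then show "continuous_on (evolution_domain s) (\<lambda>(x, t). \<alpha> * pxx x t + 2 * \<alpha> * s t * bkernel a ((s t)\<^sup>2 - x\<^sup>2) * px (s t) t)"
      by (simp add: case_prod_beta)
    fix t x assume t: "0 < t" and x: "x \<in> {0..s t}"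
    show "((\<lambda>y. That y t - T y t) has_real_derivative px x t) (at x within {0..s t})"
      unfolding px_def by (rule DERIV_diff[OF DTh(2)[OF less_imp_le[OF t] x] DT(2)[OF less_imp_le[OF t] x]])
    have "((\<lambda>\<tau>. T x \<tau>) has_real_derivative \<alpha> * ?Txx x t) (at t within {\<tau>. (x, \<tau>) \<in> moving_domain s})"
      "((\<lambda>\<tau>. That x \<tau>) has_real_derivative \<alpha> * ?Thxx x t
        - observer_gain \<alpha> lam x (s t) * (deriv s t / \<beta> + ?Thx (s t) t)) (at t within {\<tau>. (x, \<tau>) \<in> moving_domain s})"
      using eT eTh t x unfolding evolves_by_def moving_domain_def by auto
    from DERIV_diff[OF this(2) this(1)]
    show "((\<lambda>\<tau>. That x \<tau> - T x \<tau>) has_real_derivative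
        \<alpha> * pxx x t + 2 * \<alpha> * s t * bkernel a ((s t)\<^sup>2 - x\<^sup>2) * px (s t) t) (at t within {\<tau>. (x, \<tau>) \<in> moving_domain s})"
    proof (rule DERIV_cong)
      have "deriv s t = - \<beta> * ?Tx (s t) t" by (rule DERIV_imp_deriv[OF DERIV_s[OF t]])
      then have 1: "deriv s t / \<beta> + ?Thx (s t) t = px (s t) t" using pos by (simp add: px_def)
      have 2: "observer_gain \<alpha> lam x (s t) = - (2 * \<alpha> * s t * bkernel a ((s t)\<^sup>2 - x\<^sup>2))"
        unfolding a_def by (rule observer_gain_eq) (use pos x in auto)
      show "\<alpha> * ?Thxx x t
        - observer_gain \<alpha> lam x (s t) * (deriv s t / \<beta> + ?Thx (s t) t) - \<alpha> * ?Txx x t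
        = \<alpha> * pxx x t + 2 * \<alpha> * s t * bkernel a ((s t)\<^sup>2 - x\<^sup>2) * px (s t) t"
        unfolding 1 2 by (simp add: pxx_def algebra_simps)
    qed
  qed
  show ?thesis
  proof unfold_locales
    show "0 < \<alpha>" "0 < \<beta>" "0 < c" "0 < a" by (fact pos aa)+
    show "continuous_on (moving_domain s) (\<lambda>(x, t). T x t - Tm)" "continuous_on (moving_domain s) (\<lambda>(x, t). That x t - T x t)"
      using DT(1) DTh(1) by (simp_all add: case_prod_beta continuous_on_diff)
    obtain B1 B2 where "\<forall>(x, t)\<in>moving_domain s. t \<le> 1 \<longrightarrow> \<bar>?Tx x t\<bar> \<le> B1"
      "\<forall>(x, t)\<in>moving_domain s. t \<le> 1 \<longrightarrow> \<bar>?Thx x t\<bar> \<le> B2" using DT(4) DTh(4) by blast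
    then have "\<forall>(x, t)\<in>moving_domain s. t \<le> 1 \<longrightarrow> \<bar>px x t\<bar> \<le> B1 + B2" unfolding px_def by fastforce
    then show "\<exists>B. \<forall>(x, t)\<in>moving_domain s. t \<le> 1 \<longrightarrow> \<bar>px x t\<bar> \<le> B" by blast
    show "((\<lambda>y. px y t) has_real_derivative pxx x t) (at x within {0..s t})" if "0 < t" "x \<in> {0..s t}" for t x
      unfolding px_def pxx_def by (rule DERIV_diff[OF DTh(5)[OF that] DT(5)[OF that]])
    show "T (s t) t - Tm = 0" "That (s t) t - T (s t) t = 0" if "0 \<le> t" for t using Te[OF that] The[OF that] by simp_all
    show "px 0 t = 0" "?Tx 0 t = - (?ctrl t / k)" if "0 < t" for t
    proof -
      have "q t / k = - ?Tx 0 t" "q t / k = - ?Thx 0 t"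
        using qT[OF that] qTh[OF that] pos by (auto simp: divide_eq_eq mult.commute)
      then show "px 0 t = 0" "?Tx 0 t = - (?ctrl t / k)"
        unfolding q_def[symmetric] px_def by simp_all
    qed
    show "?ctrl t / k
       = c * ((s_r - s t) / \<beta> - (integral {0..s t} (\<lambda>x. T x t - Tm) + integral {0..s t} (\<lambda>x. That x t - T x t)) / \<alpha>)" if "0 \<le> t" for t
      using qk[OF that] by (simp add: q_def)
    show "0 \<le> T x 0 - Tm" if "x \<in> {0..s 0}" for x using T0 T_0 that s_0 by simp
    show "0 \<le> That x 0 - T x 0 + volterra (bkernel (- a)) (s 0) (\<lambda>x. That x 0 - T x 0) x" if x: "x \<in> {0..s 0}" for x
    proof (rule backstepping_transform_nonneg[where L = "s 0" and H = H and Hhat = Hhat])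
      have "continuous_on {0..s 0} (\<lambda>x. T x 0)" "continuous_on {0..s 0} (\<lambda>x. That x 0)"
        using DT(2)[of 0] DTh(2)[of 0] by (meson DERIV_continuous continuous_on_eq_continuous_within order_refl)+
      then show "continuous_on {0..s 0} (\<lambda>x. That x 0 - T x 0)" by (intro continuous_intros)
      show "(Hhat - H) * (s 0 - x) \<le> That x 0 - T x 0 \<and> That x 0 - T x 0 \<le> Hhat * (s 0 - x)" if "x \<in> {0..s 0}" for x
      proof -
        have x: "x \<in> {0..s0}" using that s_0 by simp
        then show ?thesis using bspec[OF T0 x] bspec[OF That0 x] T_0[OF x] Th_0[OF x] s_0 by (simp add: algebra_simps)
      qed
    qed (use aa H s_0 x in auto)
    show "0 \<le> control_law \<alpha> \<beta> k Tm c s_r (\<lambda>x. That x 0) (s 0) / k"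
    proof -
      have "integral {0..s0} (\<lambda>x. That x 0 - Tm) = integral {0..s0} (\<lambda>x. Hhat * (s0 - x))"
        by (rule integral_cong) (simp add: Th_0 That0)
      also have "\<dots> = Hhat * s0\<^sup>2 / 2"
      proof -
        have "((\<lambda>x. Hhat * (s0 - x)) has_integral (- Hhat * (s0 - s0)\<^sup>2 / 2 - (- Hhat * (s0 - 0)\<^sup>2 / 2))) {0..s0}"
        proof (rule has_integral_derivative)
          fix x
          show "((\<lambda>x. - Hhat * (s0 - x)\<^sup>2 / 2) has_real_derivative Hhat * (s0 - x)) (at x within {0..s0})"
            by (rule derivative_eq_intros refl)+ (simp_all add: field_simps)
        qed (use s0 in simp)
        from integral_unique[OF this] show ?thesis by (simp only:) simp
      qed
      finally have I: "integral {0..s0} (\<lambda>x. That x 0 - Tm) = Hhat * s0\<^sup>2 / 2" .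
      have "\<beta> * (Hhat * s0\<^sup>2 / 2 / \<alpha>) \<le> s_r - s0" using s_r by (simp add: mult_ac)
      then have "Hhat * s0\<^sup>2 / 2 / \<alpha> \<le> (s_r - s0) / \<beta>" using pos by (simp only: pos_le_divide_eq mult.commute)
      then have "0 \<le> c * ((s_r - s0) / \<beta> - Hhat * s0\<^sup>2 / 2 / \<alpha>)" using pos by simp
      also have "\<dots> = control_law \<alpha> \<beta> k Tm c s_r (\<lambda>x. That x 0) (s 0) / k"
        using pos unfolding control_law_def s_0 I by (simp add: field_simps)
      finally show ?thesis .
    qed
  qed (simp_all add: C1_T C1_p DT DTh cpx cpxx)
qed

lemma closed_loop_norm_eq_state_norm:
  assumes F: "closed_loop_fields s s' \<alpha> \<beta> c a s_r (\<lambda>x t. T x t - Tm) (space_deriv s T) uxx (\<lambda>x t. That x t - T x t)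
      (\<lambda>x t. space_deriv s That x t - space_deriv s T x t) pxx pt b"
    and cT: "classical_field s T" and cTh: "classical_field s That" and t: "0 \<le> t"
  shows "closed_loop_norm Tm s_r s T That t =
     closed_loop_fields.state_norm s s_r (\<lambda>x t. T x t - Tm) (space_deriv s T) (\<lambda>x t. That x t - T x t)
      (\<lambda>x t. space_deriv s That x t - space_deriv s T x t) t"
proof -
  interpret F: closed_loop_fields s s' \<alpha> \<beta> c a s_r "\<lambda>x t. T x t - Tm" "space_deriv s T" uxx "\<lambda>x t. That x t - T x t"
      "\<lambda>x t. space_deriv s That x t - space_deriv s T x t" pxx pt b by (rule F)
  note DT = classical_fieldD(2)[OF cT] and DTh = classical_fieldD(2)[OF cTh]
  have sd: "space_deriv s (\<lambda>x t. T x t - That x t) x t = - (space_deriv s That x t - space_deriv s T x t)"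
    "space_deriv s (\<lambda>x t. T x t - Tm) x t = space_deriv s T x t" if x: "x \<in> {0..s t}" for x
  proof -
    have "((\<lambda>y. T y t - That y t) has_real_derivative - (space_deriv s That x t - space_deriv s T x t)) (at x within {0..s t})"
      using DERIV_diff[OF DT[OF t x] DTh[OF t x]] by simp
    then show "space_deriv s (\<lambda>x t. T x t - That x t) x t = - (space_deriv s That x t - space_deriv s T x t)"
      by (rule space_deriv_eq) (use x F.s_pos[OF t] in auto)
    have "((\<lambda>y. T y t - Tm) has_real_derivative space_deriv s T x t) (at x within {0..s t})"
      using DERIV_diff[OF DT[OF t x] DERIV_const] by simp
    then show "space_deriv s (\<lambda>x t. T x t - Tm) x t = space_deriv s T x t"
      by (rule space_deriv_eq) (use x F.s_pos[OF t] in auto)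
  qed
  have int: "(\<lambda>x. (That x t - T x t)\<^sup>2) integrable_on {0..s t}" "(\<lambda>x. (T x t - Tm)\<^sup>2) integrable_on {0..s t}"
    using F.continuous_slice_0[OF F.cont_p t] F.continuous_slice_0[OF F.cont_u t]
    by (intro integrable_continuous_interval continuous_on_power; simp)+
  have intx: "(\<lambda>x. (space_deriv s That x t - space_deriv s T x t)\<^sup>2) integrable_on {0..s t} \<and> (\<lambda>x. (space_deriv s T x t)\<^sup>2) integrable_on {0..s t}"
  proof (cases "t = 0")
    case True
    then show ?thesis using F.corner_squares(3,4) by simp
  next
    case False
    then have "0 < t" using t by simp
    from F.slices(2,5)[OF this] show ?thesis by (intro conjI integrable_continuous_interval continuous_on_power)
  qed
  have "h1_norm_sq s (\<lambda>x t. T x t - That x t) t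
      = integral {0..s t} (\<lambda>x. (That x t - T x t)\<^sup>2 + (space_deriv s That x t - space_deriv s T x t)\<^sup>2)"
    unfolding h1_norm_sq_def by (rule integral_cong) (simp add: sd power2_commute)
  also have "\<dots> = F.Lp t + F.Np t" unfolding F.Lp_def F.Np_def by (rule integral_add) (use int intx in auto)
  finally have 1: "h1_norm_sq s (\<lambda>x t. T x t - That x t) t = F.Lp t + F.Np t" .
  have "h1_norm_sq s (\<lambda>x t. T x t - Tm) t = integral {0..s t} (\<lambda>x. (T x t - Tm)\<^sup>2 + (space_deriv s T x t)\<^sup>2)"
    unfolding h1_norm_sq_def by (rule integral_cong) (simp add: sd)
  also have "\<dots> = F.Lu t + F.Nu t" unfolding F.Lu_def F.Nu_def by (rule integral_add) (use int intx in auto)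
  finally have 2: "h1_norm_sq s (\<lambda>x t. T x t - Tm) t = F.Lu t + F.Nu t" .
  show ?thesis unfolding closed_loop_norm_def 1 2 F.state_norm_def by simp
qed

theorem theorem3:
  fixes \<alpha> \<beta> k Tm c lam s_r :: real
  assumes "\<alpha> > 0" and "\<beta> > 0" and "k > 0" and "c > 0" and "lam > 0"
  shows "\<exists>M>0. \<exists>\<kappa>>0. \<forall>s0 H Hhat T0 That0 s T That.
           compatible \<alpha> \<beta> k Tm c s_r That0 s0 \<longrightarrow>
           s0 > 0 \<longrightarrow>
           H > 0 \<longrightarrow>
           (\<forall>x\<in>{0..s0}. 0 \<le> T0 x - Tm \<and> T0 x - Tm \<le> H * (s0 - x)) \<longrightarrow>
           Hhat > H \<longrightarrow>
           (\<forall>x\<in>{0..s0}. That0 x = Tm + Hhat * (s0 - x)) \<longrightarrow>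
           lam < 4 * \<alpha> / s0\<^sup>2 * (1 - H / Hhat) \<longrightarrow>
           s_r > s0 + \<beta> * s0\<^sup>2 / (2 * \<alpha>) * Hhat \<longrightarrow>
           closed_loop_solution \<alpha> \<beta> k Tm c lam s_r s0 T0 That0 s T That \<longrightarrow>
           (\<forall>t\<ge>0. closed_loop_norm Tm s_r s T That t
                     \<le> M * exp (- \<kappa> * t) * closed_loop_norm Tm s_r s T That 0)"
proof -
  define a where "a = lam / (4 * \<alpha>)"
  (* For s_r \<le> 0 there are no admissible data; the absolute value keeps the weights nonnegative. *)
  define R where "R = \<bar>s_r\<bar>"
  define C where "C = 4 * \<alpha> * R ^ 4 * (bkernel' a (R\<^sup>2))\<^sup>2 / a"
  define r where "r = R ^ 3 / \<alpha>\<^sup>2"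
  define q where "q = 2 * c\<^sup>2 * ((1 + c)\<^sup>2 * R)"
  define w2 where "w2 = 1 + 4 * R * c\<^sup>2 * r"
  define w3 where "w3 = (q + 1) / c + 4 * R * c\<^sup>2 + 1"
  define w1 where "w1 = (1 + w2 * C + w3 * c * r + q * r) / (2 * \<alpha>)"
  define K where "K = w1 * R\<^sup>2 + w2 + w3 + R\<^sup>2 / \<alpha> + 1"
  define K2 where "K2 = R\<^sup>2 + 1 + 2 * \<beta>\<^sup>2 + 2 * \<beta>\<^sup>2 * r"
  define K3 where "K3 = w1 + w2 + w3 * (2 * R / \<alpha>\<^sup>2 + 2 / \<beta>\<^sup>2) + 1 / \<alpha> + 1"
  have R: "0 \<le> R" by (simp add: R_def)
  have cst: "0 \<le> C" "0 \<le> r" "0 \<le> q" "0 \<le> w2" "0 \<le> w3" using assms R by (simp_all add: C_def r_def q_def w2_def w3_def a_def)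
  then have "0 \<le> w1" using assms by (simp add: w1_def)
  then have K: "0 < K" "0 \<le> K2" "0 \<le> K3" using cst assms R by (simp_all add: K_def K2_def K3_def add_nonneg_pos)
  (* The summand 1 covers t = 0, where the decay estimate is not available. *)
  define M where "M = 2 * K2 * K3 + 1"
  have "0 < M" "0 < 1 / K" using K by (simp_all add: M_def add_nonneg_pos)
  show ?thesis
  proof (rule exI[of _ M], rule conjI[OF \<open>0 < M\<close>], rule exI[of _ "1 / K"], rule conjI[OF \<open>0 < 1 / K\<close>], intro allI impI)
    fix s0 H Hhat :: real and T0 That0 s :: "real \<Rightarrow> real" and T That :: "real \<Rightarrow> real \<Rightarrow> real" and t :: real
    assume hyps: "s0 > 0" "H > 0" "Hhat > H"
      "\<forall>x\<in>{0..s0}. 0 \<le> T0 x - Tm \<and> T0 x - Tm \<le> H * (s0 - x)"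
      "\<forall>x\<in>{0..s0}. That0 x = Tm + Hhat * (s0 - x)"
      "lam < 4 * \<alpha> / s0\<^sup>2 * (1 - H / Hhat)"
      "s_r > s0 + \<beta> * s0\<^sup>2 / (2 * \<alpha>) * Hhat"
      and sol: "closed_loop_solution \<alpha> \<beta> k Tm c lam s_r s0 T0 That0 s T That" and t: "0 \<le> t"
    note F = closed_loop_fields_of_solution[OF assms hyps(1-7) sol, folded a_def]
    note loop = closed_loop_fields.s_r_pos[OF F] closed_loop_fields.state_norm_init_nonneg[OF F] closed_loop_fields.lyapunov_decay[OF F]
    let ?N = "closed_loop_norm Tm s_r s T That"
    have "classical_field s T" "classical_field s That"
      using sol unfolding closed_loop_solution_def stefan_solution_def observer_solution_def Let_def by auto
    note norm = closed_loop_norm_eq_state_norm[OF F this]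
    have Req: "R = s_r" using loop(1) by (simp add: R_def)
    have N0: "0 \<le> ?N 0" using loop(2) norm[of 0] by simp
    show "?N t \<le> M * exp (- (1 / K) * t) * ?N 0"
    proof (cases "t = 0")
      case True
      have "1 * ?N 0 \<le> M * ?N 0" using K N0 by (intro mult_right_mono) (auto simp: M_def)
      then show ?thesis using True by simp
    next
      case False
      note weights = C_def r_def q_def w2_def w3_def w1_def K_def K2_def K3_def
      have "?N t \<le> 2 * K2 * K3 * exp (- (1 / K) * t) * ?N 0"
        using loop(3)[OF weights[unfolded Req], of t] t False norm[of t] norm[of 0] by simp
      also have "\<dots> \<le> M * exp (- (1 / K) * t) * ?N 0" using N0 by (intro mult_right_mono) (auto simp: M_def)
      finally show ?thesis .
    qed
  qed
qed

end
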